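(* Let $\mathbb{K}$ be a field, let $n\ge 3$, and let $P_1,\dots,P_n$ be finite bounded posets such that $Z(P_i)=\{0\}$ for all $i$ and $2\le |P_1|\le |P_2|\le\dots\le |P_n|$. Let $\mathbf{P}=\prod_{i=1}^{n}P_i$ be their direct product. Then the following statements are equivalent: (1) $\Gamma(\mathbf{P})$ is Cohen--Macaulay (over $\mathbb{K}$). (2) $\Gamma(\mathbf{P})$ is well-covered. (3) $|P_i|=2$ for all $i=1,2,\dots,n$. (4) $\mathbf{P}$ is a Boolean lattice. (5) $\mathbf{P}$ is a Boolean poset.
   Context: For a poset $P$ and $A\subseteq P$, the upper cone is $A^{u}=\{b\in P : b\ge a \text{ for all } a\in A\}$ and the lower cone is $A^{\ell}=\{b\in P : b\le a\text{ for all }a\in A\}$; $A^{u\ell}=(A^{u})^{\ell}$. A poset is bounded if it has a least element $0$ and a greatest element $1$. In a bounded poset, $a'$ is a complement of $a$ if $\{a,a'\}^{\ell}=\{0\}$ and $\{a,a'\}^{u}=\{1\}$; a bounded poset is complemented if every element has a complement. A poset is distributive if for all $a,b,c\in P$, $(\{a\}\cup\{b,c\}^{u})^{\ell}=(\{a,b\}^{\ell}\cup\{a,c\}^{\ell})^{u\ell}$. A Boolean poset is a bounded poset that is both distributive and complemented. A Boolean lattice is a complemented distributive (bounded) lattice. The direct product $\prod_{i=1}^n P_i$ is ordered componentwise: $a\le b$ iff $a_i\le b_i$ in $P_i$ for every $i$. For a poset $P$ with $0$, the set of zero-divisors is $Z(P)=\{a\in P : \text{there exists } b\in P\setminus\{0\}\text{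 with }\{a,b\}^{\ell}=\{0\}\}$. The zero-divisor graph $\Gamma(P)$ is the simple graph with vertex set $Z(P)\setminus\{0\}$ in which two distinct vertices $a,b$ are adjacent if and only if $\{a,b\}^{\ell}=\{0\}$. A finite simple graph is well-covered if all its maximal (with respect to inclusion) independent sets have the same cardinality. For a finite simple graph $\Gamma$ on vertices $1,\dots,m$ and a field $\mathbb{K}$, the independence complex $\Delta_\Gamma$ is the simplicial complex whose faces are the independent sets of $\Gamma$. Its Stanley--Reisner ring is $\mathbb{K}[\Delta_\Gamma]=\mathbb{K}[x_1,\dots,x_m]/I(\Gamma)$, where $I(\Gamma)=(x_ix_j : \{i,j\}\text{ is an edge of }\Gamma)$. The graph $\Gamma$ is Cohen--Macaulay (over $\mathbb{K}$) if $\mathbb{K}[\Delta_\Gamma]$ is a Cohen--Macaulay ring. *)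

theory Defs
  imports
    "HOL-Algebra.Algebra"
    "HOL-Algebra.Algebraic_Closure_Type"
    "HOL-Library.Poly_Mapping"
    "HOL-Library.Extended_Nat"
begin

section \<open>Posets\<close>

text \<open>
  Posets are order records of HOL-Algebra. The cones are \<^const>\<open>Upper\<close> and \<^const>\<open>Lower\<close>,
  and the elements 0 and 1 are \<^const>\<open>bottom\<close> and \<^const>\<open>top\<close>. The locale
  \<^locale>\<open>partial_order\<close> demands that the equality stored in the record is HOL equality.
\<close>

definition bounded_poset :: "'a gorder \<Rightarrow> bool" where
  "bounded_poset L \<longleftrightarrow>
     partial_order L \<and> weak_partial_order_bottom L \<and> weak_partial_order_top L"

definition is_complement :: "'a gorder \<Rightarrow> 'a \<Rightarrow> 'a \<Rightarrow> bool" where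
  "is_complement L a a' \<longleftrightarrow>
     Lower L {a, a'} = {\<bottom>\<^bsub>L\<^esub>} \<and> Upper L {a, a'} = {\<top>\<^bsub>L\<^esub>}"

definition complemented_poset :: "'a gorder \<Rightarrow> bool" where
  "complemented_poset L \<longleftrightarrow>
     bounded_poset L \<and> (\<forall>a\<in>carrier L. \<exists>a'\<in>carrier L. is_complement L a a')"

definition distributive_poset :: "'a gorder \<Rightarrow> bool" where
  "distributive_poset L \<longleftrightarrow> partial_order L \<and>
     (\<forall>a\<in>carrier L. \<forall>b\<in>carrier L. \<forall>c\<in>carrier L.
        Lower L ({a} \<union> Upper L {b, c}) = Lower L (Upper L (Lower L {a, b} \<union> Lower L {a, c})))"

definition boolean_poset :: "'a gorder \<Rightarrow> bool" where
  "boolean_poset L \<longleftrightarrow> bounded_poset L \<and> distributive_poset L \<and> complemented_poset L"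

definition boolean_lattice :: "'a gorder \<Rightarrow> bool" where
  "boolean_lattice L \<longleftrightarrow> bounded_lattice L \<and>
     (\<forall>a\<in>carrier L. \<forall>b\<in>carrier L. \<forall>c\<in>carrier L.
        a \<sqinter>\<^bsub>L\<^esub> (b \<squnion>\<^bsub>L\<^esub> c) = (a \<sqinter>\<^bsub>L\<^esub> b) \<squnion>\<^bsub>L\<^esub> (a \<sqinter>\<^bsub>L\<^esub> c)) \<and>
     complemented_poset L"

definition product_poset :: "'i set \<Rightarrow> ('i \<Rightarrow> 'a gorder) \<Rightarrow> ('i \<Rightarrow> 'a) gorder" where
  "product_poset I P =
     \<lparr>carrier = (\<Pi>\<^sub>E i\<in>I. carrier (P i)), eq = (=),
      le = (\<lambda>a b. \<forall>i\<in>I. a i \<sqsubseteq>\<^bsub>P i\<^esub> b i)\<rparr>"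

definition poset_zero_divisors :: "'a gorder \<Rightarrow> 'a set" where
  "poset_zero_divisors L =
     {a \<in> carrier L. \<exists>b \<in> carrier L - {\<bottom>\<^bsub>L\<^esub>}. Lower L {a, b} = {\<bottom>\<^bsub>L\<^esub>}}"


section \<open>Simple graphs\<close>

record 'v sgraph =
  vertices :: "'v set"
  edges :: "'v set set"

definition finite_simple_graph :: "'v sgraph \<Rightarrow> bool" where
  "finite_simple_graph G \<longleftrightarrow>
     finite (vertices G) \<and> (\<forall>e\<in>edges G. e \<subseteq> vertices G \<and> card e = 2)"

definition zero_divisor_graph :: "'a gorder \<Rightarrow> 'a sgraph" where
  "zero_divisor_graph L =
     (let V = poset_zero_divisors L - {\<bottom>\<^bsub>L\<^esub>} in
      \<lparr>vertices = V,
       edges = {{a, b} | a b. a \<in> V \<and> b \<in> V \<and> a \<noteq> b \<and> Lower L {a, b} = {\<bottom>\<^bsub>L\<^esub>}}\<rparr>)"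

definition independent_set :: "'v sgraph \<Rightarrow> 'v set \<Rightarrow> bool" where
  "independent_set G S \<longleftrightarrow> S \<subseteq> vertices G \<and> (\<forall>e\<in>edges G. \<not> e \<subseteq> S)"

definition maximal_independent_set :: "'v sgraph \<Rightarrow> 'v set \<Rightarrow> bool" where
  "maximal_independent_set G S \<longleftrightarrow>
     independent_set G S \<and> (\<forall>T. independent_set G T \<and> S \<subseteq> T \<longrightarrow> T = S)"

definition well_covered :: "'v sgraph \<Rightarrow> bool" where
  "well_covered G \<longleftrightarrow> finite_simple_graph G \<and>
     (\<forall>S T. maximal_independent_set G S \<and> maximal_independent_set G T \<longrightarrow> card S = card T)"


section \<open>Cohen--Macaulay rings\<close>

text \<open>
  In \<open>regular_sequence\<close>, the second conjunct says that the class of \<open>xs ! k\<close> is a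
  nonzerodivisor on the quotient of \<open>R\<close> by the ideal generated by \<open>xs ! 0, \<dots>, xs ! (k - 1)\<close>.
\<close>

definition regular_sequence :: "('a, 'm) ring_scheme \<Rightarrow> 'a list \<Rightarrow> bool" where
  "regular_sequence R xs \<longleftrightarrow>
     set xs \<subseteq> carrier R \<and>
     (\<forall>k<length xs. \<forall>r\<in>carrier R.
        r \<otimes>\<^bsub>R\<^esub> (xs ! k) \<in> Idl\<^bsub>R\<^esub> (set (take k xs)) \<longrightarrow> r \<in> Idl\<^bsub>R\<^esub> (set (take k xs))) \<and>
     Idl\<^bsub>R\<^esub> (set xs) \<noteq> carrier R"

definition ideal_depth :: "('a, 'm) ring_scheme \<Rightarrow> 'a set \<Rightarrow> enat" where
  "ideal_depth R I = (SUP xs \<in> {xs. regular_sequence R xs \<and> set xs \<subseteq> I}. enat (length xs))"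

text \<open>
  The height of a prime ideal \<open>M\<close> is the supremum of the lengths \<open>k\<close> of the strictly
  ascending chains \<open>p 0 \<subset> \<dots> \<subset> p k = M\<close> of prime ideals.
\<close>

definition ideal_height :: "('a, 'm) ring_scheme \<Rightarrow> 'a set \<Rightarrow> enat" where
  "ideal_height R M =
     (SUP (k, p) \<in> {(k :: nat, p). (\<forall>i\<le>k. primeideal (p i) R) \<and>
        (\<forall>i<k. p i \<subset> p (Suc i)) \<and> p k = M}. enat k)"

text \<open>
  This is Eisenbud's definition (Commutative Algebra with a View Toward Algebraic Geometry,
  Section 18.2), which is also that of Kaplansky's Macaulay rings: a commutative Noetherian
  ring in which depth and height agree for every maximal ideal. Depth is measured by regular
  sequences of the ring itself, so no localization occurs.
\<close>

definition cohen_macaulay_ring :: "('a, 'm) ring_scheme \<Rightarrow> bool" where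
  "cohen_macaulay_ring R \<longleftrightarrow> cring R \<and> noetherian_ring R \<and>
     (\<forall>M. maximalideal M R \<longrightarrow> ideal_depth R M = ideal_height R M)"


section \<open>Stanley--Reisner rings\<close>

text \<open>
  A monomial is a finitely supported map from variables to exponents, and a polynomial is a
  finitely supported map from monomials to coefficients. The ring \<open>mpoly_ring V\<close> is the
  polynomial ring over \<open>'k\<close> whose variables are indexed by the elements of \<open>V\<close>.
\<close>

definition mpoly_ring :: "'v set \<Rightarrow> (('v \<Rightarrow>\<^sub>0 nat) \<Rightarrow>\<^sub>0 'k::field) ring" where
  "mpoly_ring V =
     ring_of_type_algebra
       \<lparr>carrier := {p. \<forall>m \<in> Poly_Mapping.keys p. Poly_Mapping.keys m \<subseteq> V}\<rparr>"

definition mpoly_var :: "'v \<Rightarrow> ('v \<Rightarrow>\<^sub>0 nat) \<Rightarrow>\<^sub>0 'k::field" where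
  "mpoly_var v = Poly_Mapping.single (Poly_Mapping.single v 1) 1"

definition edge_ideal :: "'v sgraph \<Rightarrow> (('v \<Rightarrow>\<^sub>0 nat) \<Rightarrow>\<^sub>0 'k::field) set" where
  "edge_ideal G =
     Idl\<^bsub>mpoly_ring (vertices G)\<^esub> {mpoly_var i * mpoly_var j | i j. {i, j} \<in> edges G}"

definition stanley_reisner_ring :: "'v sgraph \<Rightarrow> (('v \<Rightarrow>\<^sub>0 nat) \<Rightarrow>\<^sub>0 'k::field) set ring" where
  "stanley_reisner_ring G = mpoly_ring (vertices G) Quot edge_ideal G"

definition cohen_macaulay_graph :: "'k::field itself \<Rightarrow> 'v sgraph \<Rightarrow> bool" where
  "cohen_macaulay_graph _ G \<longleftrightarrow> finite_simple_graph G \<and>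
     cohen_macaulay_ring (stanley_reisner_ring G :: (('v \<Rightarrow>\<^sub>0 nat) \<Rightarrow>\<^sub>0 'k) set ring)"

end

theory Submission
  imports Defs
begin

text \<open>
  A factor has no zero-divisor except its bottom element, so two elements of the product have the
  meet-cone \<open>{bottom}\<close> exactly when their supports, the sets of coordinates that differ from the bottom,
  are disjoint (\<open>disjoint_iff_supp\<close>). The graph is thus the disjointness graph of the proper nonempty
  subsets \<open>A\<close> of the index set, each repeated \<open>\<Prod>i\<in>A. m i\<close> times with \<open>m i = card (P i) - 1\<close>.

  Well-covered implies two-element factors (\<open>well_covered_imp_card_2\<close>): the vertices whose support contains
  \<open>i\<close> form a maximal independent set, and it stays one when the vertices with support \<open>{i}\<close> are exchanged
  for those with the complementary support. Equality of the sizes says \<open>m i = (\<Prod>j\<noteq>i. m j)\<close> for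
  every \<open>i\<close>, and with at least three factors this forces all \<open>m i = 1\<close>.

  Cohen--Macaulay implies well-covered, for every finite graph (\<open>cohen_macaulay_imp_well_covered\<close>): at the
  ideal generated by all variables the height is at least the size of any independent set \<open>T\<close>, by
  a chain of primes generated by variables, and the depth is at most the size of any maximal
  independent set \<open>S\<close>. For the depth, the product of the variables in \<open>S\<close> has as annihilator the
  prime of the facet \<open>S\<close>; a regular sequence spreads this annihilator into a chain of ideals along
  which its members are successively nonzerodivisors (\<open>regular_sequence_colon_chain\<close>), which makes them
  algebraically independent modulo the first ideal (\<open>ideal_chain_independent\<close>), whereas that quotient
  is a polynomial ring in \<open>card S\<close> variables (\<open>algebraically_dependent_mod\<close>). Applied to chains of primes,
  the same two lemmas bound heights.

  Two-element factors imply Cohen--Macaulay (\<open>cohen_macaulay_zero_divisor_graph\<close>): the vertices are now the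
  proper nonempty subsets, and each set is paired with its complement. The parameter of a pair is
  the sum \<open>\<theta>\<close> of its two variables. Every maximal ideal contains a monic polynomial in each \<open>\<theta>\<close>, by
  Zariski's lemma (\<open>maximal_ideal_algebraic\<close>), and these polynomials form a regular sequence when the
  pairs are ordered by decreasing size of the member that avoids a fixed index: there is an explicit
  linear operator that divides by \<open>\<theta>\<close>, is locally nilpotent and commutes with the preceding
  parameters, and this is enough for regularity (\<open>shift_nonzerodivisor\<close>). So every maximal ideal has depth
  at least the number \<open>d\<close> of pairs, while an independent set contains at most one member of each pair,
  so heights are at most \<open>d\<close>; finally the depth never exceeds the height
  (\<open>regular_sequence_prime_chain\<close>).

  The order-theoretic equivalences come down to one remark: a complement in the product of an element
  concentrated in a single coordinate forces that coordinate to be the bottom or the top.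

  The ring theory is carried out in the polynomial ring over the type of all vertices, whose ideals
  are plain sets: the Stanley--Reisner ring is the quotient of that ring by the edges and by the
  variables that are not vertices (\<open>sr_presentation\<close>).
\<close>

section \<open>Ideals, regular sequences and chains of ideals\<close>

interpretation idl: Modules.module "(*) :: 'r::comm_ring_1 \<Rightarrow> 'r \<Rightarrow> 'r"
  by unfold_locales (simp_all add: algebra_simps)

text \<open>
  As a rewrite rule this would undo the associative law of multiplication.
\<close>
declare idl.scale_scale [simp del]

definition prime_ideal :: "'r::comm_ring_1 set \<Rightarrow> bool" where
  "prime_ideal M \<longleftrightarrow> idl.subspace M \<and> 1 \<notin> M \<and> (\<forall>a b. a * b \<in> M \<longrightarrow> a \<in> M \<or> b \<in> M)"

text \<open>
  The quotient by \<open>J\<close> is Noetherian. Stating this relative to \<open>J\<close> allows an ambient ring that is not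
  Noetherian, such as a polynomial ring in infinitely many variables.
\<close>
definition noeth_mod :: "'r::comm_ring_1 set \<Rightarrow> bool" where
  "noeth_mod J \<longleftrightarrow> (\<forall>I. idl.subspace I \<and> J \<subseteq> I \<longrightarrow> (\<exists>F. finite F \<and> I = idl.span (J \<union> F)))"

text \<open>
  The classes of \<open>xs\<close> form a regular sequence on the quotient by \<open>J\<close>.
\<close>
definition regular_mod :: "'r::comm_ring_1 set \<Rightarrow> 'r list \<Rightarrow> bool" where
  "regular_mod J xs \<longleftrightarrow>
     (\<forall>k<length xs. \<forall>r. r * xs ! k \<in> idl.span (J \<union> set (take k xs)) \<longrightarrow>
        r \<in> idl.span (J \<union> set (take k xs))) \<and>
     idl.span (J \<union> set xs) \<noteq> UNIV"

lemma idl_mult: "idl.subspace I \<Longrightarrow> a \<in> I \<Longrightarrow> r * a \<in> I"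
  "idl.subspace I \<Longrightarrow> a \<in> I \<Longrightarrow> a * r \<in> I"
  using idl.subspace_scale[of I a r] by (simp_all add: mult.commute)

lemma prime_idealD:
  assumes "prime_ideal M"
  shows "idl.subspace M" "1 \<notin> M" "a * b \<in> M \<Longrightarrow> a \<in> M \<or> b \<in> M"
  using assms by (auto simp: prime_ideal_def)

lemma nonzerodivisor_power:
  fixes I :: "'r::comm_ring_1 set"
  assumes nzd: "\<And>r. r * x \<in> I \<Longrightarrow> r \<in> I" and "r * x ^ k \<in> I"
  shows "r \<in> I"
  using assms(2)
proof (induction k arbitrary: r)
  case (Suc k)
  from Suc.prems have "r * x * x ^ k \<in> I" by (simp add: mult.assoc)
  then have "r * x \<in> I" by (rule Suc.IH)
  then show ?case by (rule nzd)
qed simp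

lemma prime_ideal_power: "prime_ideal M \<Longrightarrow> a ^ n \<in> M \<Longrightarrow> a \<in> M"
  by (induction n) (auto simp: prime_ideal_def)

lemma prime_ideal_prod:
  assumes "prime_ideal M" "finite A" "prod f A \<in> M" shows "\<exists>a\<in>A. f a \<in> M"
  using assms(2,3) by induction (use prime_idealD[OF assms(1)] in auto)

text \<open>
  The union of a chain of ideals is finitely generated modulo \<open>J\<close>, hence equal to a member of the chain,
  and Zorn's lemma applies.
\<close>
lemma noeth_maximal:
  fixes J :: "'r::comm_ring_1 set"
  assumes noeth: "noeth_mod J" and ne: "C \<noteq> {}"
    and C: "\<And>I. I \<in> C \<Longrightarrow> idl.subspace I \<and> J \<subseteq> I"
  shows "\<exists>M\<in>C. \<forall>I\<in>C. M \<subseteq> I \<longrightarrow> I = M"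
proof (rule subset_Zorn_nonempty[OF ne])
  fix K assume K: "K \<noteq> {}" "subset.chain C K"
  have sub: "K \<subseteq> C" and lin: "\<And>A B. A \<in> K \<Longrightarrow> B \<in> K \<Longrightarrow> A \<subseteq> B \<or> B \<subseteq> A"
    using K(2) by (auto simp: subset_chain_def)
  have id: "idl.subspace (\<Union>K)"
  proof (rule idl.subspaceI)
    show "0 \<in> \<Union>K" using K(1) sub C idl.subspace_0 by fastforce
    fix x y assume "x \<in> \<Union>K" "y \<in> \<Union>K"
    then obtain A B where AB: "A \<in> K" "x \<in> A" "B \<in> K" "y \<in> B" by auto
    then obtain D where "D \<in> K" "x \<in> D" "y \<in> D" using lin[of A B] by blast
    then show "x + y \<in> \<Union>K" using sub C idl.subspace_add by (metis UnionI subsetD)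
  next
    fix c x assume "x \<in> \<Union>K"
    then show "c * x \<in> \<Union>K" using sub C idl_mult(1) by (metis UnionE UnionI subsetD)
  qed
  have JK: "J \<subseteq> \<Union>K" using K(1) sub C by fastforce
  obtain F where F: "finite F" "\<Union>K = idl.span (J \<union> F)"
    using noeth id JK unfolding noeth_mod_def by blast
  have "F \<subseteq> \<Union>K" using F(2) idl.span_superset by blast
  then obtain B where B: "B \<in> K" "F \<subseteq> B"
    using finite_subset_Union_chain[OF F(1) _ K(1) K(2)] by blast
  have "\<Union>K \<subseteq> B"
    unfolding F(2) using B sub C by (intro idl.span_minimal) auto
  then have "\<Union>K = B" using B(1) by auto
  then show "\<Union>K \<in> C" using B(1) sub by auto
qed

text \<open>
  An ideal that is maximal among those disjoint from a multiplicative set is prime.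
\<close>
lemma prime_ideal_disjoint:
  fixes J :: "'r::comm_ring_1 set"
  assumes noeth: "noeth_mod J" and I: "idl.subspace I" "J \<subseteq> I" "I \<inter> S = {}"
    and S: "1 \<in> S" "\<And>a b. a \<in> S \<Longrightarrow> b \<in> S \<Longrightarrow> a * b \<in> S"
  shows "\<exists>P. prime_ideal P \<and> I \<subseteq> P \<and> P \<inter> S = {}"
proof -
  define C where "C = {P. idl.subspace P \<and> I \<subseteq> P \<and> P \<inter> S = {}}"
  have "C \<noteq> {}" using I by (auto simp: C_def)
  moreover have "idl.subspace L \<and> J \<subseteq> L" if "L \<in> C" for L
    using that I(2) by (auto simp: C_def)
  ultimately have "\<exists>P\<in>C. \<forall>L\<in>C. P \<subseteq> L \<longrightarrow> L = P" by (rule noeth_maximal[OF noeth])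
  then obtain P where P: "P \<in> C" and max: "\<And>L. L \<in> C \<Longrightarrow> P \<subseteq> L \<Longrightarrow> L = P"
    by blast
  have meets: "\<exists>r. \<exists>p\<in>P. p + r * a \<in> S" if a: "a \<notin> P" for a
  proof -
    have "P \<subseteq> idl.span (insert a P)" "a \<in> idl.span (insert a P)"
      by (auto intro: idl.span_base)
    then have "idl.span (insert a P) \<notin> C" using max a by blast
    then obtain s where s: "s \<in> S" "s \<in> idl.span (insert a P)"
      using P unfolding C_def by (auto intro: idl.span_base)
    then obtain k where "s - k * a \<in> P"
      using P by (auto simp: idl.span_breakdown_eq C_def simp flip: idl.span_eq_iff)
    then show ?thesis using s(1) by (intro exI[of _ k] bexI[of _ "s - k * a"]) auto
  qed
  have "prime_ideal P"
    unfolding prime_ideal_def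
  proof (intro conjI allI impI)
    show sP: "idl.subspace P" and "1 \<notin> P" using P S(1) by (auto simp: C_def)
    fix a b assume ab: "a * b \<in> P"
    show "a \<in> P \<or> b \<in> P"
    proof (rule ccontr)
      assume "\<not> (a \<in> P \<or> b \<in> P)"
      then obtain r s p q where *: "p \<in> P" "q \<in> P" "p + r * a \<in> S" "q + s * b \<in> S"
        using meets by metis
      have "(p + r * a) * (q + s * b) = p * (q + s * b) + (r * a) * q + (r * s) * (a * b)"
        by (simp add: algebra_simps)
      also have "\<dots> \<in> P"
        using idl_mult(2)[OF sP *(1)] idl_mult(1)[OF sP *(2)] idl_mult(1)[OF sP ab]
        by (intro idl.subspace_add[OF sP]) auto
      finally show False using S(2)[OF *(3,4)] P by (auto simp: C_def)
    qed
  qed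
  then show ?thesis using P by (auto simp: C_def)
qed

lemma regular_mod_snoc:
  assumes "regular_mod J (xs @ [x])"
  shows "regular_mod J xs" "\<And>r. r * x \<in> idl.span (J \<union> set xs) \<Longrightarrow> r \<in> idl.span (J \<union> set xs)"
proof -
  have nz: "\<And>k r. k < Suc (length xs) \<Longrightarrow> r * (xs @ [x]) ! k \<in> idl.span (J \<union> set (take k (xs @ [x])))
     \<Longrightarrow> r \<in> idl.span (J \<union> set (take k (xs @ [x])))" and
    proper: "idl.span (J \<union> set (xs @ [x])) \<noteq> UNIV"
    using assms unfolding regular_mod_def by auto
  have "idl.span (J \<union> set xs) \<subseteq> idl.span (J \<union> set (xs @ [x]))"
    by (intro idl.span_mono) auto
  then have "idl.span (J \<union> set xs) \<noteq> UNIV" using proper by auto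
  moreover have "r \<in> idl.span (J \<union> set (take k xs))"
    if "k < length xs" "r * xs ! k \<in> idl.span (J \<union> set (take k xs))" for k r
    using nz[of k r] that by (simp add: nth_append)
  ultimately show "regular_mod J xs" by (auto simp: regular_mod_def)
  show "r \<in> idl.span (J \<union> set xs)" if "r * x \<in> idl.span (J \<union> set xs)" for r
    using nz[of "length xs" r] that by simp
qed

text \<open>
  Depth is at most height. If \<open>x\<close> is regular modulo \<open>I\<close>, then \<open>I\<close> misses the multiplicative set of all
  \<open>s * x ^ k\<close> with \<open>s\<close> outside the prime \<open>M\<close>; a prime over \<open>I\<close> that misses it too lies in \<open>M\<close> and does not
  contain \<open>x\<close>. The chain is built downwards from the last element of the sequence.
\<close>
lemma regular_sequence_prime_chain:
  fixes J :: "'r::comm_ring_1 set"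
  assumes noeth: "noeth_mod J" 
    and "regular_mod J xs" "prime_ideal M" "J \<subseteq> M" "set xs \<subseteq> M"
  shows "\<exists>p. (\<forall>i\<le>length xs. prime_ideal (p i) \<and> J \<subseteq> p i) \<and>
     (\<forall>i<length xs. p i \<subset> p (Suc i)) \<and> p (length xs) = M"
  using assms(2-)
proof (induction xs arbitrary: M rule: rev_induct)
  case Nil
  then show ?case by (intro exI[of _ "\<lambda>_. M"]) auto
next
  case (snoc x xs)
  note reg = regular_mod_snoc[OF snoc.prems(1)]
  define I where "I = idl.span (J \<union> set xs)"
  define S where "S = {s * x ^ k | s k. s \<notin> M}"
  have SI: "s * x ^ k \<in> S" if "s \<notin> M" for s k
    using that by (auto simp: S_def)
  have nz: "r \<in> I" if "r * x ^ k \<in> I" for r k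
    using reg(2) that unfolding I_def by (rule nonzerodivisor_power)
  have IM: "I \<subseteq> M" unfolding I_def
    using snoc.prems prime_idealD(1) by (intro idl.span_minimal) auto
  have "\<exists>P. prime_ideal P \<and> I \<subseteq> P \<and> P \<inter> S = {}"
  proof (rule prime_ideal_disjoint[OF noeth])
    show "idl.subspace I" by (simp add: I_def)
    show "J \<subseteq> I" by (auto simp: I_def intro: idl.span_base)
    show "I \<inter> S = {}" using nz IM by (auto simp: S_def)
    show "1 \<in> S" using SI[of 1 0] prime_idealD(2)[OF snoc.prems(2)] by simp
    fix a b assume "a \<in> S" "b \<in> S"
    then obtain s k t l where "a = s * x ^ k" "b = t * x ^ l" "s \<notin> M" "t \<notin> M"
      by (auto simp: S_def)
    then show "a * b \<in> S" using SI[of "s * t" "k + l"] prime_idealD(3)[OF snoc.prems(2), of s t]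
      by (auto simp: power_add mult_ac)
  qed
  then obtain P where P: "prime_ideal P" "I \<subseteq> P" "P \<inter> S = {}" by blast
  have "x \<in> S" using SI[of 1 1] prime_idealD(2)[OF snoc.prems(2)] by simp
  moreover have "s \<in> S" if "s \<notin> M" for s using SI[OF that, of 0] by simp
  ultimately have "P \<subset> M" using P(3) snoc.prems(4) by auto
  moreover have "J \<subseteq> P" "set xs \<subseteq> P" using P(2) by (auto simp: I_def intro: idl.span_base)
  with snoc.IH[OF reg(1) P(1)] obtain p where p:
    "\<forall>i\<le>length xs. prime_ideal (p i) \<and> J \<subseteq> p i" "\<forall>i<length xs. p i \<subset> p (Suc i)"
    "p (length xs) = P" by blast
  ultimately show ?case using snoc.prems
    by (intro exI[of _ "p(Suc (length xs) := M)"]) (auto simp: less_Suc_eq le_Suc_eq)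
qed

text \<open>
  A relation \<open>F(y 0, y 1, \<dots>)\<close> in \<open>Q 0\<close> may be divided by the largest power of \<open>y 0\<close> that occurs in all its
  terms, since \<open>y 0\<close> is a nonzerodivisor modulo \<open>Q 0\<close>. The terms that still contain \<open>y 0\<close> lie in \<open>Q 1\<close>, so
  the others form a nonzero relation between \<open>y 1, y 2, \<dots>\<close> in \<open>Q 1\<close>; at the end a nonzero constant
  would lie in \<open>Q h\<close>. The function \<open>\<iota>\<close> embeds the coefficients, and monomials are exponent functions.
\<close>
lemma ideal_chain_independent:
  fixes Q :: "nat \<Rightarrow> 'r::comm_ring_1 set" and y :: "nat \<Rightarrow> 'r" and \<iota> :: "'k::zero \<Rightarrow> 'r"
  assumes Q: "\<And>k. k \<le> h \<Longrightarrow> idl.subspace (Q k)"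
    and inc: "\<And>k. k < h \<Longrightarrow> Q k \<subseteq> Q (Suc k)"
    and y: "\<And>k. k < h \<Longrightarrow> y k \<in> Q (Suc k)"
    and nzd: "\<And>k r. k < h \<Longrightarrow> r * y k \<in> Q k \<Longrightarrow> r \<in> Q k"
    and proper: "\<And>c. c \<noteq> 0 \<Longrightarrow> \<iota> c \<notin> Q h"
    and E: "finite E" "inj_on (\<lambda>\<alpha>. restrict \<alpha> {..<h}) E"
    and c: "\<And>\<alpha>. \<alpha> \<in> E \<Longrightarrow> c \<alpha> \<noteq> 0"
    and rel: "(\<Sum>\<alpha>\<in>E. \<iota> (c \<alpha>) * (\<Prod>i<h. y i ^ \<alpha> i)) \<in> Q 0"
  shows "E = {}"
proof -
  have "\<forall>E. finite E \<longrightarrow> inj_on (\<lambda>\<alpha>. restrict \<alpha> {k..<h}) E \<longrightarrow> (\<forall>\<alpha>\<in>E. c \<alpha> \<noteq> 0) \<longrightarrow>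
      (\<Sum>\<alpha>\<in>E. \<iota> (c \<alpha>) * (\<Prod>i\<in>{k..<h}. y i ^ \<alpha> i)) \<in> Q k \<longrightarrow> E = {}" if "k \<le> h" for k
    using that
  proof (induction rule: inc_induct)
    case base
    show ?case
    proof (intro allI impI, rule ccontr)
      fix E :: "(nat \<Rightarrow> nat) set"
      assume E: "inj_on (\<lambda>\<alpha>. restrict \<alpha> {h..<h}) E" "\<forall>\<alpha>\<in>E. c \<alpha> \<noteq> 0"
        "(\<Sum>\<alpha>\<in>E. \<iota> (c \<alpha>) * (\<Prod>i\<in>{h..<h}. y i ^ \<alpha> i)) \<in> Q h" "E \<noteq> {}"
      then obtain \<alpha> where "\<alpha> \<in> E" by blast
      moreover have "\<beta> = \<alpha>" if "\<beta> \<in> E" for \<beta>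
        using inj_onD[OF E(1), of \<beta> \<alpha>] that \<open>\<alpha> \<in> E\<close> by (simp add: restrict_def)
      ultimately have "E = {\<alpha>}" by blast
      then show False using E proper[of "c \<alpha>"] by auto
    qed
  next
    case (step k)
    show ?case
    proof (intro allI impI, rule ccontr)
      fix E :: "(nat \<Rightarrow> nat) set"
      assume E: "finite E" "inj_on (\<lambda>\<alpha>. restrict \<alpha> {k..<h}) E" "\<forall>\<alpha>\<in>E. c \<alpha> \<noteq> 0"
        and rel: "(\<Sum>\<alpha>\<in>E. \<iota> (c \<alpha>) * (\<Prod>i\<in>{k..<h}. y i ^ \<alpha> i)) \<in> Q k" and ne: "E \<noteq> {}"
      \<comment> \<open>\<open>y k ^ m\<close> is the largest power of \<open>y k\<close> that divides all terms.\<close>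
      define m where "m = Min ((\<lambda>\<alpha>. \<alpha> k) ` E)"
      have m: "m \<le> \<alpha> k" if "\<alpha> \<in> E" for \<alpha> using that E(1) by (auto simp: m_def)
      define t where "t = (\<lambda>\<alpha>::nat \<Rightarrow> nat. \<iota> (c \<alpha>) * (\<Prod>i\<in>{Suc k..<h}. y i ^ \<alpha> i))"
      have spl: "{k..<h} = insert k {Suc k..<h}" using step.hyps by auto
      have eq0: "(\<Sum>\<alpha>\<in>E. \<iota> (c \<alpha>) * (\<Prod>i\<in>{k..<h}. y i ^ \<alpha> i)) = (\<Sum>\<alpha>\<in>E. t \<alpha> * y k ^ (\<alpha> k - m)) * y k ^ m"
        unfolding sum_distrib_right
      proof (rule sum.cong[OF refl])
        fix \<alpha> assume "\<alpha> \<in> E"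
        then have "y k ^ \<alpha> k = y k ^ (\<alpha> k - m) * y k ^ m"
          using m by (simp add: power_add[symmetric])
        then show "\<iota> (c \<alpha>) * (\<Prod>i\<in>{k..<h}. y i ^ \<alpha> i) = t \<alpha> * y k ^ (\<alpha> k - m) * y k ^ m"
          by (simp add: spl t_def mult_ac)
      qed
      have nzp: "r \<in> Q k" if "r * y k ^ j \<in> Q k" for r j
        using nzd[OF step.hyps(2)] that by (rule nonzerodivisor_power)
      have "(\<Sum>\<alpha>\<in>E. t \<alpha> * y k ^ (\<alpha> k - m)) \<in> Q k"
        using rel unfolding eq0 by (rule nzp)
      then have 1: "(\<Sum>\<alpha>\<in>E. t \<alpha> * y k ^ (\<alpha> k - m)) \<in> Q (Suc k)"
        using inc[of k] step.hyps by auto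
      define E' where "E' = {\<alpha>\<in>E. \<alpha> k = m}"
      have Qs: "idl.subspace (Q (Suc k))" using Q step.hyps by auto
      have yk: "y k ^ j \<in> Q (Suc k)" if "j > 0" for j
        using that y[of k] step.hyps Qs by (cases j) (auto intro: idl_mult)
      have "(\<Sum>\<alpha>\<in>E. t \<alpha> * y k ^ (\<alpha> k - m)) =
          (\<Sum>\<alpha>\<in>E'. t \<alpha> * y k ^ (\<alpha> k - m)) + (\<Sum>\<alpha>\<in>E - E'. t \<alpha> * y k ^ (\<alpha> k - m))"
        using E(1) sum.subset_diff[of E' E "\<lambda>\<alpha>. t \<alpha> * y k ^ (\<alpha> k - m)"]
        by (simp add: E'_def add.commute)
      also have "(\<Sum>\<alpha>\<in>E'. t \<alpha> * y k ^ (\<alpha> k - m)) = (\<Sum>\<alpha>\<in>E'. t \<alpha>)"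
        by (rule sum.cong) (auto simp: E'_def)
      finally have eq: "(\<Sum>\<alpha>\<in>E'. t \<alpha>) = (\<Sum>\<alpha>\<in>E. t \<alpha> * y k ^ (\<alpha> k - m)) - 
          (\<Sum>\<alpha>\<in>E - E'. t \<alpha> * y k ^ (\<alpha> k - m))" by simp
      have "t \<alpha> * y k ^ (\<alpha> k - m) \<in> Q (Suc k)" if "\<alpha> \<in> E - E'" for \<alpha>
        using that m[of \<alpha>] by (intro idl_mult(1)[OF Qs] yk) (auto simp: E'_def)
      then have "(\<Sum>\<alpha>\<in>E'. t \<alpha>) \<in> Q (Suc k)" unfolding eq
        by (auto intro!: idl.subspace_diff[OF Qs 1] idl.subspace_sum[OF Qs])
      moreover have "inj_on (\<lambda>\<alpha>. restrict \<alpha> {Suc k..<h}) E'"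
      proof (rule inj_onI)
        fix \<alpha> \<beta> assume *: "\<alpha> \<in> E'" "\<beta> \<in> E'" "restrict \<alpha> {Suc k..<h} = restrict \<beta> {Suc k..<h}"
        have "\<alpha> i = \<beta> i" if "i \<in> {k..<h}" for i
        proof (cases "i = k")
          case False
          then have "i \<in> {Suc k..<h}" using that by auto
          then show ?thesis using fun_cong[OF *(3), of i] unfolding restrict_def by metis
        qed (use * in \<open>simp add: E'_def\<close>)
        then have "restrict \<alpha> {k..<h} = restrict \<beta> {k..<h}" by auto
        then show "\<alpha> = \<beta>" using * E(2) by (auto simp: E'_def dest: inj_onD)
      qed
      moreover have "finite E'" "\<forall>\<alpha>\<in>E'. c \<alpha> \<noteq> 0" using E by (auto simp: E'_def)
      ultimately have "E' = {}" using step.IH unfolding t_def by blast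
      moreover have "m \<in> (\<lambda>\<alpha>. \<alpha> k) ` E" unfolding m_def using E(1) ne by (intro Min_in) auto
      ultimately show False by (auto simp: E'_def)
    qed
  qed
  from this[of 0] show ?thesis using E c rel by (simp add: lessThan_atLeast0)
qed

text \<open>
  Locally at \<open>M\<close> the element \<open>f\<close> is divided by \<open>x\<close> as often as possible modulo \<open>I\<close>; the result \<open>g\<close> satisfies
  \<open>(I : f) \<subseteq> (I : g)\<close> and \<open>(I + (x) : g) \<subseteq> M\<close>. That the division stops is Krull's intersection theorem,
  which is proved along the way by taking a maximal ideal among the contractions \<open>N h\<close> of the local
  ideals generated by \<open>h\<close> and \<open>I\<close>.
\<close>
lemma colon_lift:
  fixes J :: "'r::comm_ring_1 set"
  assumes noeth: "noeth_mod J" and M: "prime_ideal M" 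
    and I: "idl.subspace I" "J \<subseteq> I" and x: "x \<in> M"
    and nzd: "\<And>r. r * x \<in> I \<Longrightarrow> r \<in> I"
    and f: "\<And>r. r * f \<in> I \<Longrightarrow> r \<in> M"
  shows "\<exists>g. (\<forall>r. r * f \<in> I \<longrightarrow> r * g \<in> I) \<and> (\<forall>r a. r * g - a * x \<in> I \<longrightarrow> r \<in> M)"
proof (rule ccontr)
  assume contra: "\<not> ?thesis"
  have nzp: "r \<in> I" if "r * x ^ j \<in> I" for r j
    using nzd that by (rule nonzerodivisor_power)
  define P where "P = (\<lambda>h. \<exists>c j. c \<notin> M \<and> c * f - x ^ j * h \<in> I)"
  define N where "N = (\<lambda>h. {r. \<exists>s a. s \<notin> M \<and> s * r - a * h \<in> I})"
  have Mm: "s * t \<notin> M" if "s \<notin> M" "t \<notin> M" for s t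
    using that prime_idealD(3)[OF M] by blast
  have "P f" unfolding P_def using prime_idealD(2)[OF M] idl.subspace_0[OF I(1)]
    by (intro exI[of _ "1::'r"] exI[of _ "0::nat"]) auto
  have NI: "r \<in> N h" if "s \<notin> M" "s * r - a * h \<in> I" for s r a h
    using that unfolding N_def by blast
  have N: "idl.subspace (N h)" for h
  proof (rule idl.subspaceI)
    show "0 \<in> N h" using NI[of 1 0 0 h] prime_idealD(2)[OF M] idl.subspace_0[OF I(1)] by simp
    fix r t assume "r \<in> N h" "t \<in> N h"
    then obtain s a s' a' where *: "s \<notin> M" "s * r - a * h \<in> I" "s' \<notin> M" "s' * t - a' * h \<in> I"
      by (auto simp: N_def)
    have "s * s' * (r + t) - (s' * a + s * a') * h = s' * (s * r - a * h) + s * (s' * t - a' * h)"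
      by (simp add: algebra_simps)
    also have "\<dots> \<in> I" using idl_mult(1)[OF I(1)] * idl.subspace_add[OF I(1)] by blast
    finally show "r + t \<in> N h" unfolding N_def using Mm * by blast
  next
    fix b r assume "r \<in> N h"
    then obtain s a where *: "s \<notin> M" "s * r - a * h \<in> I" by (auto simp: N_def)
    have "s * (b * r) - (b * a) * h = b * (s * r - a * h)" by (simp add: algebra_simps)
    also have "\<dots> \<in> I" using idl_mult(1)[OF I(1)] * by blast
    finally show "b * r \<in> N h" unfolding N_def using * by blast
  qed
  have "idl.subspace L \<and> J \<subseteq> L" if LP: "L \<in> N ` {h. P h}" for L
  proof -
    obtain h where L: "L = N h" using LP by blast
    have "r \<in> N h" if "r \<in> J" for r
      using NI[of 1 r 0 h] prime_idealD(2)[OF M] that I(2) by auto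
    then show ?thesis using N L by blast
  qed
  then have "\<exists>L\<in>N ` {h. P h}. \<forall>K\<in>N ` {h. P h}. L \<subseteq> K \<longrightarrow> K = L"
    using \<open>P f\<close> by (intro noeth_maximal[OF noeth]) auto
  then obtain h where h: "P h" and max: "\<And>h'. P h' \<Longrightarrow> N h \<subseteq> N h' \<Longrightarrow> N h' = N h" by blast
  obtain c j where cj: "c \<notin> M" "c * f - x ^ j * h \<in> I" using h by (auto simp: P_def)
  have "\<forall>r. r * f \<in> I \<longrightarrow> r * h \<in> I"
  proof (intro allI impI)
    fix r assume "r * f \<in> I"
    then have "c * (r * f) - r * (c * f - x ^ j * h) \<in> I"
      using cj(2) idl_mult(1)[OF I(1)] idl.subspace_diff[OF I(1)] by blast
    then have "(r * h) * x ^ j \<in> I" by (simp add: algebra_simps)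
    then show "r * h \<in> I" by (rule nzp)
  qed
  then obtain d h' where d: "d \<notin> M" "d * h - h' * x \<in> I" using contra by blast
  have "(d * c) * f - x ^ Suc j * h' = d * (c * f - x ^ j * h) + x ^ j * (d * h - h' * x)"
    by (simp add: algebra_simps)
  also have "\<dots> \<in> I" using cj d idl_mult(1)[OF I(1)] idl.subspace_add[OF I(1)] by blast
  finally have "P h'" unfolding P_def using Mm[OF d(1) cj(1)] by blast
  moreover have "N h \<subseteq> N h'"
  proof
    fix r assume "r \<in> N h"
    then obtain s a where *: "s \<notin> M" "s * r - a * h \<in> I" by (auto simp: N_def)
    have "(d * s) * r - (a * x) * h' = d * (s * r - a * h) + a * (d * h - h' * x)"
      by (simp add: algebra_simps)
    also have "\<dots> \<in> I" using * d idl_mult(1)[OF I(1)] idl.subspace_add[OF I(1)] by blast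
    finally show "r \<in> N h'" unfolding N_def using Mm[OF d(1) *(1)] by blast
  qed
  ultimately have "N h' = N h" by (rule max)
  moreover have "h' \<in> N h'"
    using NI[of 1 h' 1 h'] prime_idealD(2)[OF M] idl.subspace_0[OF I(1)] by simp
  ultimately obtain s a where sa: "s \<notin> M" "s * h' - a * h \<in> I" by (auto simp: N_def)
  \<comment> \<open>Locally \<open>h = x * h'\<close> and \<open>h'\<close> is a multiple of \<open>h\<close>, so \<open>e\<close>, which is \<open>s * d\<close> up to an element of \<open>M\<close>, kills \<open>h\<close>.\<close>
  define e where "e = s * d - a * x"
  have "e \<notin> M"
  proof
    assume "e \<in> M"
    then have "e + a * x \<in> M" using prime_idealD(1)[OF M] x idl_mult(1) idl.subspace_add by blast
    then show False using Mm[OF sa(1) d(1)] by (simp add: e_def)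
  qed
  have "e * h = s * (d * h - h' * x) + x * (s * h' - a * h)"
    by (simp add: e_def algebra_simps)
  also have "\<dots> \<in> I" using sa d idl_mult(1)[OF I(1)] idl.subspace_add[OF I(1)] by blast
  finally have eh: "e * h \<in> I" .
  have "(e * c) * f = e * (c * f - x ^ j * h) + x ^ j * (e * h)" by (simp add: algebra_simps)
  also have "\<dots> \<in> I" using eh cj idl_mult(1)[OF I(1)] idl.subspace_add[OF I(1)] by blast
  finally show False using f Mm[OF \<open>e \<notin> M\<close> cj(1)] by blast
qed

text \<open>
  With \<open>J\<close> extended step by step by the members of \<open>xs\<close>, the ideals are the colon ideals of the elements
  that \<open>colon_lift\<close> provides; an element regular modulo an ideal is regular modulo all its colon ideals.
\<close>
lemma regular_sequence_colon_chain:
  fixes J :: "'r::comm_ring_1 set"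
  assumes noeth: "noeth_mod J" and M: "prime_ideal M" and J: "idl.subspace J" "J \<subseteq> M"
    and f: "\<And>r. r * f \<in> J \<Longrightarrow> r \<in> M"
    and xs: "regular_mod J xs" "set xs \<subseteq> M"
  shows "\<exists>Q. (\<forall>k\<le>length xs. idl.subspace (Q k) \<and> Q k \<subseteq> M) \<and> Q 0 = {r. r * f \<in> J} \<and>
     (\<forall>k<length xs. Q k \<subseteq> Q (Suc k) \<and> xs ! k \<in> Q (Suc k) \<and> (\<forall>r. r * xs ! k \<in> Q k \<longrightarrow> r \<in> Q k))"
proof -
  have "\<exists>Q g. (\<forall>k\<le>length xs. idl.subspace (Q k) \<and> Q k \<subseteq> M) \<and> Q 0 = {r. r * f \<in> J} \<and>
     (\<forall>k<length xs. Q k \<subseteq> Q (Suc k) \<and> xs ! k \<in> Q (Suc k) \<and> (\<forall>r. r * xs ! k \<in> Q k \<longrightarrow> r \<in> Q k)) \<and>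
     Q (length xs) = {r. r * g \<in> idl.span (J \<union> set xs)}"
    using xs
  proof (induction xs rule: rev_induct)
    case Nil
    have "idl.subspace {r. r * f \<in> J}"
      using J(1) by (intro idl.subspaceI) 
        (auto simp: distrib_right mult.assoc intro: idl_mult idl.subspace_add idl.subspace_0)
    moreover have sp: "idl.span J = J" using J(1) by simp
    ultimately show ?case using f
      by (intro exI[of _ "\<lambda>_. {r. r * f \<in> J}"] exI[of _ f]) (auto simp: sp)
  next
    case (snoc x xs)
    note reg = regular_mod_snoc[OF snoc.prems(1)]
    define I where "I = idl.span (J \<union> set xs)"
    have I: "idl.subspace I" "J \<subseteq> I" unfolding I_def by (auto intro: idl.span_base)
    obtain Q g where Q: "\<forall>k\<le>length xs. idl.subspace (Q k) \<and> Q k \<subseteq> M" "Q 0 = {r. r * f \<in> J}"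
      "\<forall>k<length xs. Q k \<subseteq> Q (Suc k) \<and> xs ! k \<in> Q (Suc k) \<and> (\<forall>r. r * xs ! k \<in> Q k \<longrightarrow> r \<in> Q k)"
      and g: "Q (length xs) = {r. r * g \<in> I}"
      using snoc.IH reg(1) snoc.prems(2) unfolding I_def by auto
    have "\<exists>g'. (\<forall>r. r * g \<in> I \<longrightarrow> r * g' \<in> I) \<and> (\<forall>r a. r * g' - a * x \<in> I \<longrightarrow> r \<in> M)"
      using reg(2) snoc.prems(2) Q(1) g
      by (intro colon_lift[OF noeth M I]) (auto simp: I_def)
    then obtain g' where g': "\<And>r. r * g \<in> I \<Longrightarrow> r * g' \<in> I" "\<And>r a. r * g' - a * x \<in> I \<Longrightarrow> r \<in> M"
      by blast
    define K where "K = idl.span (J \<union> set (xs @ [x]))"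
    have K: "K = idl.span (insert x (J \<union> set xs))" by (simp add: K_def)
    have Kmem: "t \<in> K \<longleftrightarrow> (\<exists>a. t - a * x \<in> I)" for t
      unfolding K I_def by (rule idl.span_breakdown_eq)
    have Ks: "idl.subspace K" by (simp add: K)
    define Q' where "Q' = {r. r * g' \<in> K}"
    have IK: "I \<subseteq> K" unfolding I_def K by (intro idl.span_mono) auto
    have "x \<in> K" unfolding K by (intro idl.span_base) auto
    then have "x \<in> Q'" unfolding Q'_def using idl_mult(2)[OF Ks] by blast
    moreover have "idl.subspace Q'" unfolding Q'_def
      using Ks by (intro idl.subspaceI) 
        (auto simp: distrib_right mult.assoc intro: idl_mult idl.subspace_add idl.subspace_0)
    moreover have "Q' \<subseteq> M" unfolding Q'_def using g'(2) Kmem by blast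
    moreover have "Q (length xs) \<subseteq> Q'" unfolding g Q'_def using g'(1) IK by blast
    moreover have "r \<in> Q (length xs)" if "r * x \<in> Q (length xs)" for r
      using reg(2)[of "r * g"] that unfolding g I_def by (simp add: mult_ac)
    ultimately show ?case using Q
      by (intro exI[of _ "Q(Suc (length xs) := Q')"] exI[of _ g'])
        (auto simp: less_Suc_eq le_Suc_eq nth_append Q'_def K_def)
  qed
  then show ?thesis by blast
qed

text \<open>
  The operator \<open>D\<close> divides by \<open>x\<close>. Suppose that the product of \<open>r\<close> with a monic polynomial of degree \<open>e\<close> in
  \<open>x\<close> is in \<open>J\<close>. Applying \<open>D\<close> to it \<open>n + e\<close> times gives the iterate \<open>(D ^^ n) r\<close>, from the leading term,
  plus a combination of later iterates; so the last iterate outside \<open>J\<close> would lie in \<open>J\<close>.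
\<close>
lemma shift_nonzerodivisor:
  fixes D :: "'r::comm_ring_1 \<Rightarrow> 'r"
  assumes J: "idl.subspace J"
    and add: "\<And>a b. D (a + b) = D a + D b"
    and scal: "\<And>j r. D (c j * r) = c j * D r"
    and DJ: "\<And>r. r \<in> J \<Longrightarrow> D r \<in> J"
    and Dx: "\<And>r. D (x * r) - r \<in> J"
    and nil: "\<And>r. \<exists>N. (D ^^ N) r \<in> J"
    and zero: "r * (x ^ e + (\<Sum>j<e. c j * x ^ j)) \<in> J"
  shows "r \<in> J"
proof -
  have D0: "D 0 = 0" using add[of 0 0] by simp
  have padd: "(D ^^ i) (a + b) = (D ^^ i) a + (D ^^ i) b" for i a b
    by (induction i) (simp_all add: add)
  have psum: "(D ^^ i) (sum g A) = (\<Sum>a\<in>A. (D ^^ i) (g a))" for i A and g :: "nat \<Rightarrow> 'r"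
  proof -
    have "(D ^^ i) 0 = 0" by (induction i) (simp_all add: D0)
    then show ?thesis by (induction A rule: infinite_finite_induct) (simp_all add: padd)
  qed
  have pscal: "(D ^^ i) (c j * a) = c j * (D ^^ i) a" for i j a
    by (induction i) (simp_all add: scal)
  have pJ: "(D ^^ i) a \<in> J" if "a \<in> J" for i a
    using that by (induction i) (simp_all add: DJ)
  have shift: "(D ^^ i) (x ^ j * a) - (D ^^ (i - j)) a \<in> J" if "j \<le> i" for i j a
    using that
  proof (induction j arbitrary: i)
    case 0
    then show ?case using idl.subspace_0[OF J] by simp
  next
    case (Suc j)
    then obtain i' where i: "i = Suc i'" "j \<le> i'" by (cases i) auto
    define u where "u = D (x * (x ^ j * a)) - x ^ j * a"
    have "(D ^^ i) (x ^ Suc j * a) = (D ^^ i') (x ^ j * a + u)"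
      by (simp add: i u_def funpow_swap1 mult.assoc)
    also have "\<dots> = (D ^^ i') (x ^ j * a) + (D ^^ i') u" by (rule padd)
    finally have "(D ^^ i) (x ^ Suc j * a) - (D ^^ (i - Suc j)) a =
        ((D ^^ i') (x ^ j * a) - (D ^^ (i' - j)) a) + (D ^^ i') u"
      by (simp add: i)
    also have "\<dots> \<in> J"
      using Suc.IH[OF i(2)] pJ[of u i'] Dx[of "x ^ j * a"] idl.subspace_add[OF J] unfolding u_def by blast
    finally show ?case .
  qed
  define N where "N = (LEAST N. (D ^^ N) r \<in> J)"
  have N: "(D ^^ N) r \<in> J" unfolding N_def using nil by (rule LeastI_ex)
  have later: "(D ^^ i) r \<in> J" if "N \<le> i" for i
  proof -
    have "(D ^^ i) r = (D ^^ (i - N)) ((D ^^ N) r)"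
      using that funpow_add[of "i - N" N D] by simp
    then show ?thesis using pJ N by simp
  qed
  show ?thesis
  proof (cases N)
    case 0
    then show ?thesis using N by simp
  next
    case (Suc n)
    \<comment> \<open>The leading term then contributes the iterate \<open>n\<close>, and all other terms contribute iterates from \<open>N\<close> on.\<close>
    define i where "i = n + e"
    have eq: "r * (x ^ e + (\<Sum>j<e. c j * x ^ j)) = x ^ e * r + (\<Sum>j<e. c j * (x ^ j * r))"
      by (simp add: distrib_left sum_distrib_left mult_ac)
    have "(D ^^ i) (x ^ e * r) + (\<Sum>j<e. c j * (D ^^ i) (x ^ j * r)) \<in> J"
      using pJ[OF zero, of i] unfolding eq by (simp add: padd psum pscal)
    moreover have "c j * (D ^^ i) (x ^ j * r) \<in> J" if "j < e" for j
    proof -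
      have "(D ^^ i) (x ^ j * r) - (D ^^ (i - j)) r \<in> J" using that by (intro shift) (simp add: i_def)
      moreover have "(D ^^ (i - j)) r \<in> J" using that by (intro later) (simp add: i_def Suc)
      ultimately have "(D ^^ i) (x ^ j * r) \<in> J" using idl.subspace_add[OF J] by fastforce
      then show ?thesis by (rule idl_mult(1)[OF J])
    qed
    then have "(\<Sum>j<e. c j * (D ^^ i) (x ^ j * r)) \<in> J"
      by (intro idl.subspace_sum[OF J]) auto
    ultimately have "(D ^^ i) (x ^ e * r) \<in> J" using idl.subspace_diff[OF J] by fastforce
    moreover have "(D ^^ i) (x ^ e * r) - (D ^^ (i - e)) r \<in> J" by (intro shift) (simp add: i_def)
    ultimately have "(D ^^ (i - e)) r \<in> J" using idl.subspace_diff[OF J] by fastforce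
    then have "(D ^^ n) r \<in> J" by (simp add: i_def)
    then have "N \<le> n" unfolding N_def by (rule Least_le)
    then show ?thesis using Suc by simp
  qed
qed

section \<open>Zariski's lemma\<close>

definition subring_set :: "'r::comm_ring_1 set \<Rightarrow> bool" where
  "subring_set A \<longleftrightarrow> 0 \<in> A \<and> 1 \<in> A \<and> (\<forall>a\<in>A. \<forall>b\<in>A. a + b \<in> A \<and> a * b \<in> A) \<and> (\<forall>a\<in>A. - a \<in> A)"

abbreviation coeff :: "'r::zero poly \<Rightarrow> nat \<Rightarrow> 'r" where "coeff \<equiv> Polynomial.coeff"

abbreviation degree :: "'r::zero poly \<Rightarrow> nat" where "degree \<equiv> Polynomial.degree"

definition polys_over :: "'r::comm_ring_1 set \<Rightarrow> 'r poly set" where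
  "polys_over A = {p. \<forall>i. coeff p i \<in> A}"

definition adjoin :: "'r::comm_ring_1 set \<Rightarrow> 'r \<Rightarrow> 'r set" where
  "adjoin A u = (\<lambda>p. poly p u) ` polys_over A"

text \<open>
  The image of \<open>A\<close> in the quotient by the prime \<open>M\<close> is a Goldman domain: inverting one element \<open>c\<close> turns it
  into a field. Zariski's lemma is proved by descending this property from the whole ring, following
  Kaplansky.
\<close>
definition goldman :: "'r::comm_ring_1 set \<Rightarrow> 'r set \<Rightarrow> bool" where
  "goldman M A \<longleftrightarrow> (\<exists>c\<in>A. c \<notin> M \<and> (\<forall>a\<in>A. a \<notin> M \<longrightarrow> (\<exists>N. \<exists>w\<in>A. c ^ N - a * w \<in> M)))"

lemma subring_setD:
  assumes "subring_set A"
  shows "0 \<in> A" "1 \<in> A" "a \<in> A \<Longrightarrow> b \<in> A \<Longrightarrow> a + b \<in> A" "a \<in> A \<Longrightarrow> b \<in> A \<Longrightarrow> a * b \<in> A"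
    "a \<in> A \<Longrightarrow> - a \<in> A" "a \<in> A \<Longrightarrow> b \<in> A \<Longrightarrow> a - b \<in> A" "a \<in> A \<Longrightarrow> a ^ n \<in> A"
proof -
  show *: "0 \<in> A" "1 \<in> A" "\<And>a b. a \<in> A \<Longrightarrow> b \<in> A \<Longrightarrow> a + b \<in> A" 
    "\<And>a b. a \<in> A \<Longrightarrow> b \<in> A \<Longrightarrow> a * b \<in> A" "\<And>a. a \<in> A \<Longrightarrow> - a \<in> A"
    using assms by (auto simp: subring_set_def)
  show "a \<in> A \<Longrightarrow> b \<in> A \<Longrightarrow> a - b \<in> A" using *(3)[of a "- b"] *(5) by simp
  show "a \<in> A \<Longrightarrow> a ^ n \<in> A" by (induction n) (simp_all add: *)
qed

lemma subring_set_sum: "subring_set A \<Longrightarrow> (\<And>i. i \<in> I \<Longrightarrow> f i \<in> A) \<Longrightarrow> sum f I \<in> A"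
  by (induction I rule: infinite_finite_induct) (auto simp: subring_setD)

lemma polys_over_closed:
  assumes A: "subring_set A"
  shows "p \<in> polys_over A \<Longrightarrow> q \<in> polys_over A \<Longrightarrow> p + q \<in> polys_over A"
    "p \<in> polys_over A \<Longrightarrow> q \<in> polys_over A \<Longrightarrow> p - q \<in> polys_over A"
    "p \<in> polys_over A \<Longrightarrow> q \<in> polys_over A \<Longrightarrow> p * q \<in> polys_over A"
    "p \<in> polys_over A \<Longrightarrow> - p \<in> polys_over A"
    "0 \<in> polys_over A" "1 \<in> polys_over A"
    "a \<in> A \<Longrightarrow> p \<in> polys_over A \<Longrightarrow> smult a p \<in> polys_over A"
    "a \<in> A \<Longrightarrow> p \<in> polys_over A \<Longrightarrow> pCons a p \<in> polys_over A"
    "a \<in> A \<Longrightarrow> monom a n \<in> polys_over A"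
  unfolding polys_over_def
  by (auto simp: subring_setD[OF A] coeff_mult coeff_pCons intro!: subring_set_sum[OF A]
      split: nat.split)

lemma polys_overD: "p \<in> polys_over A \<Longrightarrow> coeff p i \<in> A"
  by (simp add: polys_over_def)

lemma adjoin_subring:
  assumes A: "subring_set A" 
  shows "subring_set (adjoin A u)" "A \<subseteq> adjoin A u" "u \<in> adjoin A u"
proof -
  note cl = polys_over_closed[OF A]
  have I: "poly p u \<in> adjoin A u" if "p \<in> polys_over A" for p
    using that by (auto simp: adjoin_def)
  show "subring_set (adjoin A u)"
    unfolding subring_set_def
  proof (intro conjI ballI)
    show "0 \<in> adjoin A u" "1 \<in> adjoin A u" using I[OF cl(5)] I[OF cl(6)] by simp_all
    fix a assume "a \<in> adjoin A u"
    then obtain p where p: "a = poly p u" "p \<in> polys_over A" by (auto simp: adjoin_def)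
    then show "- a \<in> adjoin A u" using I[OF cl(4)[OF p(2)]] by simp
    fix b assume "b \<in> adjoin A u"
    then obtain q where q: "b = poly q u" "q \<in> polys_over A" by (auto simp: adjoin_def)
    show "a + b \<in> adjoin A u" "a * b \<in> adjoin A u"
      using I[OF cl(1)[OF p(2) q(2)]] I[OF cl(3)[OF p(2) q(2)]] by (simp_all add: p q)
  qed
  show "A \<subseteq> adjoin A u"
  proof
    fix a assume "a \<in> A"
    then have "[:a:] \<in> polys_over A" by (simp add: cl)
    then show "a \<in> adjoin A u" unfolding adjoin_def by (rule rev_image_eqI) simp
  qed
  have "[:0, 1:] \<in> polys_over A" by (simp add: cl subring_setD[OF A])
  then show "u \<in> adjoin A u" unfolding adjoin_def by (rule rev_image_eqI) simp
qed

lemma poly_in_ideal: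
  assumes "idl.subspace M" "p \<in> polys_over M" shows "poly p u \<in> M"
  unfolding poly_altdef using assms
  by (intro idl.subspace_sum) (auto simp: polys_over_def intro: idl_mult)

lemma polys_over_ideal:
  assumes M: "idl.subspace M"
  shows "p \<in> polys_over M \<Longrightarrow> q \<in> polys_over M \<Longrightarrow> p + q \<in> polys_over M"
    "p \<in> polys_over M \<Longrightarrow> q \<in> polys_over M \<Longrightarrow> p - q \<in> polys_over M"
    "p \<in> polys_over M \<Longrightarrow> p * q \<in> polys_over M"
    "p \<in> polys_over M \<Longrightarrow> q * p \<in> polys_over M"
    "0 \<in> polys_over M"
    "p \<in> polys_over M \<Longrightarrow> smult a p \<in> polys_over M"
    "a \<in> M \<Longrightarrow> monom a n \<in> polys_over M"
proof -
  show mult: "q * p \<in> polys_over M" if "p \<in> polys_over M" for p q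
    using that unfolding polys_over_def
    by (auto simp: coeff_mult intro!: idl.subspace_sum[OF M] idl_mult(1)[OF M])
  show "p * q \<in> polys_over M" if "p \<in> polys_over M" for p q
    using mult[OF that, of q] by (simp add: mult.commute)
qed (use M in \<open>auto simp: polys_over_def intro: idl_mult(1) idl.subspace_add idl.subspace_diff
      idl.subspace_0\<close>)

lemma finite_coeff_notin:
  assumes "idl.subspace M" shows "finite {i. coeff p i \<notin> M}"
proof (rule finite_subset)
  show "{i. coeff p i \<notin> M} \<subseteq> {..degree p}"
    using idl.subspace_0[OF assms] by (auto simp: coeff_eq_0 intro: ccontr)
qed simp

text \<open>
  Modulo \<open>M\<close> this is the product of the leading coefficients of \<open>p\<close> and \<open>q\<close>.
\<close>
lemma top_coeff_mult:
  fixes p q :: "'r::comm_ring_1 poly"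
  assumes M: "prime_ideal M" and p: "p \<notin> polys_over M" and q: "q \<notin> polys_over M"
  defines "tp \<equiv> (\<lambda>p :: 'r poly. Max {i. coeff p i \<notin> M})"
  shows "coeff (p * q) (tp p + tp q) \<notin> M"
proof -
  note s = prime_idealD(1)[OF M]
  note fin = finite_coeff_notin[OF s]
  have tp_notin: "coeff p (tp p) \<notin> M" if "p \<notin> polys_over M" for p
    using Max_in[OF fin, of p] that by (auto simp: polys_over_def tp_def)
  have above: "coeff p i \<in> M" if "tp p < i" for i and p :: "'r poly"
    using Max_ge[OF fin, of i p] that by (auto simp: tp_def)
  define n where "n = tp p + tp q"
  let ?f = "\<lambda>i. coeff p i * coeff q (n - i)"
  have eq: "?f (tp p) = coeff (p * q) n - (\<Sum>i\<in>{..n} - {tp p}. ?f i)"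
    unfolding coeff_mult by (subst sum.remove[of _ "tp p"]) (auto simp: n_def)
  have "(\<Sum>i\<in>{..n} - {tp p}. ?f i) \<in> M"
  proof (rule idl.subspace_sum[OF s])
    fix i assume "i \<in> {..n} - {tp p}"
    then have "tp p < i \<or> tp q < n - i" by (auto simp: n_def)
    then show "?f i \<in> M" using above idl_mult[OF s] by blast
  qed
  moreover have "?f (tp p) \<notin> M" using tp_notin[OF p] tp_notin[OF q] prime_idealD(3)[OF M]
    by (auto simp: n_def)
  ultimately have "coeff (p * q) n \<notin> M" using idl.subspace_diff[OF s] eq by metis
  then show ?thesis by (simp add: n_def)
qed

text \<open>
  Otherwise \<open>A[u]\<close> is a polynomial ring modulo \<open>M\<close>. Then \<open>1 + u * c\<close>, which is not zero and hence divides
  a power of \<open>c\<close>, is also prime to \<open>c\<close>, so it is a unit, although its degree in \<open>u\<close> is positive.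
\<close>
lemma goldman_adjoin_algebraic:
  assumes M: "prime_ideal M" and A: "subring_set A" and G: "goldman M (adjoin A u)"
  shows "\<exists>p\<in>polys_over A. p \<notin> polys_over M \<and> poly p u \<in> M"
proof (rule ccontr)
  assume "\<not> ?thesis"
  then have trans: "\<And>p. p \<in> polys_over A \<Longrightarrow> poly p u \<in> M \<Longrightarrow> p \<in> polys_over M" by blast
  note s = prime_idealD(1)[OF M]
  note B = adjoin_subring[OF A, of u]
  obtain c where c: "c \<in> adjoin A u" "c \<notin> M"
    "\<And>a. a \<in> adjoin A u \<Longrightarrow> a \<notin> M \<Longrightarrow> \<exists>N. \<exists>w\<in>adjoin A u. c ^ N - a * w \<in> M"
    using G unfolding goldman_def by blast
  obtain C where C: "C \<in> polys_over A" "c = poly C u" using c(1) by (auto simp: adjoin_def)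
  then have "C \<notin> polys_over M" using c(2) poly_in_ideal[OF s] by blast
  then obtain i where i: "coeff C i \<notin> M" by (auto simp: polys_over_def)
  define F where "F = pCons 1 C"
  have F: "F \<in> polys_over A" using C(1) by (simp add: F_def polys_over_closed[OF A] subring_setD[OF A])
  have Fi: "coeff F (Suc i) \<notin> M" using i by (simp add: F_def)
  then have FM: "F \<notin> polys_over M" by (auto simp: polys_over_def)
  define t where "t = - (u * c)"
  have Fu: "poly F u = 1 - t" by (simp add: F_def t_def C)
  have "1 - t \<notin> M" using trans[OF F] FM Fu by auto
  moreover have "1 - t \<in> adjoin A u" unfolding Fu[symmetric] adjoin_def using F by blast
  ultimately obtain N w where w: "w \<in> adjoin A u" "c ^ N - (1 - t) * w \<in> M" using c(3) by blast
  \<comment> \<open>The inverse of \<open>1 - t\<close> modulo \<open>M\<close>: a geometric sum inverts \<open>1 - t\<close> up to \<open>t ^ N\<close>, and \<open>1 - t\<close> divides \<open>c ^ N\<close>.\<close>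
  define v where "v = (\<Sum>i<N. t ^ i) + (- u) ^ N * w"
  have "1 - (1 - t) * v = (1 - (1 - t) * (\<Sum>i<N. t ^ i)) - (- u) ^ N * ((1 - t) * w)"
    by (simp add: v_def algebra_simps)
  also have "1 - (1 - t) * (\<Sum>i<N. t ^ i) = (- u) ^ N * c ^ N"
    unfolding one_diff_power_eq[symmetric] by (simp add: t_def power_mult_distrib[symmetric])
  finally have "1 - (1 - t) * v = (- u) ^ N * (c ^ N - (1 - t) * w)"
    by (simp add: algebra_simps)
  then have vM: "1 - (1 - t) * v \<in> M" using idl_mult(1)[OF s w(2)] by simp
  have "t \<in> adjoin A u" unfolding t_def using B(3) c(1) by (simp add: subring_setD[OF B(1)])
  then have "v \<in> adjoin A u" unfolding v_def using w(1) B(3)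
    by (simp add: subring_set_sum[OF B(1)] subring_setD[OF B(1)])
  then obtain V where V: "V \<in> polys_over A" "v = poly V u" by (auto simp: adjoin_def)
  have "poly (1 - F * V) u \<in> M" using vM by (simp add: V Fu)
  then have FV: "1 - F * V \<in> polys_over M"
    using F V by (intro trans) (simp_all add: polys_over_closed[OF A])
  have "V \<notin> polys_over M"
  proof
    assume "V \<in> polys_over M"
    then have "(1 - F * V) + F * V \<in> polys_over M" using FV by (intro polys_over_ideal(1,4)[OF s])
    then show False using prime_idealD(2)[OF M] polys_overD[of 1 M 0] by simp
  qed
  define a where "a = Max {i. coeff F i \<notin> M} + Max {i. coeff V i \<notin> M}"
  have "Suc i \<le> Max {i. coeff F i \<notin> M}" 
    using Fi finite_coeff_notin[OF s] by (intro Max_ge) auto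
  then have "a > 0" by (simp add: a_def)
  have "coeff (F * V) a \<notin> M"
    unfolding a_def using \<open>V \<notin> polys_over M\<close> FM by (rule top_coeff_mult[OF M, rotated])
  moreover have "coeff (F * V) a = - coeff (1 - F * V) a"
    unfolding coeff_diff coeff_1 using \<open>a > 0\<close> by (simp only: of_bool_def) simp
  ultimately show False using idl.subspace_neg[OF s polys_overD[OF FV, of a]] by metis
qed

text \<open>
  The leading coefficient of \<open>C\<close> need not be invertible, so \<open>p\<close> is multiplied by a power of it first. The
  bound on the degree of the quotient is recorded because zero divisors would prevent its recovery.
\<close>
lemma pseudo_division:
  fixes C p :: "'r::comm_ring_1 poly"
  assumes A: "subring_set A" and C: "C \<in> polys_over A" "C \<noteq> 0" and "p \<in> polys_over A"
  shows "\<exists>k. \<exists>Q\<in>polys_over A. \<exists>R\<in>polys_over A. smult (lead_coeff C ^ k) p = Q * C + R \<and>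
     (R = 0 \<or> degree R < degree C) \<and>
     degree Q \<le> degree p - degree C"
  using \<open>p \<in> polys_over A\<close>
proof (induction "if p = 0 then 0 else Suc (degree p)" arbitrary: p rule: less_induct)
  case less
  note cl = polys_over_closed[OF A]
  show ?case
  proof (cases "p = 0 \<or> degree p < degree C")
    case True
    then show ?thesis using less.prems
      by (intro exI[of _ 0] bexI[of _ 0] bexI[of _ p]) (auto simp: cl)
  next
    case False
    define c where "c = lead_coeff C"
    define d where "d = degree p - degree C"
    define m where "m = monom (lead_coeff p) d"
    define p' where "p' = smult c p - m * C"
    have c: "c \<in> A" using C by (simp add: c_def polys_over_def)
    have m: "m \<in> polys_over A" using less.prems polys_overD by (auto simp: m_def intro!: cl)
    have p': "p' \<in> polys_over A" unfolding p'_def using C c m less.prems by (simp add: cl)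
    have dm: "degree m \<le> d" by (simp add: m_def degree_monom_le)
    have deg: "degree p = d + degree C" using False by (simp add: d_def)
    have "degree (m * C) \<le> degree p"
      using degree_mult_le[of m C] dm deg by linarith
    then have le: "degree p' \<le> degree p"
      unfolding p'_def by (intro degree_diff_le) (auto intro: degree_smult_le)
    have "coeff (m * C) (d + degree C) = lead_coeff p * c"
      by (simp add: m_def coeff_monom_mult c_def)
    then have z: "coeff p' (degree p) = 0"
      by (simp add: p'_def deg[symmetric] mult.commute)
    have "(if p' = 0 then 0 else Suc (degree p')) < (if p = 0 then 0 else Suc (degree p))"
    proof (cases "p' = 0")
      case False
      then have "degree p' \<noteq> degree p" using z leading_coeff_0_iff by metis
      then show ?thesis using le \<open>\<not> (p = 0 \<or> _)\<close> by auto
    qed (use False in auto)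
    from less.hyps[OF this p'] obtain k Q R where kQR:
      "Q \<in> polys_over A" "R \<in> polys_over A" "smult (c ^ k) p' = Q * C + R"
      "R = 0 \<or> degree R < degree C"
      "degree Q \<le> degree p' - degree C" unfolding c_def by blast
    define Q' where "Q' = Q + smult (c ^ k) m"
    have "smult (c ^ k) p' = smult (c ^ Suc k) p - smult (c ^ k) m * C"
      by (simp add: p'_def smult_diff_right mult.commute)
    then have "smult (c ^ Suc k) p = Q' * C + R" using kQR(3) 
      by (simp add: Q'_def distrib_right algebra_simps)
    moreover have "Q' \<in> polys_over A" unfolding Q'_def using kQR c m by (simp add: cl subring_setD[OF A])
    moreover have "degree Q' \<le> d" unfolding Q'_def
    proof (rule degree_add_le)
      show "degree Q \<le> d" using kQR(5) le by (simp add: d_def)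
      show "degree (smult (c ^ k) m) \<le> d"
        using degree_smult_le[of "c ^ k" m] dm by linarith
    qed
    ultimately show ?thesis using kQR(2,4) unfolding c_def d_def
      by (intro exI[of _ "Suc k"] bexI[of _ Q'] bexI[of _ R] conjI)
  qed
qed

text \<open>
  Modulo \<open>M\<close>, let \<open>u\<close> be a root of \<open>p\<close>, of minimal degree \<open>m\<close> and with leading coefficient \<open>a\<close>. By a
  Euclidean argument every nonzero element of \<open>A[u]\<close> divides a nonzero element of \<open>A\<close>; let \<open>b\<close> be such a
  multiple of the element \<open>c\<close> that witnesses the hypothesis. Then every nonzero \<open>e\<close> in \<open>A\<close> divides a
  power of \<open>b\<close> in \<open>A[u]\<close>, and, as the first \<open>m\<close> powers of \<open>u\<close> are independent over \<open>A\<close>, comparing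
  constant coefficients shows that \<open>e\<close> divides a power of \<open>a * b\<close> in \<open>A\<close>.
\<close>
lemma goldman_adjoin:
  fixes M :: "'r::comm_ring_1 set"
  assumes M: "prime_ideal M" and A: "subring_set A" and G: "goldman M (adjoin A u)"
  shows "goldman M A"
proof -
  note s = prime_idealD(1)[OF M]
  note cl = polys_over_closed[OF A]
  note As = subring_setD[OF A]
  define B where "B = adjoin A u"
  note B = adjoin_subring[OF A, of u, folded B_def]
  note Bs = subring_setD[OF B(1)]
  have PB: "poly p u \<in> B" if "p \<in> polys_over A" for p
    using that by (auto simp: B_def adjoin_def)
  have Mm: "a * b \<notin> M" if "a \<notin> M" "b \<notin> M" for a b
    using that prime_idealD(3)[OF M] by blast
  have Mp: "a ^ n \<notin> M" if "a \<notin> M" for a n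
    using that prime_ideal_power[OF M] by blast
  define S where "S = {p \<in> polys_over A. p \<notin> polys_over M \<and> poly p u \<in> M}"
  obtain p where p: "p \<in> S" and min: "\<And>q. q \<in> S \<Longrightarrow> degree p \<le> degree q"
    using goldman_adjoin_algebraic[OF M A G] ex_has_least_nat[of "\<lambda>p. p \<in> S" _ Polynomial.degree]
    unfolding S_def by blast
  have pA: "p \<in> polys_over A" and pM: "p \<notin> polys_over M" and pu: "poly p u \<in> M"
    using p by (auto simp: S_def)
  define m where "m = degree p"
  have indep: "q \<in> polys_over M"
    if "q \<in> polys_over A" "poly q u \<in> M" "q = 0 \<or> degree q < m" for q
  proof (rule ccontr)
    assume *: "q \<notin> polys_over M"
    then have "q \<noteq> 0" using polys_over_ideal(5)[OF s] by auto
    then show False using min[of q] that * by (auto simp: S_def m_def)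
  qed
  \<comment> \<open>A leading term with coefficient in \<open>M\<close> can be dropped without changing the value modulo \<open>M\<close>.\<close>
  have cut: "\<exists>q'. q' \<in> polys_over A \<and> q' \<notin> polys_over M \<and> degree q' < degree q \<and>
      poly q u - poly q' u \<in> M"
    if q: "q \<in> polys_over A" "q \<notin> polys_over M" "lead_coeff q \<in> M" for q
  proof -
    define t where "t = monom (lead_coeff q) (degree q)"
    have tA: "t \<in> polys_over A" unfolding t_def using polys_overD[OF q(1)] by (rule cl(9))
    have tM: "t \<in> polys_over M" unfolding t_def using q(3) by (rule polys_over_ideal(7)[OF s])
    have "degree q \<noteq> 0"
    proof
      assume "degree q = 0"
      then have "q = t" unfolding t_def by (metis degree_eq_zeroE lead_coeff_pCons(2) monom_0)
      then show False using tM q(2) by simp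
    qed
    moreover have "degree (q - t) < degree q \<or> q - t = 0"
    proof -
      have "degree (q - t) \<le> degree q"
        unfolding t_def by (intro degree_diff_le) (auto intro: degree_monom_le)
      moreover have "coeff (q - t) (degree q) = 0" by (simp add: t_def)
      ultimately show ?thesis by (metis le_neq_implies_less leading_coeff_0_iff)
    qed
    moreover have "q - t \<notin> polys_over M"
      using polys_over_ideal(1)[OF s _ tM, of "q - t"] q(2) by auto
    moreover have "q - t \<in> polys_over A" using q(1) tA by (rule cl(2))
    moreover have "poly q u - poly (q - t) u \<in> M" using poly_in_ideal[OF s tM] by simp
    ultimately show ?thesis by (intro exI[of _ "q - t"]) (auto simp: polys_over_ideal(5)[OF s])
  qed
  define a where "a = lead_coeff p"
  have a: "a \<in> A" using pA by (simp add: a_def polys_over_def)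
  have aM: "a \<notin> M"
  proof
    assume "a \<in> M"
    then obtain q where q: "q \<in> polys_over A" "q \<notin> polys_over M" "degree q < degree p"
      "poly p u - poly q u \<in> M" using cut[OF pA pM] unfolding a_def by blast
    then have "poly q u \<in> M" using idl.subspace_diff[OF s pu q(4)] by simp
    then show False using q min[of q] by (simp add: S_def)
  qed
  have m0: "m > 0"
  proof (rule ccontr)
    assume "\<not> m > 0"
    then have "poly p u = a" by (metis a_def degree_eq_zeroE lead_coeff_pCons(2) m_def neq0_conv
          poly_const_conv pCons_0_0)
    then show False using pu aM by simp
  qed
  have p0: "p \<noteq> 0" using m0 by (auto simp: m_def)
  have reduce: "\<exists>k. \<exists>R\<in>polys_over A. a ^ k * poly q u - poly R u \<in> M \<and> (R = 0 \<or> degree R < m)"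
    if q: "q \<in> polys_over A" for q
  proof -
    obtain k Q R where *: "Q \<in> polys_over A" "R \<in> polys_over A" "smult (a ^ k) q = Q * p + R"
      "R = 0 \<or> degree R < m"
      using pseudo_division[OF A pA p0 q] unfolding a_def m_def by blast
    have "a ^ k * poly q u = poly (smult (a ^ k) q) u" by simp
    also have "\<dots> = poly Q u * poly p u + poly R u" by (simp add: *(3))
    finally have "a ^ k * poly q u - poly R u = poly Q u * poly p u" by simp
    then have "a ^ k * poly q u - poly R u \<in> M" using idl_mult(1)[OF s pu] by simp
    then show ?thesis using *(2,4) by blast
  qed
  \<comment> \<open>Euclid's algorithm applied to \<open>p\<close> and \<open>C\<close>; a zero remainder would give \<open>p\<close> a proper factor with root \<open>u\<close>.\<close>
  have norm: "\<exists>b\<in>A. b \<notin> M \<and> (\<exists>w\<in>B. b - w * poly C u \<in> M)"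
    if "C \<in> polys_over A" "C \<notin> polys_over M" "degree C < m" for C
    using that
  proof (induction "degree C" arbitrary: C rule: less_induct)
    case less
    show ?case
    proof (cases "lead_coeff C \<in> M")
      case True
      then obtain q where q: "q \<in> polys_over A" "q \<notin> polys_over M" "degree q < degree C"
        "poly C u - poly q u \<in> M" using cut[OF less.prems(1,2)] by blast
      then obtain b w where w: "b \<in> A" "b \<notin> M" "w \<in> B" "b - w * poly q u \<in> M"
        using less.hyps[OF q(3,1,2)] less.prems(3) by auto
      have "b - w * poly C u = (b - w * poly q u) - w * (poly C u - poly q u)"
        by (simp add: algebra_simps)
      also have "\<dots> \<in> M" by (intro idl.subspace_diff[OF s] w idl_mult(1)[OF s] q)
      finally show ?thesis using w by blast
    next
      case False
      define c where "c = lead_coeff C"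
      have C0: "C \<noteq> 0" using less.prems(2) polys_over_ideal(5)[OF s] by auto
      show ?thesis
      proof (cases "degree C = 0")
        case True
        then have "poly C u = c" by (metis c_def degree_eq_zeroE lead_coeff_pCons(2)
          poly_const_conv pCons_0_0)
        moreover have "c \<in> A" using less.prems(1) by (simp add: c_def polys_over_def)
        ultimately show ?thesis using False Bs(2) idl.subspace_0[OF s]
          by (intro bexI[of _ c] conjI bexI[of _ 1]) (auto simp: c_def)
      next
        case d0: False
        obtain k Q R where *: "Q \<in> polys_over A" "R \<in> polys_over A" "smult (c ^ k) p = Q * C + R"
          "R = 0 \<or> degree R < degree C"
          "degree Q \<le> m - degree C"
          using pseudo_division[OF A less.prems(1) C0 pA] unfolding c_def m_def by blast
        have "c ^ k * poly p u = poly (smult (c ^ k) p) u" by simp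
        also have "\<dots> = poly Q u * poly C u + poly R u" by (simp add: *(3))
        finally have ev: "poly Q u * poly C u + poly R u \<in> M" using idl_mult(1)[OF s pu] by metis
        have "R \<notin> polys_over M"
        proof
          assume R: "R \<in> polys_over M"
          have "poly Q u * poly C u \<in> M"
            using idl.subspace_diff[OF s ev poly_in_ideal[OF s R, of u]] by simp
          moreover have "poly C u \<notin> M" using indep[OF less.prems(1)] less.prems by blast
          ultimately have "poly Q u \<in> M" using prime_idealD(3)[OF M] by blast
          moreover have "degree Q < m" using *(5) d0 m0 by linarith
          ultimately have "Q \<in> polys_over M" using indep *(1) by blast
          then have "smult (c ^ k) p \<in> polys_over M" 
            unfolding *(3) by (intro polys_over_ideal(1,3)[OF s] R)
          then have "c ^ k * a \<in> M" using polys_overD[of _ M m] by (fastforce simp: a_def m_def)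
          then show False using False Mm[OF Mp aM] by (simp add: c_def)
        qed
        moreover have dR: "degree R < degree C" using *(4) d0 by auto
        ultimately obtain b w where w: "b \<in> A" "b \<notin> M" "w \<in> B" "b - w * poly R u \<in> M"
          using less.hyps[OF _ *(2)] less.prems(3) by auto
        have "b - (- (w * poly Q u)) * poly C u = (b - w * poly R u) + w * (poly Q u * poly C u + poly R u)"
          by (simp add: algebra_simps)
        also have "\<dots> \<in> M" by (intro idl.subspace_add[OF s] w idl_mult(1)[OF s] ev)
        finally show ?thesis using w Bs(5)[OF Bs(4)[OF w(3) PB[OF *(1)]]] by blast
      qed
    qed
  qed
  obtain c where c: "c \<in> B" "c \<notin> M"
    "\<And>a. a \<in> B \<Longrightarrow> a \<notin> M \<Longrightarrow> \<exists>N. \<exists>w\<in>B. c ^ N - a * w \<in> M"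
    using G unfolding goldman_def B_def by blast
  have "\<exists>b\<in>A. b \<notin> M \<and> (\<exists>w\<in>B. b - w * c \<in> M)"
  proof -
    obtain C where C: "C \<in> polys_over A" "c = poly C u" using c(1) by (auto simp: B_def adjoin_def)
    obtain k R where R: "R \<in> polys_over A" "a ^ k * c - poly R u \<in> M" "R = 0 \<or> degree R < m"
      using reduce[OF C(1)] C(2) by blast
    have "poly R u \<notin> M"
    proof
      assume "poly R u \<in> M"
      then have "a ^ k * c \<in> M" using idl.subspace_add[OF s R(2)] by fastforce
      then show False using Mm[OF Mp[OF aM] c(2)] by blast
    qed
    then have "R \<notin> polys_over M" using poly_in_ideal[OF s] by blast
    moreover have "degree R < m" using R(3) m0 by auto
    ultimately obtain b w where w: "b \<in> A" "b \<notin> M" "w \<in> B" "b - w * poly R u \<in> M"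
      using norm[OF R(1)] by blast
    have "b - (w * a ^ k) * c = (b - w * poly R u) - w * (a ^ k * c - poly R u)"
      by (simp add: algebra_simps)
    also have "\<dots> \<in> M" by (intro idl.subspace_diff[OF s] w idl_mult(1)[OF s] R)
    finally have "b - (w * a ^ k) * c \<in> M" .
    moreover have "w * a ^ k \<in> B" using w(3) a B(2) Bs by auto
    ultimately show ?thesis using w by blast
  qed
  then obtain b v where b: "b \<in> A" "b \<notin> M" "v \<in> B" "b - v * c \<in> M" by blast
  show "goldman M A"
    unfolding goldman_def
  proof (rule bexI[of _ "a * b"], intro conjI ballI impI)
    show "a * b \<in> A" "a * b \<notin> M" using As(4)[OF a b(1)] Mm[OF aM b(2)] .
    fix e assume e: "e \<in> A" "e \<notin> M"
    obtain N w where w: "w \<in> B" "c ^ N - e * w \<in> M" using c(3)[of e] e B(2) by blast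
    have vw: "v ^ N * w \<in> B" using b(3) w(1) Bs by auto
    then obtain W where W: "W \<in> polys_over A" "v ^ N * w = poly W u" by (auto simp: B_def adjoin_def)
    obtain k R where R: "R \<in> polys_over A" "a ^ k * (v ^ N * w) - poly R u \<in> M"
      "R = 0 \<or> degree R < m"
      using reduce[OF W(1)] W(2) by metis
    have "b ^ N - (v * c) ^ N \<in> M"
      unfolding power_diff_sumr2[of b N "v * c"] using b(4) by (rule idl_mult(2)[OF s])
    then have 1: "b ^ N - v ^ N * c ^ N \<in> M" by (simp add: power_mult_distrib)
    define q where "q = smult e R - [:a ^ k * b ^ N:]"
    have "poly q u = - (a ^ k * (b ^ N - v ^ N * c ^ N) + (a ^ k * v ^ N) * (c ^ N - e * w)
        + e * (a ^ k * (v ^ N * w) - poly R u))"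
      by (simp add: q_def algebra_simps)
    also have "\<dots> \<in> M"
      by (intro idl.subspace_neg[OF s] idl.subspace_add[OF s] idl_mult(1)[OF s] 1 w R)
    finally have "poly q u \<in> M" .
    moreover have "q \<in> polys_over A" unfolding q_def using R(1) e(1) a b(1) by (simp add: cl As)
    moreover have "degree q < m"
      unfolding q_def
    proof (rule degree_diff_less)
      show "degree (smult e R) < m" using R(3) m0 degree_smult_le[of e R] by auto
    qed (simp add: m0)
    ultimately have "q \<in> polys_over M" using indep by blast
    then have q0: "e * coeff R 0 - a ^ k * b ^ N \<in> M"
      using polys_overD[of q M 0] by (simp add: q_def)
    define x where "x = a ^ N * b ^ k * coeff R 0"
    have "(a * b) ^ (k + N) - e * x = - (a ^ N * b ^ k) * (e * coeff R 0 - a ^ k * b ^ N)"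
      by (simp add: x_def algebra_simps power_add power_mult_distrib)
    also have "\<dots> \<in> M" using q0 by (rule idl_mult(1)[OF s])
    finally have "(a * b) ^ (k + N) - e * x \<in> M" .
    moreover have "x \<in> A" unfolding x_def using a b(1) polys_overD[OF R(1), of 0] As by auto
    ultimately show "\<exists>N. \<exists>w\<in>A. (a * b) ^ N - e * w \<in> M" by blast
  qed
qed

lemma subring_set_fold_adjoin: "subring_set A \<Longrightarrow> subring_set (fold (\<lambda>v B. adjoin B v) us A)"
  by (induction us arbitrary: A) (auto simp: adjoin_subring)

lemma fold_adjoin_superset:
  "subring_set A \<Longrightarrow> A \<union> set us \<subseteq> fold (\<lambda>v B. adjoin B v) us A"
proof (induction us arbitrary: A)
  case (Cons u us)
  then show ?case using adjoin_subring[OF Cons.prems, of u] Cons.IH[of "adjoin A u"] by auto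
qed auto

lemma goldman_fold_adjoin:
  assumes "prime_ideal M"
  shows "subring_set A \<Longrightarrow> goldman M (fold (\<lambda>v B. adjoin B v) us A) \<Longrightarrow> goldman M A"
proof (induction us arbitrary: A)
  case (Cons u us)
  then have "goldman M (adjoin A u)" using adjoin_subring(1)[OF Cons.prems(1)] by simp
  then show ?case by (rule goldman_adjoin[OF assms Cons.prems(1)])
qed simp

text \<open>
  Zariski's lemma, when \<open>A\<close> is a field and \<open>us\<close> generates the ring over it. As a field, the quotient by \<open>M\<close> is
  a Goldman domain with \<open>c = 1\<close>; removing the generators one after the other leaves the Goldman
  domain \<open>A[u]\<close>.
\<close>
lemma maximal_ideal_algebraic:
  fixes M :: "'r::comm_ring_1 set"
  assumes M: "prime_ideal M" and max: "\<And>a. a \<notin> M \<Longrightarrow> \<exists>b. 1 - a * b \<in> M"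
    and A: "subring_set A"
    and gen: "\<And>B. subring_set B \<Longrightarrow> A \<union> set us \<subseteq> B \<Longrightarrow> \<forall>t. \<exists>b\<in>B. t - b \<in> M"
  shows "\<exists>p\<in>polys_over A. p \<notin> polys_over M \<and> poly p u \<in> M"
proof -
  note s = prime_idealD(1)[OF M]
  define B where "B = fold (\<lambda>v B. adjoin B v) us (adjoin A u)"
  note A' = adjoin_subring[OF A, of u]
  have B: "subring_set B" unfolding B_def using A'(1) by (rule subring_set_fold_adjoin)
  have "A \<union> set us \<subseteq> B"
    unfolding B_def using fold_adjoin_superset[OF A'(1), of us] A'(2) by blast
  then have repr: "\<exists>b\<in>B. t - b \<in> M" for t using gen[OF B] by blast
  have "goldman M B" unfolding goldman_def
  proof (rule bexI[of _ 1], intro conjI ballI impI)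
    show "1 \<in> B" using subring_setD[OF B] by blast
    show "1 \<notin> M" using prime_idealD(2)[OF M] .
    fix a assume "a \<in> B" "a \<notin> M"
    then obtain b where b: "1 - a * b \<in> M" using max by blast
    obtain w where w: "w \<in> B" "b - w \<in> M" using repr by blast
    have "1 - a * w = (1 - a * b) + a * (b - w)" by (simp add: algebra_simps)
    also have "\<dots> \<in> M" by (intro idl.subspace_add[OF s] b idl_mult(1)[OF s] w)
    finally show "\<exists>N. \<exists>w\<in>B. 1 ^ N - a * w \<in> M" using w(1) by auto
  qed
  then have "goldman M (adjoin A u)" unfolding B_def by (rule goldman_fold_adjoin[OF M A'(1)])
  then show ?thesis by (rule goldman_adjoin_algebraic[OF M A])
qed

section \<open>Hilbert's basis theorem\<close>

definition ideal_of :: "'r::comm_ring_1 set \<Rightarrow> 'r set \<Rightarrow> bool" where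
  "ideal_of A I \<longleftrightarrow> I \<subseteq> A \<and> 0 \<in> I \<and> (\<forall>a\<in>I. \<forall>b\<in>I. a + b \<in> I) \<and> (\<forall>a\<in>I. \<forall>r\<in>A. r * a \<in> I)"

definition noeth_set :: "'r::comm_ring_1 set \<Rightarrow> bool" where
  "noeth_set A \<longleftrightarrow> (\<forall>I. ideal_of A I \<longrightarrow>
     (\<exists>F. finite F \<and> F \<subseteq> I \<and> (\<forall>K. ideal_of A K \<and> F \<subseteq> K \<longrightarrow> I \<subseteq> K)))"

lemma ideal_ofD:
  assumes "ideal_of A I"
  shows "I \<subseteq> A" "0 \<in> I" "a \<in> I \<Longrightarrow> b \<in> I \<Longrightarrow> a + b \<in> I" "a \<in> I \<Longrightarrow> r \<in> A \<Longrightarrow> r * a \<in> I"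
  using assms by (auto simp: ideal_of_def)

lemma noeth_set_field:
  assumes "\<And>a. a \<in> A \<Longrightarrow> a \<noteq> 0 \<Longrightarrow> \<exists>b\<in>A. b * a = 1" 
  shows "noeth_set A"
  unfolding noeth_set_def
proof (intro allI impI)
  fix I assume I: "ideal_of A I"
  show "\<exists>F. finite F \<and> F \<subseteq> I \<and> (\<forall>K. ideal_of A K \<and> F \<subseteq> K \<longrightarrow> I \<subseteq> K)"
  proof (cases "I \<subseteq> {0}")
    case True
    then show ?thesis by (intro exI[of _ "{}"]) (auto dest: ideal_ofD(2))
  next
    case False
    then obtain a where a: "a \<in> I" "a \<noteq> 0" by blast
    then obtain b where b: "b \<in> A" "b * a = 1" using assms ideal_ofD(1)[OF I] by blast
    have "I \<subseteq> K" if K: "ideal_of A K" "a \<in> K" for K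
    proof
      fix c assume "c \<in> I"
      then have "c * (b * a) \<in> K" 
        using ideal_ofD(1)[OF I] by (intro ideal_ofD(4)[OF K(1)] K(2) b(1)) auto
      then show "c \<in> K" by (simp add: b)
    qed
    then show ?thesis using a by (intro exI[of _ "{a}"]) auto
  qed
qed

text \<open>
  The ideals of leading coefficients are finitely generated. As \<open>x\<close> may be algebraic over \<open>A\<close>, a member of
  the \<open>A\<close>-module \<open>U d\<close> spanned by the powers of \<open>x\<close> below \<open>d\<close> can be written in several ways, and
  \<open>L d K\<close> collects the coefficients of \<open>x ^ d\<close> in all expressions of members of \<open>K\<close> with degree at most \<open>d\<close>.
\<close>
theorem hilbert_basis:
  fixes A :: "'r::comm_ring_1 set"
  assumes A: "subring_set A" and noeth: "noeth_set A"
  shows "noeth_set (adjoin A x)"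
  unfolding noeth_set_def
proof (intro allI impI)
  fix I assume I: "ideal_of (adjoin A x) I"
  note B = adjoin_subring[OF A, of x]
  note As = subring_setD[OF A]
  note Bs = subring_setD[OF B(1)]
  note cl = polys_over_closed[OF A]
  define U where "U = (\<lambda>d. (\<lambda>p. poly p x) ` {p \<in> polys_over A. \<forall>i\<ge>d. coeff p i = 0})"
  have UI: "poly p x \<in> U d" if "p \<in> polys_over A" "\<And>i. i \<ge> d \<Longrightarrow> coeff p i = 0" for p d
    using that by (auto simp: U_def)
  have UE: "\<exists>p. u = poly p x \<and> p \<in> polys_over A \<and> (\<forall>i\<ge>d. coeff p i = 0)" if "u \<in> U d" for u d
    using that by (auto simp: U_def)
  have U0: "0 \<in> U d" for d using UI[OF cl(5), of d] by simp
  have Uadd: "u + v \<in> U d" if "u \<in> U d" "v \<in> U d" for u v d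
    using UE[OF that(1)] UE[OF that(2)] UI[of "_ + _" d] cl(1) by (metis add_0 coeff_add poly_add)
  have Uneg: "- u \<in> U d" if "u \<in> U d" for u d
    using UE[OF that] UI[of "- _" d] cl(4) by (metis coeff_minus minus_zero poly_minus)
  have Uscal: "a * u \<in> U d" if "a \<in> A" "u \<in> U d" for a u d
    using UE[OF that(2)] UI[of "smult a _" d] cl(7)[OF that(1)]
    by (metis coeff_smult mult_zero_right poly_smult)
  have Ushift: "x ^ j * u \<in> U (d + j)" if u: "u \<in> U d" for u j d
  proof -
    obtain p where p: "u = poly p x" "p \<in> polys_over A" "\<forall>i\<ge>d. coeff p i = 0"
      using UE[OF u] by blast
    have "poly (monom 1 j * p) x \<in> U (d + j)"
      using p(3) by (intro UI cl(3) cl(9) As p) (auto simp: coeff_monom_mult)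
    then show ?thesis by (simp add: p poly_monom)
  qed
  have Usplit: "\<exists>a\<in>A. \<exists>u\<in>U d. b = a * x ^ d + u" if u: "b \<in> U (Suc d)" for b d
  proof -
    obtain p where p: "b = poly p x" "p \<in> polys_over A" "\<forall>i\<ge>Suc d. coeff p i = 0"
      using UE[OF u] by blast
    define a where "a = coeff p d"
    have a: "a \<in> A" using p by (simp add: a_def polys_over_def)
    have "coeff (p - monom a d) i = 0" if "i \<ge> d" for i
      using that p(3) by (cases "i = d") (auto simp: a_def)
    then have "poly (p - monom a d) x \<in> U d" using a p by (intro UI cl) auto
    then show ?thesis using a by (intro bexI[of _ a] bexI[of _ "poly (p - monom a d) x"])
        (auto simp: p poly_monom)
  qed
  have BU: "\<exists>d. b \<in> U d" if b: "b \<in> adjoin A x" for b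
  proof -
    obtain p where "b = poly p x" "p \<in> polys_over A" using b by (auto simp: adjoin_def)
    then show ?thesis using UI[of p "Suc (degree p)"] by (auto simp: coeff_eq_0)
  qed
  note Is = ideal_ofD[OF I]
  have xB: "x ^ j \<in> adjoin A x" for j by (intro Bs(7) B(3))
  define L where "L = (\<lambda>d K. {a \<in> A. \<exists>u\<in>U d. a * x ^ d + u \<in> K})"
  have Lid: "ideal_of A (L d K)" if K: "ideal_of (adjoin A x) K" for d K
    unfolding ideal_of_def
  proof (intro conjI ballI)
    note Ks = ideal_ofD[OF K]
    show "L d K \<subseteq> A" by (auto simp: L_def)
    show "0 \<in> L d K" using Ks(2) U0 As by (auto simp: L_def intro!: bexI[of _ 0])
    fix a assume "a \<in> L d K"
    then obtain u where u: "a \<in> A" "u \<in> U d" "a * x ^ d + u \<in> K" by (auto simp: L_def)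
    {
      fix b assume "b \<in> L d K"
      then obtain v where v: "b \<in> A" "v \<in> U d" "b * x ^ d + v \<in> K" by (auto simp: L_def)
      have "(a + b) * x ^ d + (u + v) \<in> K" using Ks(3)[OF u(3) v(3)] by (simp add: algebra_simps)
      then show "a + b \<in> L d K" using u v As Uadd by (auto simp: L_def)
    }
    {
      fix r assume r: "r \<in> A"
      then have "(r * a) * x ^ d + r * u \<in> K" using Ks(4)[OF u(3), of r] B(2) by (auto simp: algebra_simps)
      then show "r * a \<in> L d K" using u r As Uscal by (auto simp: L_def)
    }
  qed
  have Lshift: "L d K \<subseteq> L (d + j) K" if K: "ideal_of (adjoin A x) K" for d j K
  proof
    fix a assume "a \<in> L d K"
    then obtain u where u: "a \<in> A" "u \<in> U d" "a * x ^ d + u \<in> K" by (auto simp: L_def)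
    have "a * x ^ (d + j) + x ^ j * u \<in> K"
      using ideal_ofD(4)[OF K u(3) xB[of j]] by (simp add: algebra_simps power_add)
    then show "a \<in> L (d + j) K" using u(1) Ushift[OF u(2)] by (auto simp: L_def)
  qed
  have "ideal_of A (\<Union>d. L d I)"
    unfolding ideal_of_def
  proof (intro conjI ballI)
    show "(\<Union>d. L d I) \<subseteq> A" by (auto simp: L_def)
    show "0 \<in> (\<Union>d. L d I)" using ideal_ofD(2)[OF Lid[OF I]] by blast
    fix a assume "a \<in> (\<Union>d. L d I)"
    then obtain d where d: "a \<in> L d I" by blast
    { fix b assume "b \<in> (\<Union>d. L d I)"
      then obtain e where e: "b \<in> L e I" by blast
      have "a \<in> L (d + e) I" "b \<in> L (d + e) I"
        using Lshift[OF I, of d e] Lshift[OF I, of e d] d e by (auto simp: add.commute)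
      then show "a + b \<in> (\<Union>d. L d I)" using ideal_ofD(3)[OF Lid[OF I]] by blast }
    { fix r assume "r \<in> A"
      then show "r * a \<in> (\<Union>d. L d I)" using ideal_ofD(4)[OF Lid[OF I] d] by blast }
  qed
  then obtain G where G: "finite G" "G \<subseteq> (\<Union>d. L d I)"
    and Gmin: "\<And>K. ideal_of A K \<Longrightarrow> G \<subseteq> K \<Longrightarrow> (\<Union>d. L d I) \<subseteq> K"
    using noeth unfolding noeth_set_def by meson
  have "\<forall>g\<in>G. \<exists>d. g \<in> L d I" using G(2) by blast
  then obtain \<delta> where \<delta>: "\<And>g. g \<in> G \<Longrightarrow> g \<in> L (\<delta> g) I" by metis
  define N where "N = Max (insert 0 (\<delta> ` G))"
  have N: "\<delta> g \<le> N" if "g \<in> G" for g using that G(1) by (auto simp: N_def)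
  have "\<forall>d. \<exists>F. finite F \<and> F \<subseteq> L d I \<and> (\<forall>K. ideal_of A K \<and> F \<subseteq> K \<longrightarrow> L d I \<subseteq> K)"
    using noeth Lid[OF I] unfolding noeth_set_def by blast
  then obtain H where H: "\<And>d. finite (H d)" "\<And>d. H d \<subseteq> L d I"
    and Hmin: "\<And>d K. ideal_of A K \<Longrightarrow> H d \<subseteq> K \<Longrightarrow> L d I \<subseteq> K" by metis
  have "\<forall>d. \<forall>g\<in>L d I. \<exists>b\<in>I. \<exists>u\<in>U d. b = g * x ^ d + u" by (auto simp: L_def)
  then obtain \<beta> where \<beta>: "\<And>d g. g \<in> L d I \<Longrightarrow> \<beta> d g \<in> I \<and> (\<exists>u\<in>U d. \<beta> d g = g * x ^ d + u)"
    by metis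
  \<comment> \<open>\<open>G\<close> generates all leading coefficients and serves in degrees from \<open>N\<close> on; \<open>H d\<close> serves in the degree \<open>d < N\<close>.\<close>
  define F where "F = (\<lambda>g. \<beta> (\<delta> g) g) ` G \<union> (\<Union>d<N. \<beta> d ` H d)"
  show "\<exists>F. finite F \<and> F \<subseteq> I \<and> (\<forall>K. ideal_of (adjoin A x) K \<and> F \<subseteq> K \<longrightarrow> I \<subseteq> K)"
  proof (intro exI[of _ F] conjI allI impI)
    show "finite F" using G(1) H(1) by (auto simp: F_def)
    show "F \<subseteq> I" unfolding F_def using \<beta> \<delta> H(2) by blast
    fix K assume "ideal_of (adjoin A x) K \<and> F \<subseteq> K"
    then have K: "ideal_of (adjoin A x) K" and FK: "F \<subseteq> K" by auto
    have KI: "ideal_of (adjoin A x) (K \<inter> I)"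
      using K I by (auto simp: ideal_of_def)
    have FKI: "F \<subseteq> K \<inter> I" using FK \<open>F \<subseteq> I\<close> by blast
    have lead: "L d I \<subseteq> L d (K \<inter> I)" for d
    proof (cases "d < N")
      case True
      have "g \<in> L d (K \<inter> I)" if g: "g \<in> H d" for g
      proof -
        have "g \<in> L d I" using g H(2) by blast
        then obtain u where "u \<in> U d" "\<beta> d g = g * x ^ d + u" using \<beta> by blast
        moreover have "\<beta> d g \<in> K \<inter> I" using FKI g True unfolding F_def by blast
        ultimately show ?thesis using \<open>g \<in> L d I\<close> by (auto simp: L_def)
      qed
      then show ?thesis by (intro Hmin Lid KI) blast
    next
      case False
      have "g \<in> L d (K \<inter> I)" if g: "g \<in> G" for g
      proof -
        have gL: "g \<in> L (\<delta> g) I" using g \<delta> by blast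
        then obtain u where "u \<in> U (\<delta> g)" "\<beta> (\<delta> g) g = g * x ^ \<delta> g + u" using \<beta> by blast
        moreover have "\<beta> (\<delta> g) g \<in> K \<inter> I" using FKI g unfolding F_def by blast
        ultimately have "g \<in> L (\<delta> g) (K \<inter> I)" using gL by (auto simp: L_def)
        then show ?thesis using Lshift[OF KI, of "\<delta> g" "d - \<delta> g"] N[OF g] False by auto
      qed
      then have "(\<Union>d. L d I) \<subseteq> L d (K \<inter> I)" by (intro Gmin Lid KI) blast
      then show ?thesis by blast
    qed
    have "I \<inter> U d \<subseteq> K" for d
    proof (induction d)
      case 0
      have "U 0 \<subseteq> {0}"
      proof
        fix u assume "u \<in> U 0"
        then obtain p where "u = poly p x" "\<forall>i. coeff p i = 0" using UE[of u 0] by auto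
        then have "p = 0" by (intro poly_eqI) simp
        then show "u \<in> {0}" using \<open>u = _\<close> by simp
      qed
      then show ?case using ideal_ofD(2)[OF K] by blast
    next
      case (Suc d)
      show ?case
      proof
        fix b assume b: "b \<in> I \<inter> U (Suc d)"
        then obtain a u where u: "a \<in> A" "u \<in> U d" "b = a * x ^ d + u" using Usplit by blast
        then have "a \<in> L d I" using b by (auto simp: L_def)
        then have "a \<in> L d (K \<inter> I)" using lead by blast
        then obtain v where v: "v \<in> U d" "a * x ^ d + v \<in> K \<inter> I" by (auto simp: L_def)
        have m1: "- 1 \<in> adjoin A x" by (rule Bs(5)[OF Bs(2)])
        have eq: "u + - v = b + (- 1) * (a * x ^ d + v)" by (simp add: u)
        have "u + - v \<in> I" unfolding eq
          using Is(3)[of b "(- 1) * (a * x ^ d + v)"] Is(4)[OF _ m1, of "a * x ^ d + v"] b v by blast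
        then have "u + - v \<in> I \<inter> U d" using Uadd[OF u(2) Uneg[OF v(1)]] by blast
        then have "u + - v \<in> K" using Suc.IH by blast
        then have "(u + - v) + (a * x ^ d + v) \<in> K" using v ideal_ofD(3)[OF K] by blast
        then show "b \<in> K" by (simp add: u add.commute)
      qed
    qed
    then show "I \<subseteq> K" using BU Is(1) by blast
  qed
qed

section \<open>Polynomials in many variables\<close>

abbreviation keys :: "('a \<Rightarrow>\<^sub>0 'b::zero) \<Rightarrow> 'a set" where "keys \<equiv> Poly_Mapping.keys"

abbreviation lookup :: "('a \<Rightarrow>\<^sub>0 'b::zero) \<Rightarrow> 'a \<Rightarrow> 'b" where "lookup \<equiv> Poly_Mapping.lookup"

abbreviation single :: "'a \<Rightarrow> 'b \<Rightarrow> ('a \<Rightarrow>\<^sub>0 'b::zero)" where "single \<equiv> Poly_Mapping.single"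

type_synonym ('v, 'k) mpoly = "('v \<Rightarrow>\<^sub>0 nat) \<Rightarrow>\<^sub>0 'k"

definition cst :: "'k::field \<Rightarrow> ('v, 'k) mpoly" where
  "cst c = single 0 c"

lemma cst_hom: "cst 0 = 0" "cst 1 = 1" "cst (a + b) = cst a + cst b" "cst (a * b) = cst a * cst b"
  "cst (- a) = - cst a"
  by (simp_all add: cst_def single_add mult_single single_uminus)

lemma cst_unit: "c \<noteq> 0 \<Longrightarrow> cst (inverse c) * cst c = 1"
  by (simp add: cst_hom(4)[symmetric] cst_hom(2))

lemma keys_add_nat: "keys (a + b) = keys a \<union> keys b"
  for a b :: "'v \<Rightarrow>\<^sub>0 nat"
  by (auto simp: in_keys_iff lookup_add)

lemma mpoly_expand: "p = (\<Sum>m\<in>keys p. single m (lookup p m))"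
proof (rule poly_mapping_eqI)
  fix k
  have "(\<Sum>m\<in>keys p. lookup (single m (lookup p m)) k)
      = (\<Sum>m\<in>keys p. if m = k then lookup p m else 0)"
    by (rule sum.cong) (auto simp: lookup_single when_def)
  then show "lookup p k =
     lookup (\<Sum>m\<in>keys p. single m (lookup p m)) k"
    by (simp add: lookup_sum sum.delta' in_keys_iff)
qed

lemma mpoly_var_power: "(mpoly_var v :: ('v, 'k::field) mpoly) ^ n = single (single v n) 1"
  by (induction n) (simp_all add: mpoly_var_def mult_single single_add[symmetric])

lemma monomial_eq_prod:
  "(single m c :: ('v, 'k::field) mpoly) =
     cst c * (\<Prod>v\<in>keys m. mpoly_var v ^ lookup m v)"
proof -
  have "(\<Prod>v\<in>S. mpoly_var v ^ f v :: ('v, 'k) mpoly) =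
      single (\<Sum>v\<in>S. single v (f v)) 1" if "finite S" for S f
    using that by induction (simp_all add: mpoly_var_power mult_single)
  then show ?thesis by (simp add: mpoly_expand[symmetric] cst_def mult_single)
qed

definition mpolys_in :: "'v set \<Rightarrow> ('v, 'k::field) mpoly set" where
  "mpolys_in W = {p. \<forall>m\<in>keys p. keys m \<subseteq> W}"

lemma mpolys_in_subring: "subring_set (mpolys_in W :: ('v, 'k::field) mpoly set)"
proof -
  have "p * q \<in> mpolys_in W" if "p \<in> mpolys_in W" "q \<in> mpolys_in W" for p q :: "('v, 'k) mpoly"
    using that keys_mult[of p q] by (fastforce simp: mpolys_in_def keys_add_nat)
  moreover have "p + q \<in> mpolys_in W" if "p \<in> mpolys_in W" "q \<in> mpolys_in W" for p q :: "('v, 'k) mpoly"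
    using that keys_add[of p q] by (fastforce simp: mpolys_in_def)
  moreover have "- p \<in> mpolys_in W" if "p \<in> mpolys_in W" for p :: "('v, 'k) mpoly"
    using that by (auto simp: mpolys_in_def in_keys_iff)
  moreover have "0 \<in> mpolys_in W" "1 \<in> mpolys_in W" by (auto simp: mpolys_in_def)
  ultimately show ?thesis unfolding subring_set_def by blast
qed

lemma mpolys_in_minimal:
  fixes B :: "('v, 'k::field) mpoly set"
  assumes B: "subring_set B" "range cst \<subseteq> B" "mpoly_var ` W \<subseteq> B"
  shows "mpolys_in W \<subseteq> B"
proof
  note Bs = subring_setD[OF B(1)]
  fix p :: "('v, 'k) mpoly" assume p: "p \<in> mpolys_in W"
  have prodB: "prod f S \<in> B" if "\<And>v. v \<in> S \<Longrightarrow> f v \<in> B" for f :: "'v \<Rightarrow> _" and S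
    using that by (induction S rule: infinite_finite_induct) (auto simp: Bs)
  have "single m c \<in> B" if "keys m \<subseteq> W" for m c
    unfolding monomial_eq_prod using that B by (intro Bs(4) prodB Bs(7)) auto
  then show "p \<in> B"
    using p by (subst mpoly_expand) (auto intro!: subring_set_sum[OF B(1)] simp: mpolys_in_def)
qed

lemma range_cst_subring: "subring_set (range cst :: ('v, 'k::field) mpoly set)"
  unfolding subring_set_def
proof (intro conjI ballI)
  show "0 \<in> range cst" "1 \<in> range cst" by (metis cst_hom(1) rangeI, metis cst_hom(2) rangeI)
  fix a :: "('v, 'k) mpoly" assume "a \<in> range cst"
  then obtain c where c: "a = cst c" by blast
  show "- a \<in> range cst" unfolding c cst_hom(5)[symmetric] by blast
  fix b :: "('v, 'k) mpoly" assume "b \<in> range cst"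
  then obtain d where d: "b = cst d" by blast
  show "a + b \<in> range cst" "a * b \<in> range cst"
    unfolding c d cst_hom(3,4)[symmetric] by blast+
qed

lemma cst_in_mpolys: "cst c \<in> mpolys_in W"
  by (auto simp: mpolys_in_def cst_def)

lemma var_in_mpolys: "v \<in> W \<Longrightarrow> mpoly_var v \<in> mpolys_in W"
  by (auto simp: mpolys_in_def mpoly_var_def)

lemma noeth_mpolys_in:
  assumes "finite W" shows "noeth_set (mpolys_in W :: ('v, 'k::field) mpoly set)"
  using assms
proof induction
  case empty
  have "noeth_set (range cst :: ('v, 'k) mpoly set)"
    by (rule noeth_set_field) (metis cst_hom(1) cst_unit rangeE rangeI)
  moreover have "mpolys_in {} = (range cst :: ('v, 'k) mpoly set)"
  proof
    show "mpolys_in {} \<subseteq> (range cst :: ('v, 'k) mpoly set)"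
      by (rule mpolys_in_minimal[OF range_cst_subring]) auto
  qed (auto simp: cst_in_mpolys)
  ultimately show ?case by simp
next
  case (insert v W)
  let ?A = "mpolys_in W :: ('v, 'k) mpoly set"
  let ?B = "mpolys_in (insert v W) :: ('v, 'k) mpoly set"
  have A: "subring_set (adjoin ?A (mpoly_var v))" "?A \<subseteq> adjoin ?A (mpoly_var v)"
    "mpoly_var v \<in> adjoin ?A (mpoly_var v)"
    by (rule adjoin_subring[OF mpolys_in_subring])+
  have "?B \<subseteq> adjoin ?A (mpoly_var v)"
  proof (rule mpolys_in_minimal[OF A(1)])
    show "range cst \<subseteq> adjoin ?A (mpoly_var v)" using A(2) cst_in_mpolys by blast
    show "mpoly_var ` insert v W \<subseteq> adjoin ?A (mpoly_var v)" 
    proof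
      fix t :: "('v, 'k) mpoly" assume "t \<in> mpoly_var ` insert v W"
      then obtain w where w: "t = mpoly_var w" "w = v \<or> w \<in> W" by auto
      show "t \<in> adjoin ?A (mpoly_var v)"
      proof (cases "w = v")
        case False
        then have "t \<in> ?A" using w by (simp add: var_in_mpolys)
        then show ?thesis by (rule subsetD[OF A(2)])
      qed (use A(3) w in simp)
    qed
  qed
  moreover have "adjoin ?A (mpoly_var v) \<subseteq> ?B"
  proof
    fix t assume "t \<in> adjoin ?A (mpoly_var v)"
    then obtain p where p: "t = poly p (mpoly_var v)" "p \<in> polys_over ?A" by (auto simp: adjoin_def)
    note Bs = subring_setD[OF mpolys_in_subring[of "insert v W"]]
    have "?A \<subseteq> ?B" by (auto simp: mpolys_in_def)
    then show "t \<in> ?B"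
      unfolding p(1) poly_altdef using polys_overD[OF p(2)]
      by (intro subring_set_sum[OF mpolys_in_subring] Bs(4) Bs(7) var_in_mpolys) (blast, simp)
  qed
  ultimately show ?case using hilbert_basis[OF mpolys_in_subring insert.IH, of "mpoly_var v"] by simp
qed

text \<open>
  The endomorphism that sends the variables outside \<open>W\<close> to \<open>0\<close>.
\<close>
definition restrict_vars :: "'v set \<Rightarrow> ('v, 'k::field) mpoly \<Rightarrow> ('v, 'k) mpoly" where
  "restrict_vars W p = Abs_poly_mapping (\<lambda>m. if keys m \<subseteq> W then lookup p m else 0)"

lemma lookup_restrict_vars:
  "lookup (restrict_vars W p) m = (if keys m \<subseteq> W then lookup p m else 0)"
proof -
  have "finite {m. (if keys m \<subseteq> W then lookup p m else 0) \<noteq> 0}"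
    by (rule finite_subset[OF _ finite_keys[of p]]) (auto simp: in_keys_iff)
  then show ?thesis unfolding restrict_vars_def by simp
qed

lemma restrict_vars_add: "restrict_vars W (p + q) = restrict_vars W p + restrict_vars W q"
  by (rule poly_mapping_eqI) (simp add: lookup_restrict_vars lookup_add)

lemma restrict_vars_mult: "restrict_vars W (p * q) = restrict_vars W p * restrict_vars W q"
proof (rule poly_mapping_eqI)
  fix k
  show "lookup (restrict_vars W (p * q)) k =
      lookup (restrict_vars W p * restrict_vars W q) k"
  proof (cases "keys k \<subseteq> W")
    case True
    have "lookup p l * (\<Sum>m. lookup q m when k = l + m) =
        lookup (restrict_vars W p) l *
          (\<Sum>m. lookup (restrict_vars W q) m when k = l + m)" for l
    proof -
      have "(lookup q m when k = l + m) =
          (lookup (restrict_vars W q) m when k = l + m)" for m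
        using True by (auto simp: when_def lookup_restrict_vars keys_add_nat)
      moreover have "(\<Sum>m. lookup q m when k = l + m) = 0" if "\<not> keys l \<subseteq> W"
      proof -
        have "(lookup q m when k = l + m) = 0" for m
          using True that by (auto simp: when_def keys_add_nat)
        then show ?thesis by simp
      qed
      ultimately show ?thesis by (auto simp: lookup_restrict_vars[of W p])
    qed
    then show ?thesis using True by (simp add: lookup_restrict_vars lookup_mult)
  next
    case False
    have "k \<notin> keys (restrict_vars W p * restrict_vars W q)"
    proof
      assume "k \<in> keys (restrict_vars W p * restrict_vars W q)"
      then obtain a b where "k = a + b" "a \<in> keys (restrict_vars W p)"
        "b \<in> keys (restrict_vars W q)" using keys_mult[of "restrict_vars W p" "restrict_vars W q"] by blast
      then have "keys k \<subseteq> W"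
        by (auto simp: keys_add_nat in_keys_iff lookup_restrict_vars split: if_splits)
      then show False using False by simp
    qed
    then show ?thesis using False by (simp add: lookup_restrict_vars in_keys_iff)
  qed
qed

lemma restrict_vars_simps [simp]:
  "restrict_vars W 0 = 0" "restrict_vars W 1 = 1" "restrict_vars W (cst c) = cst c"
  "v \<in> W \<Longrightarrow> restrict_vars W (mpoly_var v) = mpoly_var v"
  "v \<notin> W \<Longrightarrow> restrict_vars W (mpoly_var v) = 0"
  "restrict_vars W (- p) = - restrict_vars W p"
  "restrict_vars W (p - q) = restrict_vars W p - restrict_vars W q"
  by (rule poly_mapping_eqI; auto simp: lookup_restrict_vars lookup_one lookup_single cst_def mpoly_var_def
      when_def lookup_minus)+

lemma restrict_vars_power: "restrict_vars W (p ^ n) = restrict_vars W p ^ n"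
  by (induction n) (simp_all add: restrict_vars_mult)

lemma restrict_vars_prod: "restrict_vars W (prod f A) = (\<Prod>a\<in>A. restrict_vars W (f a))"
  by (induction A rule: infinite_finite_induct) (simp_all add: restrict_vars_mult)

lemma restrict_vars_sum: "restrict_vars W (sum f A) = (\<Sum>a\<in>A. restrict_vars W (f a))"
  by (induction A rule: infinite_finite_induct) (simp_all add: restrict_vars_add)

lemma restrict_vars_in: "restrict_vars W p \<in> mpolys_in W"
proof -
  have "keys m \<subseteq> W" if "m \<in> keys (restrict_vars W p)" for m
    using that unfolding in_keys_iff[where s = "restrict_vars W p"] lookup_restrict_vars
    by (auto split: if_splits)
  then show ?thesis by (auto simp: mpolys_in_def)
qed

lemma restrict_vars_id: "p \<in> mpolys_in W \<Longrightarrow> restrict_vars W p = p"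
  by (rule poly_mapping_eqI)
    (auto simp: mpolys_in_def lookup_restrict_vars simp flip: not_in_keys_iff_lookup_eq_zero)

lemma monomial_in_ideal:
  fixes I :: "('v, 'k::field) mpoly set"
  assumes I: "idl.subspace I" and v: "mpoly_var v \<in> I" "v \<in> keys m"
  shows "single m c \<in> I"
proof -
  obtain n where n: "lookup m v = Suc n" using v(2) by (cases "lookup m v") (auto simp: in_keys_iff)
  have "mpoly_var v ^ lookup m v \<in> I" using idl_mult(2)[OF I v(1)] by (simp add: n)
  then have "(\<Prod>w\<in>keys m. mpoly_var w ^ lookup m w) \<in> I"
    using v(2) by (subst prod.remove[of _ v]) (auto intro: idl_mult(2)[OF I])
  then show ?thesis unfolding monomial_eq_prod by (rule idl_mult(1)[OF I])
qed

lemma minus_restrict_vars_in_ideal: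
  fixes I :: "('v, 'k::field) mpoly set"
  assumes I: "idl.subspace I" and v: "\<And>v. v \<notin> W \<Longrightarrow> mpoly_var v \<in> I"
  shows "p - restrict_vars W p \<in> I"
proof (subst mpoly_expand, rule idl.subspace_sum[OF I])
  fix m assume "m \<in> keys (p - restrict_vars W p)"
  then have "\<not> keys m \<subseteq> W"
    by (auto simp: in_keys_iff lookup_minus lookup_restrict_vars)
  then obtain w where "w \<in> keys m" "w \<notin> W" by blast
  then show "single m (lookup (p - restrict_vars W p) m) \<in> I"
    using v by (intro monomial_in_ideal[OF I])
qed

text \<open>
  Modulo the variables outside the finite set \<open>V\<close> every polynomial is congruent to its restriction to \<open>V\<close>.
\<close>
lemma noeth_mod_mpoly:
  fixes J :: "('v, 'k::field) mpoly set"
  assumes V: "finite V" and J: "idl.subspace J" "\<And>v. v \<notin> V \<Longrightarrow> mpoly_var v \<in> J"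
  shows "noeth_mod J"
  unfolding noeth_mod_def
proof (intro allI impI)
  let ?A = "mpolys_in V :: ('v, 'k) mpoly set"
  note As = subring_setD[OF mpolys_in_subring[of V]]
  have ideal: "ideal_of ?A (I \<inter> ?A)" if "idl.subspace I" for I :: "('v, 'k) mpoly set"
    using that As unfolding ideal_of_def
    by (auto intro: idl.subspace_0 idl.subspace_add idl_mult(1))
  fix I :: "('v, 'k) mpoly set" assume I: "idl.subspace I \<and> J \<subseteq> I"
  then have "ideal_of ?A (I \<inter> ?A)" by (intro ideal) auto
  then have "\<exists>F. finite F \<and> F \<subseteq> I \<inter> ?A \<and> (\<forall>K. ideal_of ?A K \<and> F \<subseteq> K \<longrightarrow> I \<inter> ?A \<subseteq> K)"
    by (rule noeth_mpolys_in[OF V, unfolded noeth_set_def, rule_format])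
  then obtain F where F: "finite F" "F \<subseteq> I \<inter> ?A"
    and min: "\<forall>K. ideal_of ?A K \<and> F \<subseteq> K \<longrightarrow> I \<inter> ?A \<subseteq> K"
    by (elim exE conjE)
  have "I \<subseteq> idl.span (J \<union> F)"
  proof
    fix p assume p: "p \<in> I"
    have *: "p - restrict_vars V p \<in> J" by (rule minus_restrict_vars_in_ideal[OF J])
    then have "p - restrict_vars V p \<in> I" using I by blast
    then have "p - (p - restrict_vars V p) \<in> I" using p I idl.subspace_diff by blast
    then have "restrict_vars V p \<in> I \<inter> ?A" using restrict_vars_in by auto
    also have "I \<inter> ?A \<subseteq> idl.span (J \<union> F) \<inter> ?A"
      using F by (intro min[rule_format] conjI ideal) (auto intro: idl.span_base)
    finally have "restrict_vars V p + (p - restrict_vars V p) \<in> idl.span (J \<union> F)"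
      using * by (intro idl.span_add) (auto intro: idl.span_base)
    then show "p \<in> idl.span (J \<union> F)" by simp
  qed
  moreover have "idl.span (J \<union> F) \<subseteq> I" using I F(2) by (intro idl.span_minimal) auto
  ultimately show "\<exists>F. finite F \<and> I = idl.span (J \<union> F)" using F(1) by blast
qed

section \<open>Quotient rings as images of a commutative ring type\<close>

text \<open>
  A ring with carrier that is a quotient of the commutative ring \<open>'r\<close>. Ideals, primes, maximal ideals and
  regular sequences on both sides correspond, so that arguments can be given for ideals of a type.
\<close>
locale ring_presentation = cring R for R :: "('a, 'm) ring_scheme" (structure) +
  fixes \<phi> :: "'r::comm_ring_1 \<Rightarrow> 'a"
  assumes phi_add: "\<phi> (a + b) = \<phi> a \<oplus> \<phi> b"
    and phi_mult: "\<phi> (a * b) = \<phi> a \<otimes> \<phi> b"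
    and phi_one: "\<phi> 1 = \<one>"
    and phi_surj: "range \<phi> = carrier R"
begin

definition ker :: "'r set" where "ker = {t. \<phi> t = \<zero>}"

lemma phi_closed [simp]: "\<phi> a \<in> carrier R"
  using phi_surj by blast

lemma phi_zero [simp]: "\<phi> 0 = \<zero>"
proof -
  have "\<phi> 0 \<oplus> \<phi> 0 = \<phi> 0" using phi_add[of 0 0] by simp
  then show ?thesis using add.l_cancel_one'[of "\<phi> 0" "\<phi> 0"] by simp
qed

lemma phi_neg: "\<phi> (- a) = \<ominus> \<phi> a"
proof -
  have "\<phi> (- a) \<oplus> \<phi> a = \<zero>" using phi_add[of "- a" a] by simp
  then show ?thesis by (intro minus_equality[symmetric]) auto
qed

lemma phi_eq_iff: "\<phi> a = \<phi> b \<longleftrightarrow> a - b \<in> ker"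
proof -
  have "\<phi> (a - b) = \<phi> a \<ominus> \<phi> b" using phi_add[of a "- b"] by (simp add: phi_neg a_minus_def)
  then show ?thesis by (simp add: ker_def)
qed

lemma pull_ideal:
  assumes "ideal P R" shows "idl.subspace (\<phi> -` P)" "ker \<subseteq> \<phi> -` P"
proof -
  interpret P: ideal P R by fact
  show "idl.subspace (\<phi> -` P)"
    by (rule idl.subspaceI) (auto simp: phi_add phi_mult P.I_l_closed)
  show "ker \<subseteq> \<phi> -` P" by (auto simp: ker_def)
qed

lemma push_pull: "P \<subseteq> carrier R \<Longrightarrow> \<phi> ` (\<phi> -` P) = P"
  using phi_surj by auto

lemma pull_push:
  assumes "idl.subspace Q" "ker \<subseteq> Q" shows "\<phi> -` (\<phi> ` Q) = Q"
proof
  show "\<phi> -` (\<phi> ` Q) \<subseteq> Q"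
  proof
    fix a assume "a \<in> \<phi> -` (\<phi> ` Q)"
    then obtain b where b: "b \<in> Q" "\<phi> a = \<phi> b" by auto
    then have "(a - b) + b \<in> Q" using assms(2) phi_eq_iff by (intro idl.subspace_add[OF assms(1)]) auto
    then show "a \<in> Q" by simp
  qed
qed auto

lemma push_ideal:
  assumes Q: "idl.subspace Q" shows "ideal (\<phi> ` Q) R"
proof (rule idealI)
  show "ring R" by (rule ring_axioms)
  show "subgroup (\<phi> ` Q) (add_monoid R)"
  proof (rule add.subgroupI)
    show "\<phi> ` Q \<noteq> {}" using idl.subspace_0[OF Q] by blast
    fix x assume "x \<in> \<phi> ` Q"
    then obtain a where a: "x = \<phi> a" "a \<in> Q" by blast
    show "\<ominus> x \<in> \<phi> ` Q"
      using idl.subspace_neg[OF Q a(2)] by (auto simp: a phi_neg[symmetric])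
    fix y assume "y \<in> \<phi> ` Q"
    then obtain b where b: "y = \<phi> b" "b \<in> Q" by blast
    show "x \<oplus> y \<in> \<phi> ` Q"
      using idl.subspace_add[OF Q a(2) b(2)] by (auto simp: a b phi_add[symmetric])
  qed auto
  fix x y assume "x \<in> \<phi> ` Q" "y \<in> carrier R"
  then obtain a b where a: "x = \<phi> a" "a \<in> Q" "y = \<phi> b" using phi_surj by blast
  show "y \<otimes> x \<in> \<phi> ` Q" "x \<otimes> y \<in> \<phi> ` Q"
    using idl_mult[OF Q a(2), of b] by (auto simp: a phi_mult[symmetric])
qed

lemma Idl_push: "Idl (\<phi> ` S) = \<phi> ` idl.span (ker \<union> S)"
proof
  have "S \<subseteq> idl.span (ker \<union> S)" by (auto intro: idl.span_base)
  then show "Idl (\<phi> ` S) \<subseteq> \<phi> ` idl.span (ker \<union> S)"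
    by (intro genideal_minimal push_ideal) auto
  have I: "ideal (Idl (\<phi> ` S)) R" by (rule genideal_ideal) auto
  have "\<phi> ` S \<subseteq> Idl (\<phi> ` S)" by (rule genideal_self) auto
  then have "idl.span (ker \<union> S) \<subseteq> \<phi> -` (Idl (\<phi> ` S))"
    using pull_ideal[OF I] by (intro idl.span_minimal) auto
  then show "\<phi> ` idl.span (ker \<union> S) \<subseteq> Idl (\<phi> ` S)" by blast
qed

lemma mem_Idl_push: "\<phi> t \<in> Idl (\<phi> ` S) \<longleftrightarrow> t \<in> idl.span (ker \<union> S)"
  using pull_push[of "idl.span (ker \<union> S)"] unfolding Idl_push by (auto intro: idl.span_base)

lemma pull_prime:
  assumes "primeideal P R" shows "prime_ideal (\<phi> -` P)"
proof -
  interpret P: primeideal P R by fact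
  have "1 \<notin> \<phi> -` P" using P.one_imp_carrier P.I_notcarr by (auto simp: phi_one)
  moreover have "a \<in> \<phi> -` P \<or> b \<in> \<phi> -` P" if "a * b \<in> \<phi> -` P" for a b
    using that P.I_prime[of "\<phi> a" "\<phi> b"] by (auto simp: phi_mult)
  ultimately show ?thesis using pull_ideal(1)[OF P.ideal_axioms] by (auto simp: prime_ideal_def)
qed

lemma push_prime:
  assumes Q: "prime_ideal Q" "ker \<subseteq> Q" shows "primeideal (\<phi> ` Q) R"
proof -
  note pp = pull_push[OF prime_idealD(1)[OF Q(1)] Q(2)]
  have mem: "\<phi> a \<in> \<phi> ` Q \<longleftrightarrow> a \<in> Q" for a using pp by blast
  show ?thesis
  proof (rule primeidealI[OF push_ideal[OF prime_idealD(1)[OF Q(1)]]])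
    show "cring R" by (rule cring_axioms)
    show "carrier R \<noteq> \<phi> ` Q"
    proof
      assume *: "carrier R = \<phi> ` Q"
      have "\<phi> 1 \<in> \<phi> ` Q" unfolding *[symmetric] by simp
      then show False using prime_idealD(2)[OF Q(1)] by (simp only: mem)
    qed
    fix x y assume xy: "x \<in> carrier R" "y \<in> carrier R" "x \<otimes> y \<in> \<phi> ` Q"
    obtain a where a: "x = \<phi> a" using xy(1) phi_surj by blast
    obtain b where b: "y = \<phi> b" using xy(2) phi_surj by blast
    have "a * b \<in> Q" using xy(3) by (simp only: a b phi_mult[symmetric] mem)
    then show "x \<in> \<phi> ` Q \<or> y \<in> \<phi> ` Q" using prime_idealD(3)[OF Q(1)] by (auto simp: a b)
  qed
qed

lemma pull_maximal:
  assumes "maximalideal P R" "a \<notin> \<phi> -` P"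
  shows "\<exists>b. 1 - a * b \<in> \<phi> -` P"
proof -
  interpret P: maximalideal P R by fact
  note pull = pull_ideal[OF P.ideal_axioms]
  define Q where "Q = idl.span (insert a (\<phi> -` P))"
  have PQ: "\<phi> -` P \<subseteq> Q" and aQ: "a \<in> Q" by (auto simp: Q_def intro: idl.span_base)
  have Qs: "idl.subspace Q" by (simp add: Q_def)
  have mem: "\<phi> t \<in> \<phi> ` Q \<longleftrightarrow> t \<in> Q" for t
    using pull_push[OF Qs] pull(2) PQ by blast
  have "P \<subseteq> \<phi> ` Q" using push_pull[OF P.a_subset] PQ by blast
  then have "\<phi> ` Q = P \<or> \<phi> ` Q = carrier R"
    by (intro P.I_maximal push_ideal Qs) auto
  moreover have "\<phi> ` Q \<noteq> P" using aQ assms(2) by blast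
  ultimately have "\<phi> ` Q = carrier R" by blast
  then have "1 \<in> Q" using mem[of 1] by simp
  then obtain k where "1 - k * a \<in> idl.span (\<phi> -` P)" by (auto simp: Q_def idl.span_breakdown_eq)
  moreover have "idl.span (\<phi> -` P) = \<phi> -` P" using pull(1) by (simp only: idl.span_eq_iff)
  ultimately have "1 - a * k \<in> \<phi> -` P" by (simp only: mult.commute)
  then show ?thesis by blast
qed

lemma push_maximal:
  assumes M: "prime_ideal M" "ker \<subseteq> M" and max: "\<And>a. a \<notin> M \<Longrightarrow> \<exists>b. 1 - a * b \<in> M"
  shows "maximalideal (\<phi> ` M) R"
proof (rule maximalidealI)
  interpret M: primeideal "\<phi> ` M" R by (rule push_prime[OF M])
  show "ideal (\<phi> ` M) R" by (rule M.ideal_axioms)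
  show "carrier R \<noteq> \<phi> ` M" by (rule M.I_notcarr)
  fix J assume J: "ideal J R" "\<phi> ` M \<subseteq> J" "J \<subseteq> carrier R"
  note pull = pull_ideal[OF J(1)]
  show "J = \<phi> ` M \<or> J = carrier R"
  proof (cases "\<phi> -` J \<subseteq> M")
    case True
    then have "J \<subseteq> \<phi> ` M" using push_pull[OF J(3)] by blast
    then show ?thesis using J(2) by blast
  next
    case False
    then obtain a b where a: "a \<in> \<phi> -` J" "1 - a * b \<in> M" using max by blast
    have "1 - a * b \<in> \<phi> -` J" using a(2) J(2) by blast
    then have "(1 - a * b) + a * b \<in> \<phi> -` J"
      using idl_mult(2)[OF pull(1) a(1)] by (rule idl.subspace_add[OF pull(1)])
    then have "t \<in> \<phi> -` J" for t using idl_mult(1)[OF pull(1), of 1 t] by simp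
    then have "carrier R \<subseteq> J" unfolding phi_surj[symmetric] by blast
    then show ?thesis using J(3) by blast
  qed
qed

lemma regular_sequence_push: "regular_sequence R (map \<phi> ts) \<longleftrightarrow> regular_mod ker ts"
proof -
  have tk: "set (take k (map \<phi> ts)) = \<phi> ` set (take k ts)" for k by (simp add: take_map)
  have "(\<forall>r\<in>carrier R. r \<otimes> (map \<phi> ts ! k) \<in> Idl (set (take k (map \<phi> ts))) \<longrightarrow> r \<in> Idl (set (take k (map \<phi> ts))))
      \<longleftrightarrow> (\<forall>s. s * ts ! k \<in> idl.span (ker \<union> set (take k ts)) \<longrightarrow> s \<in> idl.span (ker \<union> set (take k ts)))"
    if "k < length ts" for k
    unfolding tk phi_surj[symmetric] using that
    by (simp add: phi_mult[symmetric] mem_Idl_push)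
  moreover have "Idl (set (map \<phi> ts)) \<noteq> carrier R \<longleftrightarrow> idl.span (ker \<union> set ts) \<noteq> UNIV"
  proof -
    have "Idl (\<phi> ` set ts) = carrier R \<longleftrightarrow> idl.span (ker \<union> set ts) = UNIV"
    proof
      assume "Idl (\<phi> ` set ts) = carrier R"
      then have "\<phi> t \<in> Idl (\<phi> ` set ts)" for t by simp
      then show "idl.span (ker \<union> set ts) = UNIV" unfolding mem_Idl_push by blast
    next
      assume "idl.span (ker \<union> set ts) = UNIV"
      then show "Idl (\<phi> ` set ts) = carrier R" by (simp add: Idl_push phi_surj)
    qed
    then show ?thesis by simp
  qed
  ultimately show ?thesis unfolding regular_sequence_def regular_mod_def by auto
qed

lemma noetherian_push: "noeth_mod ker \<Longrightarrow> noetherian_ring R"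
proof (rule noetherian_ringI)
  assume noeth: "noeth_mod ker"
  fix I assume I: "ideal I R"
  have sub: "I \<subseteq> carrier R" using additive_subgroup.a_subset[OF ideal.axioms(1)[OF I]] .
  obtain F where F: "finite F" "\<phi> -` I = idl.span (ker \<union> F)"
    using noeth pull_ideal[OF I] unfolding noeth_mod_def by blast
  have "I = Idl (\<phi> ` F)" using push_pull[OF sub] unfolding Idl_push F(2)[symmetric] by simp
  then show "\<exists>A\<subseteq>carrier R. finite A \<and> I = Idl A" using F(1) by (intro exI[of _ "\<phi> ` F"]) auto
qed

lemma depth_ge:
  assumes "regular_mod ker ts" "set ts \<subseteq> \<phi> -` P"
  shows "enat (length ts) \<le> ideal_depth R P"
proof -
  have "map \<phi> ts \<in> {xs. regular_sequence R xs \<and> set xs \<subseteq> P}"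
    using assms regular_sequence_push by auto
  then show ?thesis unfolding ideal_depth_def by (intro SUP_upper2[of "map \<phi> ts"]) auto
qed

lemma depth_le:
  assumes "\<And>ts. regular_mod ker ts \<Longrightarrow> set ts \<subseteq> \<phi> -` P \<Longrightarrow> enat (length ts) \<le> d"
  shows "ideal_depth R P \<le> d"
  unfolding ideal_depth_def
proof (rule SUP_least)
  fix xs assume xs: "xs \<in> {xs. regular_sequence R xs \<and> set xs \<subseteq> P}"
  then have "set xs \<subseteq> range \<phi>" by (auto simp: regular_sequence_def phi_surj)
  then obtain ts where ts: "xs = map \<phi> ts" by (metis ex_map_conv image_iff subsetD)
  show "enat (length xs) \<le> d"
    using assms[of ts] xs regular_sequence_push[of ts] by (auto simp: ts)
qed

lemma height_ge:
  assumes P: "P \<subseteq> carrier R" and p: "\<And>i. i \<le> k \<Longrightarrow> prime_ideal (p i) \<and> ker \<subseteq> p i" 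
    "\<And>i. i < k \<Longrightarrow> p i \<subset> p (Suc i)" "p k = \<phi> -` P"
  shows "enat k \<le> ideal_height R P"
proof -
  have pp: "\<phi> -` (\<phi> ` p i) = p i" if "i \<le> k" for i
    using p(1)[OF that] by (intro pull_push) (auto dest: prime_idealD(1))
  have str: "\<phi> ` p i \<subset> \<phi> ` p (Suc i)" if i: "i < k" for i
  proof
    show "\<phi> ` p i \<subseteq> \<phi> ` p (Suc i)" using p(2)[OF i] by (intro image_mono) auto
    have "i \<le> k" "Suc i \<le> k" using i by auto
    then have "\<phi> ` p i = \<phi> ` p (Suc i) \<Longrightarrow> p i = p (Suc i)" using pp[of i] pp[of "Suc i"] by metis
    then show "\<phi> ` p i \<noteq> \<phi> ` p (Suc i)" using p(2)[OF i] by blast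
  qed
  have pr: "primeideal (\<phi> ` p i) R" if "i \<le> k" for i
    using p(1)[OF that] by (intro push_prime) auto
  have "\<phi> ` p k = P" unfolding p(3) by (rule push_pull[OF P])
  then have "(k, \<lambda>i. \<phi> ` p i) \<in> {(k, p). (\<forall>i\<le>k. primeideal (p i) R) \<and> (\<forall>i<k. p i \<subset> p (Suc i)) \<and> p k = P}"
    using str pr by simp
  then show ?thesis unfolding ideal_height_def by (rule SUP_upper2) simp
qed

lemma height_le:
  assumes "\<And>k p. (\<And>i. i \<le> k \<Longrightarrow> prime_ideal (p i) \<and> ker \<subseteq> p i) \<Longrightarrow>
     (\<And>i. i < k \<Longrightarrow> p i \<subset> p (Suc i)) \<Longrightarrow> p k = \<phi> -` P \<Longrightarrow> enat k \<le> d"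
  shows "ideal_height R P \<le> d"
  unfolding ideal_height_def
proof (rule SUP_least, clarify)
  fix k :: nat and p
  assume p: "\<forall>i\<le>k. primeideal (p i) R" "\<forall>i<k. p i \<subset> p (Suc i)" "P = p k"
  have sub: "p i \<subseteq> carrier R" if "i \<le> k" for i
    using p(1) that by (meson additive_subgroup.a_subset ideal.axioms(1) primeideal.axioms(1))
  show "enat k \<le> d"
  proof (rule assms[of k "\<lambda>i. \<phi> -` p i"])
    show "prime_ideal (\<phi> -` p i) \<and> ker \<subseteq> \<phi> -` p i" if "i \<le> k" for i
    proof -
      have "primeideal (p i) R" using p(1) that by blast
      then show ?thesis using pull_prime pull_ideal(2)[OF primeideal.axioms(1)] by blast
    qed
    show "\<phi> -` p i \<subset> \<phi> -` p (Suc i)" if "i < k" for i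
    proof -
      have "p i \<subset> p (Suc i)" using p(2) that by blast
      moreover have "\<phi> ` (\<phi> -` p (Suc i)) = p (Suc i)" using that by (intro push_pull sub) simp
      moreover have "\<phi> ` (\<phi> -` p i) = p i" using that by (intro push_pull sub) simp
      ultimately have "\<phi> -` p i \<noteq> \<phi> -` p (Suc i)" by (metis order_less_irrefl)
      then show ?thesis using \<open>p i \<subset> p (Suc i)\<close> by (intro psubsetI vimage_mono) auto
    qed
  qed (simp add: p(3))
qed

end

section \<open>Dimension of polynomial rings\<close>

text \<open>
  Selecting the members with the largest exponent at one variable after the other leaves a single
  monomial in each set, and their sum cannot arise in any other way.
\<close>
lemma unique_sum:
  fixes F G :: "('v \<Rightarrow>\<^sub>0 nat) set"
  assumes "finite W" "finite F" "finite G" "F \<noteq> {}" "G \<noteq> {}"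
    and "\<And>a b v. a \<in> F \<Longrightarrow> b \<in> F \<Longrightarrow> v \<notin> W \<Longrightarrow> lookup a v = lookup b v"
    and "\<And>a b v. a \<in> G \<Longrightarrow> b \<in> G \<Longrightarrow> v \<notin> W \<Longrightarrow> lookup a v = lookup b v"
  shows "\<exists>m\<in>F. \<exists>n\<in>G. \<forall>a\<in>F. \<forall>b\<in>G. a + b = m + n \<longrightarrow> a = m \<and> b = n"
  using assms
proof (induction W arbitrary: F G rule: finite_induct)
  case empty
  obtain m n where "m \<in> F" "n \<in> G" using empty by blast
  moreover have "a = m" if "a \<in> F" for a
    using that \<open>m \<in> F\<close> by (intro poly_mapping_eqI empty(5)) simp_all
  moreover have "b = n" if "b \<in> G" for b
    using that \<open>n \<in> G\<close> by (intro poly_mapping_eqI empty(6)) simp_all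
  ultimately show ?case by blast
next
  case (insert v W)
  define top where "top = (\<lambda>F :: ('v \<Rightarrow>\<^sub>0 nat) set. Max ((\<lambda>a. lookup a v) ` F))"
  define sel where "sel = (\<lambda>F. {a \<in> F. lookup a v = top F})"
  have le: "lookup a v \<le> top F" if "finite F" "a \<in> F" for a F
    using that by (auto simp: top_def)
  have ne: "sel F \<noteq> {}" if "finite F" "F \<noteq> {}" for F
  proof -
    have "top F \<in> (\<lambda>a. lookup a v) ` F" unfolding top_def using that by (intro Max_in) auto
    then show ?thesis by (auto simp: sel_def)
  qed
  have agree: "lookup a w = lookup b w"
    if "a \<in> sel H" "b \<in> sel H" "w \<notin> W"
      "\<And>a b w. a \<in> H \<Longrightarrow> b \<in> H \<Longrightarrow> w \<notin> insert v W \<Longrightarrow> lookup a w = lookup b w"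
    for a b w H
  proof (cases "w = v")
    case True
    then show ?thesis using that(1,2) by (simp add: sel_def)
  next
    case False
    then show ?thesis using that(1-3) by (intro that(4)) (auto simp: sel_def)
  qed
  have "\<exists>m\<in>sel F. \<exists>n\<in>sel G. \<forall>a\<in>sel F. \<forall>b\<in>sel G. a + b = m + n \<longrightarrow> a = m \<and> b = n"
  proof (rule insert.IH)
    show "finite (sel F)" "finite (sel G)" using insert.prems by (auto simp: sel_def)
    show "sel F \<noteq> {}" "sel G \<noteq> {}" using insert.prems ne by blast+
  next
    fix a b w assume "a \<in> sel F" "b \<in> sel F" "w \<notin> W"
    then show "lookup a w = lookup b w"
      using insert.prems(5) by (rule agree)
  next
    fix a b w assume "a \<in> sel G" "b \<in> sel G" "w \<notin> W"
    then show "lookup a w = lookup b w"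
      using insert.prems(6) by (rule agree)
  qed
  then obtain m n where mn: "m \<in> sel F" "n \<in> sel G"
    and uniq: "\<And>a b. a \<in> sel F \<Longrightarrow> b \<in> sel G \<Longrightarrow> a + b = m + n \<Longrightarrow> a = m \<and> b = n" by blast
  have "a = m \<and> b = n" if ab: "a \<in> F" "b \<in> G" "a + b = m + n" for a b
  proof -
    have "lookup a v + lookup b v = top F + top G"
      using arg_cong[OF ab(3), of "\<lambda>m. lookup m v"] mn by (simp add: lookup_add sel_def)
    then have "lookup a v = top F" "lookup b v = top G"
      using le[OF insert.prems(1) ab(1)] le[OF insert.prems(2) ab(2)] by auto
    then show ?thesis using ab by (intro uniq) (auto simp: sel_def)
  qed
  then show ?case using mn by (intro bexI[of _ m] bexI[of _ n]) (auto simp: sel_def)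
qed

text \<open>
  The variables carry no order here, so a unique product of two monomials replaces the product of the
  leading monomials.
\<close>
lemma mpoly_no_zero_divisors:
  fixes p q :: "('v, 'k::field) mpoly"
  assumes "p \<noteq> 0" "q \<noteq> 0" shows "p * q \<noteq> 0"
proof -
  define W where "W = \<Union> (keys ` (keys p \<union> keys q))"
  have *: "lookup a v = 0" if "a \<in> keys p \<union> keys q" "v \<notin> W" for a v
    using that by (auto simp: W_def in_keys_iff)
  have "\<exists>m\<in>keys p. \<exists>n\<in>keys q. \<forall>a\<in>keys p. \<forall>b\<in>keys q.
      a + b = m + n \<longrightarrow> a = m \<and> b = n"
  proof (rule unique_sum)
    show "finite W" by (auto simp: W_def)
    show "keys p \<noteq> {}" "keys q \<noteq> {}" using assms by auto
  qed (simp_all add: *)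
  then obtain m n where mn: "m \<in> keys p" "n \<in> keys q"
    and uniq: "\<And>a b. a \<in> keys p \<Longrightarrow> b \<in> keys q \<Longrightarrow> a + b = m + n \<Longrightarrow> a = m \<and> b = n"
    by blast
  have summand: "lookup p l * (\<Sum>r. lookup q r when m + n = l + r) =
      (lookup p m * lookup q n when l = m)" for l
  proof (cases "l \<in> keys p")
    case True
    have "(lookup q r when m + n = l + r) = (lookup q r when (l = m \<and> r = n))" for r
      using uniq[OF True, of r]
      by (cases "lookup q r = 0") (auto simp: when_def in_keys_iff)
    then have "(\<Sum>r. lookup q r when m + n = l + r) =
        (\<Sum>r. (lookup q r when l = m) when r = n)"
      by (simp add: when_when conj_commute)
    also have "\<dots> = (lookup q n when l = m)" by simp
    finally show ?thesis by (auto simp: when_def)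
  next
    case False
    then show ?thesis using mn(1) by (auto simp: in_keys_iff when_def)
  qed
  have "lookup (p * q) (m + n) = lookup p m * lookup q n"
    unfolding lookup_mult summand by simp
  then have "lookup (p * q) (m + n) \<noteq> 0" using mn by (simp add: in_keys_iff)
  then show ?thesis by auto
qed

text \<open>
  The prime generated by the variables outside \<open>W\<close>, as a kernel.
\<close>
definition var_prime :: "'v set \<Rightarrow> ('v, 'k::field) mpoly set" where
  "var_prime W = {p. restrict_vars W p = 0}"

lemma prime_var_prime: "prime_ideal (var_prime W)"
  unfolding prime_ideal_def
proof (intro conjI allI impI)
  show "idl.subspace (var_prime W)"
    by (rule idl.subspaceI) (simp_all add: var_prime_def restrict_vars_add restrict_vars_mult)
  show "1 \<notin> var_prime W" by (simp add: var_prime_def)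
  show "a \<in> var_prime W \<or> b \<in> var_prime W" if "a * b \<in> var_prime W" for a b
    using that mpoly_no_zero_divisors by (auto simp: var_prime_def restrict_vars_mult)
qed

lemma mpoly_var_nonzero: "mpoly_var v \<noteq> 0"
  by (simp add: mpoly_var_def flip: keys_eq_empty)

lemma var_in_var_prime [simp]: "mpoly_var v \<in> var_prime W \<longleftrightarrow> v \<notin> W"
  by (cases "v \<in> W") (auto simp: var_prime_def mpoly_var_nonzero)

lemma restrict_restrict: "restrict_vars W (restrict_vars U p) = restrict_vars (W \<inter> U) p"
  by (rule poly_mapping_eqI) (auto simp: lookup_restrict_vars)

lemma var_prime_antimono:
  assumes "W \<subseteq> U" shows "var_prime U \<subseteq> (var_prime W :: ('v, 'k::field) mpoly set)"
proof
  fix x :: "('v, 'k) mpoly" assume "x \<in> var_prime U"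
  then show "x \<in> var_prime W"
    using restrict_restrict[of W U x] assms by (simp add: var_prime_def Int_absorb2)
qed

interpretation mpoly_vs: Vector_Spaces.vector_space "\<lambda>c p. cst c * p :: ('v, 'k::field) mpoly"
  by unfold_locales (simp_all add: cst_hom algebra_simps)

declare mpoly_vs.scale_scale [simp del]

text \<open>
  Modulo \<open>Q\<close> all \<open>y i\<close> are polynomials in the variables from \<open>S\<close>, of degree at most \<open>D\<close> in each of them. The
  \<open>N ^ h\<close> products of powers with exponents below \<open>N\<close> lie in a space of dimension at most
  \<open>(h * N * D + 1) ^ card S\<close>, which is smaller for large \<open>N\<close> because \<open>card S < h\<close>.
\<close>
lemma algebraically_dependent_mod:
  fixes Q :: "('v, 'k::field) mpoly set"
  assumes S: "finite S" "card S < h" and Q: "idl.subspace Q" "\<And>v. v \<notin> S \<Longrightarrow> mpoly_var v \<in> Q"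
  shows "\<exists>E c. finite E \<and> inj_on (\<lambda>\<alpha>. restrict \<alpha> {..<h}) E \<and> E \<noteq> {} \<and> (\<forall>\<alpha>\<in>E. c \<alpha> \<noteq> 0) \<and>
     (\<Sum>\<alpha>\<in>E. cst (c \<alpha>) * (\<Prod>i<h. y i ^ \<alpha> i)) \<in> Q"
proof -
  define z where "z = (\<lambda>i. restrict_vars S (y i))"
  define Bd where "Bd = (\<lambda>n. {p :: ('v, 'k) mpoly. \<forall>m\<in>keys p.
      keys m \<subseteq> S \<and> (\<forall>v. lookup m v \<le> n)})"
  have BdE: "keys m \<subseteq> S" "lookup m v \<le> n"
    if "p \<in> Bd n" "m \<in> keys p" for p m n v
    using that by (auto simp: Bd_def)
  have Bd1: "1 \<in> Bd n" for n by (auto simp: Bd_def)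
  have Bd_mult: "p * q \<in> Bd (a + b)" if "p \<in> Bd a" "q \<in> Bd b" for p q a b
    unfolding Bd_def
  proof (rule CollectI, rule ballI)
    fix m assume "m \<in> keys (p * q)"
    then obtain k l where "m = k + l" "k \<in> keys p" "l \<in> keys q"
      using keys_mult[of p q] by blast
    then show "keys m \<subseteq> S \<and> (\<forall>v. lookup m v \<le> a + b)"
      using BdE[OF that(1)] BdE[OF that(2)] by (auto simp: keys_add_nat lookup_add intro!: add_mono)
  qed
  have Bd_mono: "p \<in> Bd b" if "p \<in> Bd a" "a \<le> b" for p a b
    unfolding Bd_def
  proof (intro CollectI ballI conjI allI)
    fix m v assume m: "m \<in> keys p"
    show "keys m \<subseteq> S" by (rule BdE(1)[OF that(1) m])
    show "lookup m v \<le> b" using BdE(2)[OF that(1) m] that(2) by (rule order_trans)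
  qed
  have Bd_pow: "p ^ n \<in> Bd (n * a)" if "p \<in> Bd a" for p a n
    by (induction n) (auto intro: Bd1 Bd_mult that)
  have Bd_prod: "prod f A \<in> Bd (card A * b)" if "finite A" "\<And>i. i \<in> A \<Longrightarrow> f i \<in> Bd b"
    for f :: "nat \<Rightarrow> ('v, 'k) mpoly" and A b
    using that by (induction A rule: finite_induct) (auto intro: Bd1 Bd_mult)
  have "\<exists>D. z i \<in> Bd D" for i
  proof -
    define D where "D = Max (insert 0 (\<Union>m\<in>keys (z i). lookup m ` keys m))"
    have "lookup m v \<le> D" if "m \<in> keys (z i)" for m v
    proof (cases "v \<in> keys m")
      case True
      then show ?thesis unfolding D_def using that by (intro Max_ge) auto
    qed (simp add: in_keys_iff)
    moreover have "keys m \<subseteq> S" if "m \<in> keys (z i)" for m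
      using that restrict_vars_in[of S "y i"] by (simp add: z_def mpolys_in_def)
    ultimately show ?thesis by (auto simp: Bd_def)
  qed
  then obtain D' where D': "\<And>i. z i \<in> Bd (D' i)" by metis
  define D where "D = Max (D' ` {..<h})"
  have zD: "z i \<in> Bd D" if "i < h" for i
    using D'[of i] by (rule Bd_mono) (use that in \<open>auto simp: D_def\<close>)
  \<comment> \<open>With this \<open>N\<close>, \<open>(h * N * D + 1) ^ card S \<le> N ^ card S * (h * D + 1) ^ card S < N ^ (card S + 1) \<le> N ^ h\<close>.\<close>
  define N where "N = (h * D + 1) ^ card S + 1"
  define A where "A = ({..<h} \<rightarrow>\<^sub>E {..<N})"
  define n where "n = h * (N * D)"
  have zA: "(\<Prod>i<h. z i ^ \<alpha> i) \<in> Bd n" if "\<alpha> \<in> A" for \<alpha>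
  proof -
    have "z i ^ \<alpha> i \<in> Bd (N * D)" if "i < h" for i
      using Bd_pow[OF zD[OF that], of "\<alpha> i"]
      by (rule Bd_mono) (use that \<open>\<alpha> \<in> A\<close> in \<open>auto simp: A_def PiE_iff intro!: mult_right_mono less_imp_le\<close>)
    then show ?thesis using Bd_prod[of "{..<h}" "\<lambda>i. z i ^ \<alpha> i" "N * D"] by (simp add: n_def)
  qed
  define Mon where "Mon = {m :: 'v \<Rightarrow>\<^sub>0 nat. keys m \<subseteq> S \<and> (\<forall>v. lookup m v \<le> n)}"
  have inj: "inj_on (\<lambda>m. restrict (lookup m) S) Mon"
  proof (rule inj_onI)
    fix a b assume ab: "a \<in> Mon" "b \<in> Mon" "restrict (lookup a) S = restrict (lookup b) S"
    show "a = b"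
    proof (rule poly_mapping_eqI)
      fix v
      show "lookup a v = lookup b v"
      proof (cases "v \<in> S")
        case True
        then show ?thesis using fun_cong[OF ab(3), of v] by simp
      next
        case False
        then have "v \<notin> keys a" "v \<notin> keys b" using ab by (auto simp: Mon_def)
        then show ?thesis by (simp add: in_keys_iff)
      qed
    qed
  qed
  have sub: "(\<lambda>m. restrict (lookup m) S) ` Mon \<subseteq> (S \<rightarrow>\<^sub>E {..n})" by (auto simp: Mon_def)
  have finPi: "finite (S \<rightarrow>\<^sub>E {..n})" using S(1) by (intro finite_PiE) auto
  have finMon: "finite Mon" using finite_imageD[OF finite_subset[OF sub finPi] inj] .
  have "card Mon \<le> card (S \<rightarrow>\<^sub>E {..n})" by (rule card_inj_on_le[OF inj sub finPi])
  also have "\<dots> = (n + 1) ^ card S" using S(1) by (simp add: card_PiE)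
  also have "\<dots> \<le> (N * (h * D + 1)) ^ card S"
    by (intro power_mono) (auto simp: n_def N_def algebra_simps)
  also have "\<dots> = N ^ card S * (h * D + 1) ^ card S" by (rule power_mult_distrib)
  also have "\<dots> < N ^ card S * N" by (simp add: N_def)
  also have "\<dots> \<le> N ^ h"
    unfolding power_Suc2[symmetric] using S(2) by (intro power_increasing) (auto simp: N_def)
  also have "\<dots> = card A" by (simp add: A_def card_PiE)
  finally have card: "card Mon < card A" .
  have finA: "finite A" unfolding A_def by (intro finite_PiE) auto
  define g where "g = (\<lambda>\<alpha>::nat \<Rightarrow> nat. \<Prod>i<h. z i ^ \<alpha> i)"
  define Xs where "Xs = (\<lambda>m. single m (1::'k)) ` Mon"
  have span: "g ` A \<subseteq> mpoly_vs.span Xs"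
  proof
    fix p assume "p \<in> g ` A"
    then have "p \<in> Bd n" using zA by (auto simp: g_def)
    have "single m (lookup p m) \<in> mpoly_vs.span Xs" if "m \<in> keys p" for m
    proof -
      have "single m 1 \<in> Xs" using BdE[OF \<open>p \<in> Bd n\<close> that] by (auto simp: Xs_def Mon_def)
      then have "cst (lookup p m) * single m 1 \<in> mpoly_vs.span Xs"
        by (intro mpoly_vs.span_scale mpoly_vs.span_base)
      then show ?thesis by (simp add: cst_def mult_single)
    qed
    then show "p \<in> mpoly_vs.span Xs" by (subst mpoly_expand) (intro mpoly_vs.span_sum)
  qed
  have finXs: "finite Xs" "card Xs \<le> card Mon" using finMon by (auto simp: Xs_def intro: card_image_le)
  have "\<exists>c. (\<exists>\<alpha>\<in>A. c \<alpha> \<noteq> 0) \<and> (\<Sum>\<alpha>\<in>A. cst (c \<alpha>) * g \<alpha>) = 0"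
  proof (cases "inj_on g A")
    case True
    have "\<not> mpoly_vs.independent (g ` A)"
      using mpoly_vs.independent_span_bound[OF finXs(1) _ span] finXs(2) card card_image[OF True] by auto
    then obtain t u v where t: "finite t" "t \<subseteq> g ` A" "(\<Sum>v\<in>t. cst (u v) * v) = 0" "v \<in> t" "u v \<noteq> 0"
      unfolding mpoly_vs.dependent_explicit by blast
    define c where "c = (\<lambda>\<alpha>. if g \<alpha> \<in> t then u (g \<alpha>) else 0)"
    have "(\<Sum>\<alpha>\<in>A. cst (c \<alpha>) * g \<alpha>) = (\<Sum>v\<in>g ` A. cst (if v \<in> t then u v else 0) * v)"
      unfolding sum.reindex[OF True] by (simp add: c_def)
    also have "\<dots> = (\<Sum>v\<in>t. cst (u v) * v)"
      using t(2) finA by (intro sum.mono_neutral_cong_right) (auto simp: cst_hom)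
    finally have "(\<Sum>\<alpha>\<in>A. cst (c \<alpha>) * g \<alpha>) = 0" using t(3) by simp
    moreover have "\<exists>\<alpha>\<in>A. c \<alpha> \<noteq> 0" using t(2,4,5) by (auto simp: c_def)
    ultimately show ?thesis by blast
  next
    case False
    then obtain \<alpha> \<beta> where ab: "\<alpha> \<in> A" "\<beta> \<in> A" "\<alpha> \<noteq> \<beta>" "g \<alpha> = g \<beta>" by (auto simp: inj_on_def)
    define c :: "(nat \<Rightarrow> nat) \<Rightarrow> 'k" where "c = (\<lambda>\<gamma>. if \<gamma> = \<alpha> then 1 else if \<gamma> = \<beta> then - 1 else 0)"
    have "(\<Sum>\<gamma>\<in>A. cst (c \<gamma>) * g \<gamma>) = (\<Sum>\<gamma>\<in>{\<alpha>, \<beta>}. cst (c \<gamma>) * g \<gamma>)"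
      using ab finA by (intro sum.mono_neutral_right) (auto simp: c_def cst_hom)
    also have "\<dots> = 0" using ab by (simp add: c_def cst_hom)
    finally show ?thesis using ab(1) by (intro exI[of _ c]) (auto simp: c_def)
  qed
  then obtain c where c: "\<exists>\<alpha>\<in>A. c \<alpha> \<noteq> 0" "(\<Sum>\<alpha>\<in>A. cst (c \<alpha>) * g \<alpha>) = 0" by blast
  define E where "E = {\<alpha>\<in>A. c \<alpha> \<noteq> 0}"
  define Y where "Y = (\<Sum>\<alpha>\<in>E. cst (c \<alpha>) * (\<Prod>i<h. y i ^ \<alpha> i))"
  have "restrict_vars S Y = (\<Sum>\<alpha>\<in>E. cst (c \<alpha>) * g \<alpha>)"
    by (simp add: Y_def g_def z_def restrict_vars_sum restrict_vars_mult restrict_vars_prod restrict_vars_power)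
  also have "\<dots> = (\<Sum>\<alpha>\<in>A. cst (c \<alpha>) * g \<alpha>)"
    using finA by (intro sum.mono_neutral_left) (auto simp: E_def cst_hom)
  finally have "restrict_vars S Y = 0" using c(2) by simp
  then have "Y \<in> Q" using minus_restrict_vars_in_ideal[OF Q(1), of S Y] Q(2) by simp
  moreover have "inj_on (\<lambda>\<alpha>. restrict \<alpha> {..<h}) E"
  proof (rule inj_onI)
    fix \<alpha> \<beta> assume *: "\<alpha> \<in> E" "\<beta> \<in> E" "restrict \<alpha> {..<h} = restrict \<beta> {..<h}"
    have "restrict \<gamma> {..<h} = \<gamma>" if "\<gamma> \<in> E" for \<gamma>
      using that unfolding E_def A_def by (intro PiE_restrict) blast
    then show "\<alpha> = \<beta>" using * by metis
  qed
  moreover obtain \<alpha> where "\<alpha> \<in> A" "c \<alpha> \<noteq> 0" using c(1) by blast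
  then have "\<alpha> \<in> E" unfolding E_def by blast
  then have "E \<noteq> {}" by blast
  moreover have "finite E" unfolding E_def using finA by (rule finite_subset[rotated]) blast
  moreover have "\<forall>\<alpha>\<in>E. c \<alpha> \<noteq> 0" unfolding E_def by blast
  ultimately show ?thesis unfolding Y_def by blast
qed

text \<open>
  The common source of the bounds for heights and for depths.
\<close>
lemma ideal_chain_length:
  fixes Q :: "nat \<Rightarrow> ('v, 'k::field) mpoly set"
  assumes Q: "\<And>k. k \<le> h \<Longrightarrow> idl.subspace (Q k)" "\<And>k. k < h \<Longrightarrow> Q k \<subseteq> Q (Suc k)"
    and y: "\<And>k. k < h \<Longrightarrow> y k \<in> Q (Suc k)" "\<And>k r. k < h \<Longrightarrow> r * y k \<in> Q k \<Longrightarrow> r \<in> Q k"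
    and proper: "1 \<notin> Q h" and S: "finite S" "\<And>v. v \<notin> S \<Longrightarrow> mpoly_var v \<in> Q 0"
  shows "h \<le> card S"
proof (rule ccontr)
  assume "\<not> h \<le> card S"
  then have "card S < h" by simp
  from algebraically_dependent_mod[OF S(1) this Q(1)[of 0] S(2), of y] obtain E c where E: "finite E"
    "inj_on (\<lambda>\<alpha>. restrict \<alpha> {..<h}) E" "E \<noteq> {}" "\<forall>\<alpha>\<in>E. c \<alpha> \<noteq> 0"
    "(\<Sum>\<alpha>\<in>E. cst (c \<alpha>) * (\<Prod>i<h. y i ^ \<alpha> i)) \<in> Q 0" by auto
  have "cst c \<notin> Q h" if "c \<noteq> 0" for c
  proof
    assume "cst c \<in> Q h"
    then have "cst (inverse c) * cst c \<in> Q h" using Q(1)[of h] by (intro idl_mult) auto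
    then show False using proper cst_unit[OF that] by metis
  qed
  then have "E = {}" using E by (intro ideal_chain_independent[of h Q y cst E c, OF Q y]) auto
  then show False using E(3) by blast
qed

section \<open>Stanley--Reisner rings and unmixedness\<close>

lemma mpoly_ring_simps [simp]:
  "carrier (mpoly_ring V) = mpolys_in V" "x \<otimes>\<^bsub>mpoly_ring V\<^esub> y = x * y" "x \<oplus>\<^bsub>mpoly_ring V\<^esub> y = x + y"
  "\<one>\<^bsub>mpoly_ring V\<^esub> = 1" "\<zero>\<^bsub>mpoly_ring V\<^esub> = 0"
  by (simp_all add: mpoly_ring_def ring_of_type_algebra_def mpolys_in_def)

lemma cring_mpoly_ring: "cring (mpoly_ring V :: ('v, 'k::field) mpoly ring)"
proof (rule cringI)
  note As = subring_setD[OF mpolys_in_subring[of V]]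
  show "abelian_group (mpoly_ring V :: ('v, 'k) mpoly ring)"
  proof (rule abelian_groupI)
    fix x :: "('v, 'k) mpoly" assume "x \<in> carrier (mpoly_ring V)"
    then have "- x \<in> mpolys_in V" using As(5) by simp
    then show "\<exists>y\<in>carrier (mpoly_ring V). y \<oplus>\<^bsub>mpoly_ring V\<^esub> x = \<zero>\<^bsub>mpoly_ring V\<^esub>"
      by (intro bexI[of _ "- x"]) simp_all
  qed (simp_all add: As add_ac)
  show "Group.comm_monoid (mpoly_ring V :: ('v, 'k) mpoly ring)"
    by (rule comm_monoidI) (simp_all add: As mult_ac)
qed (simp add: distrib_right)

text \<open>
  The edge ideal enlarged by the variables that are not vertices: the kernel of the projection from the
  polynomial ring over the whole vertex type to the Stanley--Reisner ring.
\<close>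
definition sr_ideal :: "'v sgraph \<Rightarrow> ('v, 'k::field) mpoly set" where
  "sr_ideal G = idl.span ({mpoly_var i * mpoly_var j | i j. {i, j} \<in> edges G} \<union>
     {mpoly_var v | v. v \<notin> vertices G})"

definition sr_map :: "'v sgraph \<Rightarrow> ('v, 'k::field) mpoly \<Rightarrow> ('v, 'k) mpoly set" where
  "sr_map G t = edge_ideal G +>\<^bsub>mpoly_ring (vertices G)\<^esub> restrict_vars (vertices G) t"

lemma sr_ideal_subspace [simp]: "idl.subspace (sr_ideal G)"
  by (simp add: sr_ideal_def)

lemma sr_ideal_edge: "{i, j} \<in> edges G \<Longrightarrow> mpoly_var i * mpoly_var j \<in> sr_ideal G"
  unfolding sr_ideal_def by (rule idl.span_base) auto

lemma sr_ideal_var: "v \<notin> vertices G \<Longrightarrow> mpoly_var v \<in> sr_ideal G"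
  unfolding sr_ideal_def by (rule idl.span_base) auto

lemma sr_ideal_minimal:
  assumes "idl.subspace I" "\<And>i j. {i, j} \<in> edges G \<Longrightarrow> mpoly_var i * mpoly_var j \<in> I"
    "\<And>v. v \<notin> vertices G \<Longrightarrow> mpoly_var v \<in> I"
  shows "sr_ideal G \<subseteq> I"
  unfolding sr_ideal_def using assms by (intro idl.span_minimal) auto

lemma edge_ideal_is_ideal:
  assumes "finite_simple_graph G"
  shows "ideal (edge_ideal G :: ('v, 'k::field) mpoly set) (mpoly_ring (vertices G))"
    "{i, j} \<in> edges G \<Longrightarrow> mpoly_var i * mpoly_var j \<in> (edge_ideal G :: ('v, 'k) mpoly set)"
proof -
  interpret cring "mpoly_ring (vertices G) :: ('v, 'k) mpoly ring" by (rule cring_mpoly_ring)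
  have "i \<in> vertices G" "j \<in> vertices G" if "{i, j} \<in> edges G" for i j
    using assms that by (auto simp: finite_simple_graph_def)
  then have sub: "{mpoly_var i * mpoly_var j | i j. {i, j} \<in> edges G} \<subseteq> carrier (mpoly_ring (vertices G) :: ('v, 'k) mpoly ring)"
    by (auto intro!: subring_setD(4)[OF mpolys_in_subring] var_in_mpolys)
  show "ideal (edge_ideal G :: ('v, 'k) mpoly set) (mpoly_ring (vertices G))"
    unfolding edge_ideal_def by (rule genideal_ideal[OF sub])
  show "mpoly_var i * mpoly_var j \<in> (edge_ideal G :: ('v, 'k) mpoly set)" if "{i, j} \<in> edges G"
    unfolding edge_ideal_def using genideal_self[OF sub] that by blast
qed

lemma restrict_mem_edge_ideal:
  fixes t :: "('v, 'k::field) mpoly"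
  assumes G: "finite_simple_graph G"
  shows "restrict_vars (vertices G) t \<in> edge_ideal G \<longleftrightarrow> t \<in> sr_ideal G"
proof
  interpret cring "mpoly_ring (vertices G) :: ('v, 'k) mpoly ring" by (rule cring_mpoly_ring)
  interpret I: ideal "edge_ideal G :: ('v, 'k) mpoly set" "mpoly_ring (vertices G)"
    by (rule edge_ideal_is_ideal[OF G])
  have "t - restrict_vars (vertices G) t \<in> sr_ideal G"
    by (rule minus_restrict_vars_in_ideal) (auto intro: sr_ideal_var)
  moreover assume "restrict_vars (vertices G) t \<in> edge_ideal G"
  moreover have "edge_ideal G \<subseteq> (sr_ideal G \<inter> mpolys_in (vertices G) :: ('v, 'k) mpoly set)"
    unfolding edge_ideal_def
  proof (rule genideal_minimal)
    have "(mpoly_var i * mpoly_var j :: ('v, 'k) mpoly) \<in> sr_ideal G \<inter> mpolys_in (vertices G)"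
      if "{i, j} \<in> edges G" for i j
    proof -
      have "(mpoly_var i * mpoly_var j :: ('v, 'k) mpoly) \<in> edge_ideal G"
        by (rule edge_ideal_is_ideal(2)[OF G that])
      moreover have "(mpoly_var i * mpoly_var j :: ('v, 'k) mpoly) \<in> sr_ideal G"
        by (rule sr_ideal_edge[OF that])
      ultimately show ?thesis using I.a_subset by auto
    qed
    then show "{mpoly_var i * mpoly_var j | i j. {i, j} \<in> edges G} \<subseteq>
        (sr_ideal G \<inter> mpolys_in (vertices G) :: ('v, 'k) mpoly set)"
      by blast
    note As = subring_setD[OF mpolys_in_subring[of "vertices G"]]
    show "ideal (sr_ideal G \<inter> mpolys_in (vertices G) :: ('v, 'k) mpoly set) (mpoly_ring (vertices G))"
    proof (rule idealI)
      show "ring (mpoly_ring (vertices G) :: ('v, 'k) mpoly ring)" by (rule ring_axioms)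
      show "subgroup (sr_ideal G \<inter> mpolys_in (vertices G) :: ('v, 'k) mpoly set) (add_monoid (mpoly_ring (vertices G)))"
      proof (rule add.subgroupI)
        fix x :: "('v, 'k) mpoly" assume x: "x \<in> sr_ideal G \<inter> mpolys_in (vertices G)"
        have "\<ominus>\<^bsub>mpoly_ring (vertices G)\<^esub> x = - x"
          using x As(5)[of x] by (intro minus_equality) auto
        then show "\<ominus>\<^bsub>mpoly_ring (vertices G)\<^esub> x \<in> sr_ideal G \<inter> mpolys_in (vertices G)"
          using x As(5)[of x] by (auto intro: idl.subspace_neg)
      qed (auto intro: idl.subspace_add idl.subspace_0[OF sr_ideal_subspace] As(3) As(1))
    qed (auto intro: idl_mult As(4))
  qed
  ultimately have "(t - restrict_vars (vertices G) t) + restrict_vars (vertices G) t \<in> sr_ideal G"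
    by (intro idl.subspace_add[OF sr_ideal_subspace]) auto
  then show "t \<in> sr_ideal G" by simp
next
  interpret I: ideal "edge_ideal G :: ('v, 'k) mpoly set" "mpoly_ring (vertices G)"
    by (rule edge_ideal_is_ideal[OF G])
  have V: "i \<in> vertices G" "j \<in> vertices G" if "{i, j} \<in> edges G" for i j
    using G that by (auto simp: finite_simple_graph_def)
  have "sr_ideal G \<subseteq> {t :: ('v, 'k) mpoly. restrict_vars (vertices G) t \<in> edge_ideal G}"
  proof (rule sr_ideal_minimal)
    show "idl.subspace {t :: ('v, 'k) mpoly. restrict_vars (vertices G) t \<in> edge_ideal G}"
    proof (rule idl.subspaceI)
      show "0 \<in> {t :: ('v, 'k) mpoly. restrict_vars (vertices G) t \<in> edge_ideal G}"
        using additive_subgroup.zero_closed[OF I.additive_subgroup_axioms] by simp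
      fix x y c :: "('v, 'k) mpoly" assume x: "x \<in> {t. restrict_vars (vertices G) t \<in> edge_ideal G}"
      show "c * x \<in> {t. restrict_vars (vertices G) t \<in> edge_ideal G}"
        using I.I_l_closed[of "restrict_vars (vertices G) x" "restrict_vars (vertices G) c"] x
        by (simp add: restrict_vars_mult restrict_vars_in)
      assume y: "y \<in> {t. restrict_vars (vertices G) t \<in> edge_ideal G}"
      show "x + y \<in> {t. restrict_vars (vertices G) t \<in> edge_ideal G}"
        using additive_subgroup.a_closed[OF I.additive_subgroup_axioms, of "restrict_vars (vertices G) x" "restrict_vars (vertices G) y"] x y
        by (simp add: restrict_vars_add)
    qed
    show "mpoly_var i * mpoly_var j \<in> {t :: ('v, 'k) mpoly. restrict_vars (vertices G) t \<in> edge_ideal G}"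
      if "{i, j} \<in> edges G" for i j
      using edge_ideal_is_ideal(2)[OF G that] V[OF that] by (simp add: restrict_vars_mult)
    show "mpoly_var v \<in> {t :: ('v, 'k) mpoly. restrict_vars (vertices G) t \<in> edge_ideal G}"
      if "v \<notin> vertices G" for v
      using that additive_subgroup.zero_closed[OF I.additive_subgroup_axioms] by simp
  qed
  then show "t \<in> sr_ideal G \<Longrightarrow> restrict_vars (vertices G) t \<in> edge_ideal G" by blast
qed

lemma sr_presentation:
  assumes G: "finite_simple_graph G"
  shows "ring_presentation (stanley_reisner_ring G :: ('v, 'k::field) mpoly set ring) (sr_map G)"
    "ring_presentation.ker (stanley_reisner_ring G :: ('v, 'k) mpoly set ring) (sr_map G) = sr_ideal G"
proof -
  let ?A = "mpoly_ring (vertices G) :: ('v, 'k) mpoly ring"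
  let ?I = "edge_ideal G :: ('v, 'k) mpoly set"
  interpret A: cring ?A by (rule cring_mpoly_ring)
  interpret I: ideal ?I ?A by (rule edge_ideal_is_ideal[OF G])
  note hom = I.rcos_ring_hom
  have c: "restrict_vars (vertices G) t \<in> carrier ?A" for t by (simp add: restrict_vars_in)
  show pres: "ring_presentation (stanley_reisner_ring G :: ('v, 'k) mpoly set ring) (sr_map G)"
  proof (intro ring_presentation.intro ring_presentation_axioms.intro)
    show "cring (stanley_reisner_ring G :: ('v, 'k) mpoly set ring)"
      unfolding stanley_reisner_ring_def by (rule I.quotient_is_cring[OF cring_mpoly_ring])
    fix a b :: "('v, 'k) mpoly"
    show "sr_map G (a + b) = sr_map G a \<oplus>\<^bsub>stanley_reisner_ring G\<^esub> sr_map G b"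
      using ring_hom_add[OF hom c c, of a b]
      by (simp add: sr_map_def stanley_reisner_ring_def restrict_vars_add)
    show "sr_map G (a * b) = sr_map G a \<otimes>\<^bsub>stanley_reisner_ring G\<^esub> sr_map G b"
      using ring_hom_mult[OF hom c c, of a b]
      by (simp add: sr_map_def stanley_reisner_ring_def restrict_vars_mult)
    show "sr_map G (1 :: ('v, 'k) mpoly) = \<one>\<^bsub>stanley_reisner_ring G\<^esub>"
      using ring_hom_one[OF hom] by (simp add: sr_map_def stanley_reisner_ring_def)
    show "range (sr_map G) = carrier (stanley_reisner_ring G :: ('v, 'k) mpoly set ring)"
    proof
      show "range (sr_map G) \<subseteq> carrier (stanley_reisner_ring G :: ('v, 'k) mpoly set ring)"
        using ring_hom_closed[OF hom c] by (auto simp: sr_map_def stanley_reisner_ring_def)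
      show "carrier (stanley_reisner_ring G :: ('v, 'k) mpoly set ring) \<subseteq> range (sr_map G)"
      proof
        fix x assume "x \<in> carrier (stanley_reisner_ring G :: ('v, 'k) mpoly set ring)"
        then obtain t where t: "t \<in> mpolys_in (vertices G)" "x = ?I +>\<^bsub>?A\<^esub> t"
          by (auto simp: stanley_reisner_ring_def FactRing_def A_RCOSETS_def' )
        then have "x = sr_map G t" by (simp add: sr_map_def restrict_vars_id)
        then show "x \<in> range (sr_map G)" by blast
      qed
    qed
  qed
  have "sr_map G t = \<zero>\<^bsub>stanley_reisner_ring G\<^esub> \<longleftrightarrow> t \<in> sr_ideal G" for t :: "('v, 'k) mpoly"
  proof -
    have "sr_map G t = \<zero>\<^bsub>stanley_reisner_ring G\<^esub> \<longleftrightarrow> ?I +>\<^bsub>?A\<^esub> restrict_vars (vertices G) t = ?I"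
      by (simp add: sr_map_def stanley_reisner_ring_def FactRing_def)
    also have "\<dots> \<longleftrightarrow> restrict_vars (vertices G) t \<in> ?I"
      using A.a_rcos_zero[OF I.ideal_axioms] I.rcos_const_imp_mem[OF c] by blast
    finally show ?thesis using restrict_mem_edge_ideal[OF G] by simp
  qed
  then show "ring_presentation.ker (stanley_reisner_ring G :: ('v, 'k) mpoly set ring) (sr_map G) = sr_ideal G"
    unfolding ring_presentation.ker_def[OF pres] by auto
qed

lemma sr_ideal_noeth:
  assumes "finite_simple_graph G" shows "noeth_mod (sr_ideal G :: ('v, 'k::field) mpoly set)"
  using assms by (intro noeth_mod_mpoly[of "vertices G"]) (auto simp: finite_simple_graph_def intro: sr_ideal_var)

lemma sr_ideal_subset_var_prime:
  assumes "independent_set G S" shows "sr_ideal G \<subseteq> (var_prime S :: ('v, 'k::field) mpoly set)"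
proof (rule sr_ideal_minimal)
  let ?P = "var_prime S :: ('v, 'k) mpoly set"
  show sub: "idl.subspace ?P" by (rule prime_idealD(1)[OF prime_var_prime])
  show "mpoly_var v \<in> ?P" if "v \<notin> vertices G" for v
    using that assms by (auto simp: independent_set_def)
  show "mpoly_var i * mpoly_var j \<in> ?P" if "{i, j} \<in> edges G" for i j
  proof -
    have "i \<notin> S \<or> j \<notin> S" using that assms by (auto simp: independent_set_def)
    then show ?thesis
    proof
      assume "i \<notin> S" then show ?thesis by (intro idl_mult(2)[OF sub]) simp
    next
      assume "j \<notin> S" then show ?thesis by (intro idl_mult(1)[OF sub]) simp
    qed
  qed
qed

lemma prime_independent:
  fixes M :: "('v, 'k::field) mpoly set"
  assumes "finite_simple_graph G" "prime_ideal M" "sr_ideal G \<subseteq> M" 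
  shows "independent_set G {v. mpoly_var v \<notin> M}"
  unfolding independent_set_def
proof (intro conjI ballI notI)
  show "{v. mpoly_var v \<notin> M} \<subseteq> vertices G"
  proof (rule subsetI, rule ccontr)
    fix v assume v: "v \<in> {v. mpoly_var v \<notin> M}" "v \<notin> vertices G"
    have "mpoly_var v \<in> M" by (rule subsetD[OF assms(3) sr_ideal_var[OF v(2)]])
    then show False using v(1) by simp
  qed
  fix e assume e: "e \<in> edges G" "e \<subseteq> {v. mpoly_var v \<notin> M}"
  then have "card e = 2" using assms(1) by (auto simp: finite_simple_graph_def)
  then obtain i j where ij: "e = {i, j}" by (auto simp: card_2_iff)
  then have "{i, j} \<in> edges G" using e(1) by simp
  then have "mpoly_var i * mpoly_var j \<in> M" by (rule subsetD[OF assms(3) sr_ideal_edge])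
  then show False using prime_idealD(3)[OF assms(2)] e(2) ij by auto
qed

lemma independent_subset: "independent_set G T \<Longrightarrow> U \<subseteq> T \<Longrightarrow> independent_set G U"
  unfolding independent_set_def by blast

lemma finite_independent: "finite_simple_graph G \<Longrightarrow> independent_set G S \<Longrightarrow> finite S"
  by (auto simp: independent_set_def finite_simple_graph_def intro: finite_subset)

text \<open>
  The product of the variables in \<open>S\<close> is annihilated by exactly the prime of \<open>S\<close>: a vertex outside \<open>S\<close> has
  a neighbour in \<open>S\<close> by maximality.
\<close>
lemma sr_depth_le:
  fixes M :: "('v, 'k::field) mpoly set"
  assumes G: "finite_simple_graph G" and S: "maximal_independent_set G S"
    and M: "prime_ideal M" "var_prime S \<subseteq> M" and ts: "regular_mod (sr_ideal G) ts" "set ts \<subseteq> M"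
  shows "length ts \<le> card S"
proof -
  let ?J = "sr_ideal G :: ('v, 'k) mpoly set"
  have ind: "independent_set G S" using S by (simp add: maximal_independent_set_def)
  have finS: "finite S" by (rule finite_independent[OF G ind])
  have JS: "?J \<subseteq> var_prime S" by (rule sr_ideal_subset_var_prime[OF ind])
  define f where "f = (\<Prod>v\<in>S. mpoly_var v :: ('v, 'k) mpoly)"
  have "f \<notin> var_prime S"
    unfolding f_def using prime_ideal_prod[OF prime_var_prime finS] by fastforce
  then have colon: "r \<in> var_prime S" if "r * f \<in> ?J" for r
    using prime_idealD(3)[OF prime_var_prime, of r f S] that JS by blast
  have outside: "mpoly_var v * f \<in> ?J" if v: "v \<notin> S" for v
  proof (cases "v \<in> vertices G")
    case False
    show ?thesis by (rule idl_mult(2)[OF sr_ideal_subspace sr_ideal_var[OF False]])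
  next
    case True
    have "\<not> independent_set G (insert v S)"
      using S v by (auto simp: maximal_independent_set_def)
    then obtain e where e: "e \<in> edges G" "e \<subseteq> insert v S"
      using True ind by (auto simp: independent_set_def)
    have "\<not> e \<subseteq> S" "card e = 2" using e(1) ind G by (auto simp: independent_set_def finite_simple_graph_def)
    then obtain w where w: "e = {v, w}" "w \<in> S" using e(2) by (auto simp: card_2_iff)
    have "f = mpoly_var w * (\<Prod>v\<in>S - {w}. mpoly_var v)"
      unfolding f_def by (rule prod.remove[OF finS w(2)])
    then have "mpoly_var v * f = (mpoly_var v * mpoly_var w) * (\<Prod>v\<in>S - {w}. mpoly_var v)"
      by (simp add: mult.assoc)
    also have "\<dots> \<in> ?J" using e(1) w(1) by (intro idl_mult(2) sr_ideal_edge) auto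
    finally show ?thesis .
  qed
  obtain Q where Q: "\<forall>k\<le>length ts. idl.subspace (Q k) \<and> Q k \<subseteq> M" "Q 0 = {r. r * f \<in> ?J}"
     "\<forall>k<length ts. Q k \<subseteq> Q (Suc k) \<and> ts ! k \<in> Q (Suc k) \<and> (\<forall>r. r * ts ! k \<in> Q k \<longrightarrow> r \<in> Q k)"
    using regular_sequence_colon_chain[OF sr_ideal_noeth[OF G] M(1) sr_ideal_subspace _ _ ts, of f]
      JS M(2) colon by blast
  show ?thesis
  proof (rule ideal_chain_length[of "length ts" Q "\<lambda>k. ts ! k"])
    show "1 \<notin> Q (length ts)" using Q(1) prime_idealD(2)[OF M(1)] by blast
    show "mpoly_var v \<in> Q 0" if "v \<notin> S" for v using outside[OF that] by (simp add: Q(2))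
  qed (use Q finS in auto)
qed

text \<open>
  The variables outside the first prime of a chain form an independent set.
\<close>
lemma sr_height_le:
  fixes p :: "nat \<Rightarrow> ('v, 'k::field) mpoly set"
  assumes G: "finite_simple_graph G" and p: "\<And>i. i \<le> k \<Longrightarrow> prime_ideal (p i) \<and> sr_ideal G \<subseteq> p i"
    "\<And>i. i < k \<Longrightarrow> p i \<subset> p (Suc i)"
  shows "\<exists>S. independent_set G S \<and> k \<le> card S"
proof -
  have "\<forall>i. \<exists>y. i < k \<longrightarrow> y \<in> p (Suc i) \<and> y \<notin> p i" using p(2) by blast
  then obtain y where y: "\<And>i. i < k \<Longrightarrow> y i \<in> p (Suc i)" "\<And>i. i < k \<Longrightarrow> y i \<notin> p i" by metis
  define S where "S = {v. mpoly_var v \<notin> p 0}"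
  have S: "independent_set G S" unfolding S_def using p(1)[of 0] by (intro prime_independent[OF G]) auto
  have "k \<le> card S"
  proof (rule ideal_chain_length[of k p y])
    show "idl.subspace (p i)" if "i \<le> k" for i using p(1)[OF that] prime_idealD(1) by blast
    show "r \<in> p i" if "i < k" "r * y i \<in> p i" for i r
      using prime_idealD(3)[of "p i" r "y i"] p(1)[of i] y(2)[of i] that by auto
    show "1 \<notin> p k" using p(1)[of k] prime_idealD(2) by blast
    show "finite S" by (rule finite_independent[OF G S])
  qed (use p y in \<open>auto simp: S_def\<close>)
  then show ?thesis using S by blast
qed

text \<open>
  Depth and height are compared at the maximal ideal generated by all variables, which contains the
  primes of all facets.
\<close>
theorem cohen_macaulay_imp_well_covered:
  fixes G :: "'v sgraph"
  assumes CM: "cohen_macaulay_graph TYPE('k::field) G"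
  shows "well_covered G"
proof -
  have G: "finite_simple_graph G" using CM by (simp add: cohen_macaulay_graph_def)
  let ?R = "stanley_reisner_ring G :: ('v, 'k) mpoly set ring"
  interpret R: ring_presentation ?R "sr_map G" by (rule sr_presentation(1)[OF G])
  have ker: "R.ker = sr_ideal G" by (rule sr_presentation(2)[OF G])
  let ?M = "var_prime {} :: ('v, 'k) mpoly set"
  have "independent_set G {}" using G by (auto simp: independent_set_def finite_simple_graph_def)
  then have JM: "sr_ideal G \<subseteq> ?M" by (rule sr_ideal_subset_var_prime)
  have "\<exists>b. 1 - a * b \<in> ?M" if "a \<notin> ?M" for a
  proof -
    have "restrict_vars {} a \<in> range cst"
      using mpolys_in_minimal[OF range_cst_subring, of "{}"] restrict_vars_in[of "{}" a] by auto
    then obtain c where c: "restrict_vars {} a = cst c" by blast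
    then have "c \<noteq> 0" using that by (auto simp: var_prime_def cst_hom)
    then have "1 - a * cst (inverse c) \<in> ?M"
      using cst_unit[of c] by (simp add: var_prime_def restrict_vars_mult c mult.commute)
    then show ?thesis by blast
  qed
  then have "maximalideal (sr_map G ` ?M) ?R"
    using JM by (intro R.push_maximal prime_var_prime) (auto simp: ker)
  then have eq: "ideal_depth ?R (sr_map G ` ?M) = ideal_height ?R (sr_map G ` ?M)"
    using CM by (auto simp: cohen_macaulay_graph_def cohen_macaulay_ring_def)
  have pull: "sr_map G -` (sr_map G ` ?M) = ?M"
    using JM by (intro R.pull_push prime_idealD(1)[OF prime_var_prime]) (simp add: ker)
  have le: "card T \<le> card S" if S: "maximal_independent_set G S" and T: "maximal_independent_set G T" for S T
  proof -
    have "ideal_depth ?R (sr_map G ` ?M) \<le> enat (card S)"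
    proof (rule R.depth_le)
      fix ts assume "regular_mod R.ker ts" "set ts \<subseteq> sr_map G -` (sr_map G ` ?M)"
      then have "length ts \<le> card S"
        using sr_depth_le[OF G S prime_var_prime var_prime_antimono[of "{}" S], of ts]
        unfolding ker pull by simp
      then show "enat (length ts) \<le> enat (card S)" by simp
    qed
    moreover have "enat (card T) \<le> ideal_height ?R (sr_map G ` ?M)"
    proof -
      have ind: "independent_set G T" using T by (simp add: maximal_independent_set_def)
      obtain vs where vs: "set vs = T" "distinct vs"
        using finite_distinct_list[OF finite_independent[OF G ind]] by blast
      then have len: "length vs = card T" using distinct_card by force
      define p where "p = (\<lambda>i. var_prime (set (drop i vs)) :: ('v, 'k) mpoly set)"
      show ?thesis
      proof (rule R.height_ge[where p = p])
        show "sr_map G ` ?M \<subseteq> carrier ?R" by auto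
        show "prime_ideal (p i) \<and> R.ker \<subseteq> p i" if "i \<le> card T" for i
        proof -
          have "independent_set G (set (drop i vs))"
            using ind set_drop_subset[of i vs] unfolding vs(1) by (rule independent_subset)
          then show ?thesis unfolding p_def ker using prime_var_prime sr_ideal_subset_var_prime by blast
        qed
        show "p i \<subset> p (Suc i)" if "i < card T" for i
        proof
          have d: "drop i vs = vs ! i # drop (Suc i) vs" using that len by (simp add: Cons_nth_drop_Suc)
          show "p i \<subseteq> p (Suc i)" unfolding p_def by (rule var_prime_antimono) (auto simp: d)
          have "vs ! i \<notin> set (drop (Suc i) vs)"
            using distinct_drop[OF vs(2), of i] unfolding d by simp
          then have "mpoly_var (vs ! i) \<in> p (Suc i)" "mpoly_var (vs ! i) \<notin> p i"
            by (simp_all add: p_def d)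
          then show "p i \<noteq> p (Suc i)" by blast
        qed
        show "p (card T) = sr_map G -` (sr_map G ` ?M)" unfolding pull by (simp add: p_def len[symmetric])
      qed
    qed
    ultimately show ?thesis using eq by (metis enat_ord_simps(1) order_trans)
  qed
  then show ?thesis unfolding well_covered_def using G by (auto intro: antisym)
qed

section \<open>Graphs with an ordered perfect matching are Cohen--Macaulay\<close>

definition linear_extension :: "(('v \<Rightarrow>\<^sub>0 nat) \<Rightarrow> ('v, 'k::field) mpoly) \<Rightarrow> ('v, 'k) mpoly \<Rightarrow> ('v, 'k) mpoly" where
  "linear_extension F p = (\<Sum>m\<in>keys p. cst (lookup p m) * F m)"

lemma linear_extension_superset:
  assumes "finite A" "keys p \<subseteq> A"
  shows "linear_extension F p = (\<Sum>m\<in>A. cst (lookup p m) * F m)"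
  unfolding linear_extension_def using assms
  by (intro sum.mono_neutral_left) (auto simp: in_keys_iff cst_hom(1))

lemma linear_extension_add:
  "linear_extension F (p + q) = linear_extension F p + linear_extension F q"
proof -
  let ?A = "keys p \<union> keys q"
  have "linear_extension F (p + q) = (\<Sum>m\<in>?A. cst (lookup (p + q) m) * F m)"
    using keys_add[of p q] by (intro linear_extension_superset) auto
  also have "\<dots> = (\<Sum>m\<in>?A. cst (lookup p m) * F m) + (\<Sum>m\<in>?A. cst (lookup q m) * F m)"
    by (simp add: lookup_add cst_hom(3) distrib_right sum.distrib)
  also have "\<dots> = linear_extension F p + linear_extension F q"
    using linear_extension_superset[of ?A p F] linear_extension_superset[of ?A q F] by simp
  finally show ?thesis .
qed

lemma lookup_cst_mult: "lookup (cst c * p) m = c * lookup p m"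
proof -
  have "cst c * p = (\<Sum>m\<in>keys p. single m (c * lookup p m))"
    by (subst mpoly_expand[of p]) (simp add: sum_distrib_left cst_def mult_single)
  then have "lookup (cst c * p) m =
      (\<Sum>l\<in>keys p. if l = m then c * lookup p l else 0)"
    by (simp add: lookup_sum lookup_single when_def)
  then show ?thesis by (simp add: sum.delta' in_keys_iff)
qed

lemma linear_extension_cst: "linear_extension F (cst c * p) = cst c * linear_extension F p"
proof -
  have "keys (cst c * p) \<subseteq> keys p" 
    by (auto simp: in_keys_iff lookup_cst_mult)
  then have eq: "linear_extension F (cst c * p) =
      (\<Sum>m\<in>keys p. cst (lookup (cst c * p) m) * F m)"
    by (intro linear_extension_superset) auto
  show ?thesis
    unfolding eq linear_extension_def[of F p] sum_distrib_left
    by (rule sum.cong) (simp_all add: lookup_cst_mult cst_hom(4) mult.assoc)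
qed

lemma linear_extension_monomial: "linear_extension F (single m 1) = F m"
  by (simp add: linear_extension_def cst_hom(2))

lemma linear_extension_sum: "linear_extension F (sum f A) = (\<Sum>a\<in>A. linear_extension F (f a))"
proof -
  have "linear_extension F 0 = 0" by (simp add: linear_extension_def)
  then show ?thesis by (induction A rule: infinite_finite_induct) (simp_all add: linear_extension_add)
qed

lemma mpoly_expand_cst: "p = (\<Sum>m\<in>keys p. cst (lookup p m) * single m 1)"
proof -
  have "(\<Sum>m\<in>keys p. single m (lookup p m)) =
      (\<Sum>m\<in>keys p. cst (lookup p m) * single m 1)"
    by (rule sum.cong) (simp_all add: cst_def mult_single)
  with mpoly_expand[of p] show ?thesis by (rule trans)
qed

lemma linear_congruence_monomials:
  fixes f g :: "('v, 'k::field) mpoly \<Rightarrow> ('v, 'k) mpoly"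
  assumes J: "idl.subspace J"
    and f: "\<And>p q. f (p + q) = f p + f q" "\<And>c p. f (cst c * p) = cst c * f p"
    and g: "\<And>p q. g (p + q) = g p + g q" "\<And>c p. g (cst c * p) = cst c * g p"
    and mon: "\<And>m. f (single m 1) - g (single m 1) \<in> J"
  shows "f p - g p \<in> J"
proof -
  have sum: "h (sum t A) = (\<Sum>a\<in>A. h (t a))"
    if "\<And>p q. h (p + q) = h p + h q" for h :: "('v, 'k) mpoly \<Rightarrow> ('v, 'k) mpoly" and t and A :: "('v \<Rightarrow>\<^sub>0 nat) set"
  proof -
    have "h 0 = 0" using that[of 0 0] by simp
    then show ?thesis by (induction A rule: infinite_finite_induct) (simp_all add: that)
  qed
  define t where "t = (\<lambda>m. cst (lookup p m) * single m (1::'k))"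
  have p: "p = sum t (keys p)" unfolding t_def by (rule mpoly_expand_cst)
  have "f p = (\<Sum>m\<in>keys p. f (t m))"
    using arg_cong[OF p, of f] sum[OF f(1)] by (rule trans)
  moreover have "g p = (\<Sum>m\<in>keys p. g (t m))"
    using arg_cong[OF p, of g] sum[OF g(1)] by (rule trans)
  ultimately have "f p - g p = (\<Sum>m\<in>keys p. f (t m)) - (\<Sum>m\<in>keys p. g (t m))"
    by (simp only:)
  also have "\<dots> = (\<Sum>m\<in>keys p. cst (lookup p m) *
      (f (single m 1) - g (single m 1)))"
    unfolding sum_subtractf[symmetric] by (rule sum.cong) (simp_all add: t_def f g right_diff_distrib)
  also have "\<dots> \<in> J" using mon by (intro idl.subspace_sum[OF J] idl_mult(1)[OF J])
  finally show ?thesis .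
qed

lemma nonface_monomial:
  fixes G :: "'v sgraph"
  assumes G: "finite_simple_graph G" and m: "\<not> independent_set G (keys m)"
  shows "(single m c :: ('v, 'k::field) mpoly) \<in> sr_ideal G"
proof (cases "keys m \<subseteq> vertices G")
  case False
  then obtain v where "v \<in> keys m" "v \<notin> vertices G" by blast
  then show ?thesis by (intro monomial_in_ideal[of _ v] sr_ideal_var) auto
next
  case True
  then obtain e where e: "e \<in> edges G" "e \<subseteq> keys m"
    using m by (auto simp: independent_set_def)
  then have "card e = 2" using G by (auto simp: finite_simple_graph_def)
  then obtain i j where ij: "e = {i, j}" "i \<noteq> j" by (auto simp: card_2_iff)
  define x where "x = (\<lambda>v. mpoly_var v ^ (lookup m v - 1) :: ('v, 'k) mpoly)"
  have pow: "mpoly_var v ^ lookup m v = mpoly_var v * x v" if "v \<in> keys m" for v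
    using that unfolding x_def by (cases "lookup m v") (auto simp: in_keys_iff)
  have "(\<Prod>v\<in>keys m. mpoly_var v ^ lookup m v :: ('v, 'k) mpoly) =
      (mpoly_var i * x i) * ((mpoly_var j * x j) * (\<Prod>v\<in>keys m - {i} - {j}. mpoly_var v ^ lookup m v))"
    using e(2) ij pow[of i] pow[of j]
    by (subst prod.remove[of _ i], simp, simp, subst prod.remove[of _ j]) auto
  also have "\<dots> = (mpoly_var i * mpoly_var j) * (x i * x j * (\<Prod>v\<in>keys m - {i} - {j}. mpoly_var v ^ lookup m v))"
    by (simp add: mult_ac)
  also have "\<dots> \<in> sr_ideal G" using e(1) unfolding ij(1)
    by (intro idl_mult(2)[OF sr_ideal_subspace] sr_ideal_edge)
  finally show ?thesis unfolding monomial_eq_prod by (rule idl_mult(1)[OF sr_ideal_subspace])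
qed

text \<open>
  A monomial supported on a face survives the restriction to that face, which annihilates the ideal.
\<close>
lemma sr_ideal_keys:
  fixes G :: "'v sgraph" and p :: "('v, 'k::field) mpoly"
  assumes G: "finite_simple_graph G" and p: "p \<in> sr_ideal G" and m: "m \<in> keys p"
  shows "\<not> independent_set G (keys m)"
proof
  assume "independent_set G (keys m)"
  then have "p \<in> var_prime (keys m)" by (rule subsetD[OF sr_ideal_subset_var_prime p])
  then have "restrict_vars (keys m) p = 0" by (simp add: var_prime_def)
  then have "lookup (restrict_vars (keys m) p) m = 0" by simp
  then show False using m by (simp add: lookup_restrict_vars in_keys_iff)
qed

text \<open>
  The vertices in \<open>L\<close> are matched with an independent set of partners, and \<open>t\<close> counts as below \<open>k\<close> when it
  is adjacent to the partner of \<open>k\<close>. Up to notation these are the conditions in the criterion of Crupi,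
  Rinaldo and Terai for very well-covered graphs to be Cohen--Macaulay. In the application \<open>L\<close> consists
  of the sets that avoid a fixed index, the partner is the complement, and below means contained in.
\<close>
locale ordered_matching =
  fixes G :: "'v sgraph" and L :: "'v set" and c :: "'v \<Rightarrow> 'v" and rank :: "'v \<Rightarrow> nat"
  assumes graph: "finite_simple_graph G"
    and vertices: "vertices G = L \<union> c ` L" and inj: "inj_on c L" and disj: "L \<inter> c ` L = {}"
    and partners_independent: "i \<in> L \<Longrightarrow> j \<in> L \<Longrightarrow> {c i, c j} \<notin> edges G"
    and matched: "k \<in> L \<Longrightarrow> {k, c k} \<in> edges G"
    and below_trans: "t \<in> L \<Longrightarrow> k \<in> L \<Longrightarrow> j \<in> L \<Longrightarrow> t \<noteq> k \<Longrightarrow> {t, c k} \<in> edges G \<Longrightarrow> {k, c j} \<in> edges G \<Longrightarrow> {t, c j} \<in> edges G"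
    and below_adj: "t \<in> L \<Longrightarrow> k \<in> L \<Longrightarrow> j \<in> L \<Longrightarrow> t \<noteq> k \<Longrightarrow> {t, c k} \<in> edges G \<Longrightarrow> {j, k} \<in> edges G \<Longrightarrow> {j, t} \<in> edges G"
    and rank_less: "t \<in> L \<Longrightarrow> k \<in> L \<Longrightarrow> t \<noteq> k \<Longrightarrow> {t, c k} \<in> edges G \<Longrightarrow> rank t < rank k"
begin

definition below :: "'v \<Rightarrow> 'v set" where
  "below k = {t \<in> L. t \<noteq> k \<and> {t, c k} \<in> edges G}"

abbreviation face :: "('v \<Rightarrow>\<^sub>0 nat) \<Rightarrow> bool" where
  "face m \<equiv> independent_set G (keys m)"

text \<open>
  Division by the parameter \<open>x + y\<close> of the pair \<open>x = k\<close>, \<open>y = c k\<close>. As \<open>x * y = 0\<close> modulo the edges, higher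
  powers of \<open>x\<close> and of \<open>y\<close> are \<open>x + y\<close> times the preceding power. For a monomial \<open>m\<close> without \<open>x\<close> and \<open>y\<close>
  only the sum of \<open>x * m\<close> and \<open>y * m\<close> is a multiple of \<open>x + y\<close>; the operator sends \<open>y * m\<close> to \<open>m\<close> and
  \<open>x * m\<close> to \<open>0\<close>, except when \<open>m\<close> contains a variable below \<open>k\<close>: then \<open>y * m\<close> vanishes, and \<open>x * m\<close>
  goes to \<open>m\<close>.
\<close>
definition shift_monomial :: "'v \<Rightarrow> ('v \<Rightarrow>\<^sub>0 nat) \<Rightarrow> ('v, 'k::field) mpoly" where
  "shift_monomial k m =
     (if \<not> face m then 0
      else if c k \<in> keys m then single (m - single (c k) (Suc 0)) 1
      else if 2 \<le> lookup m k \<or> (k \<in> keys m \<and> keys m \<inter> below k \<noteq> {})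
      then single (m - single k (Suc 0)) 1 else 0)"

definition shift :: "'v \<Rightarrow> ('v, 'k::field) mpoly \<Rightarrow> ('v, 'k) mpoly" where
  "shift k = linear_extension (shift_monomial k)"

definition param :: "'v \<Rightarrow> ('v, 'k::field) mpoly" where
  "param k = mpoly_var k + mpoly_var (c k)"

lemma face_insert:
  assumes "independent_set G K" "w \<in> vertices G" "\<And>z. z \<in> K \<Longrightarrow> {w, z} \<notin> edges G"
  shows "independent_set G (insert w K)"
  unfolding independent_set_def
proof (intro conjI ballI notI)
  show "insert w K \<subseteq> vertices G" using assms by (auto simp: independent_set_def)
  fix e assume e: "e \<in> edges G" "e \<subseteq> insert w K"
  then have "card e = 2" using graph by (auto simp: finite_simple_graph_def)
  then obtain i j where ij: "e = {i, j}" "i \<noteq> j" by (auto simp: card_2_iff)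
  have "\<not> e \<subseteq> K" using assms(1) e(1) by (auto simp: independent_set_def)
  then obtain z where "e = {w, z}" "z \<in> K" using ij e(2) by auto
  then show False using assms(3) e(1) by blast
qed

lemma face_no_edge: "independent_set G K \<Longrightarrow> i \<in> K \<Longrightarrow> j \<in> K \<Longrightarrow> {i, j} \<notin> edges G"
  by (auto simp: independent_set_def)

lemma vertex_cases: "v \<in> vertices G \<Longrightarrow> (v \<in> L \<Longrightarrow> thesis) \<Longrightarrow> (\<And>i. i \<in> L \<Longrightarrow> v = c i \<Longrightarrow> thesis) \<Longrightarrow> thesis"
  using vertices by blast

abbreviation raise :: "'v \<Rightarrow> ('v \<Rightarrow>\<^sub>0 nat) \<Rightarrow> ('v \<Rightarrow>\<^sub>0 nat)" where
  "raise w m \<equiv> single w (Suc 0) + m"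

lemma keys_raise: "keys (raise w m) = insert w (keys m)"
  by (simp add: keys_add_nat)

lemma var_times_monomial: "mpoly_var w * single m 1 = single (raise w m) 1"
  by (simp add: mpoly_var_def mult_single)

lemma raise_diff: "raise w m - single w (Suc 0) = m"
  by (rule poly_mapping_eqI) (simp add: lookup_minus lookup_add)

lemma diff_raise: "w \<in> keys m \<Longrightarrow> raise w (m - single w (Suc 0)) = m"
  by (rule poly_mapping_eqI) (auto simp: lookup_minus lookup_add lookup_single when_def in_keys_iff)

lemma raise_raise_diff: "u \<noteq> w \<Longrightarrow> raise w m - single u (Suc 0) = raise w (m - single u (Suc 0))"
  by (rule poly_mapping_eqI) (auto simp: lookup_minus lookup_add lookup_single when_def)

lemma c_notin: "k \<in> L \<Longrightarrow> i \<in> L \<Longrightarrow> c k \<noteq> i"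
  using disj by blast

text \<open>
  At most one of the two summands is nonzero, and which one depends on whether \<open>m\<close> already contains a
  variable of the pair or a variable below \<open>k\<close>.
\<close>
lemma shift_monomial_param:
  assumes k: "k \<in> L" and m: "face m"
  shows "shift_monomial k (raise k m) + shift_monomial k (raise (c k) m) = (single m 1 :: ('v, 'k::field) mpoly)"
proof -
  have kc: "{c k, k} \<in> edges G" using matched[OF k] by (simp add: insert_commute)
  have V: "k \<in> vertices G" "c k \<in> vertices G" using k by (auto simp: vertices)
  have ckk: "c k \<noteq> k" using c_notin[OF k k] .
  have mV: "keys m \<subseteq> vertices G" using m by (simp add: independent_set_def)
  consider "c k \<in> keys m" | "k \<in> keys m" 
    | "c k \<notin> keys m" "k \<notin> keys m" by blast
  then show ?thesis
  proof cases
    case 1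
    then have "\<not> face (raise k m)"
      using matched[OF k] face_no_edge[of "keys (raise k m)" k "c k"] by (auto simp: keys_raise)
    moreover have "face (raise (c k) m)" using 1 m by (simp add: keys_raise insert_absorb)
    ultimately show ?thesis by (simp add: shift_monomial_def keys_raise raise_diff)
  next
    case 2
    then have "\<not> face (raise (c k) m)"
      using matched[OF k] face_no_edge[of "keys (raise (c k) m)" k "c k"] by (auto simp: keys_raise)
    moreover have "face (raise k m)" using 2 m by (simp add: keys_raise insert_absorb)
    moreover have "c k \<notin> keys m" using face_no_edge[OF m 2] matched[OF k] by blast
    moreover have "2 \<le> lookup (raise k m) k" using 2 by (simp add: lookup_add in_keys_iff)
    ultimately show ?thesis using ckk by (simp add: shift_monomial_def keys_raise raise_diff)
  next
    case 3
    show ?thesis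
    proof (cases "keys m \<inter> below k = {}")
      case False
      then obtain t where t: "t \<in> keys m" "t \<in> L" "t \<noteq> k" "{t, c k} \<in> edges G"
        by (auto simp: below_def)
      then have "\<not> face (raise (c k) m)"
        using face_no_edge[of "keys (raise (c k) m)" t "c k"] by (auto simp: keys_raise)
      moreover have "{k, z} \<notin> edges G" if z: "z \<in> keys m" for z
      proof
        assume e: "{k, z} \<in> edges G"
        have "z \<in> vertices G" using z mV by blast
        then show False
        proof (rule vertex_cases)
          assume zL: "z \<in> L"
          have "{z, k} \<in> edges G" using e by (simp add: insert_commute)
          then have "{z, t} \<in> edges G" using below_adj[OF t(2) k zL t(3,4)] by blast
          then show False using face_no_edge[OF m z t(1)] by blast
        next
          fix i assume i: "i \<in> L" "z = c i"
          then have "{t, z} \<in> edges G" using below_trans[OF t(2) k i(1) t(3,4)] e by blast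
          then show False using face_no_edge[OF m t(1) z] by blast
        qed
      qed
      then have "face (raise k m)" unfolding keys_raise by (intro face_insert m V) auto
      ultimately show ?thesis using 3 ckk False by (simp add: shift_monomial_def keys_raise raise_diff)
    next
      case True
      have "{c k, z} \<notin> edges G" if z: "z \<in> keys m" for z
      proof
        assume e: "{c k, z} \<in> edges G"
        have "z \<in> vertices G" using z mV by blast
        then show False
        proof (rule vertex_cases)
          assume zL: "z \<in> L"
          have "{z, c k} \<in> edges G" using e by (simp add: insert_commute)
          then show False using True z zL 3 by (auto simp: below_def)
        next
          fix i assume "i \<in> L" "z = c i"
          then show False using partners_independent[OF k] e by blast
        qed
      qed
      then have "face (raise (c k) m)" unfolding keys_raise by (intro face_insert m V) auto
      moreover have "shift_monomial k (raise k m) = (0 :: ('v, 'k) mpoly)"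
        using 3 ckk True by (auto simp: shift_monomial_def keys_raise lookup_add in_keys_iff below_def)
      ultimately show ?thesis by (simp add: shift_monomial_def[of k "raise (c k) m"] keys_raise raise_diff)
    qed
  qed
qed

text \<open>
  Multiplication by a variable of the pair \<open>i\<close> leaves the case that applies to \<open>m\<close> unchanged, because \<open>i\<close>
  is not below \<open>k\<close>. What remains is that \<open>w\<close> kills the quotient monomial whenever it kills \<open>m\<close>: the two
  closure conditions on \<open>below\<close> move an edge from \<open>w\<close> to \<open>k\<close> to an edge from \<open>w\<close> to an element below \<open>k\<close>.
\<close>
lemma shift_monomial_commute:
  assumes k: "k \<in> L" and i: "i \<in> L" "i \<noteq> k" "i \<notin> below k" and w: "w = i \<or> w = c i"
  shows "shift_monomial k (raise w m) - mpoly_var w * shift_monomial k m \<in> (sr_ideal G :: ('v, 'k::field) mpoly set)"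
proof -
  have wV: "w \<in> vertices G" using i w by (auto simp: vertices)
  have wk: "w \<noteq> k" using w i c_notin[OF i(1) k] by auto
  have wck: "w \<noteq> c k" using w i c_notin[OF k i(1)] inj_onD[OF inj _ i(1) k] by auto
  have wbelow: "w \<notin> below k" using w i disj by (auto simp: below_def)
  have keysw: "keys (raise w m) \<inter> below k = keys m \<inter> below k"
    using wbelow by (auto simp: keys_raise)
  have lookw: "lookup (raise w m) k = lookup m k"
    using wk by (simp add: lookup_add lookup_single)
  have z: "0 \<in> (sr_ideal G :: ('v, 'k) mpoly set)" by (rule idl.subspace_0[OF sr_ideal_subspace])
  show ?thesis
  proof (cases "face m")
    case False
    then have "\<not> face (raise w m)" unfolding keys_raise using independent_subset by blast
    then show ?thesis using False z by (simp add: shift_monomial_def)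
  next
    case m: True
    have core: "single (raise w (m - single u (Suc 0))) (1::'k) \<in> sr_ideal G"
      if u: "u \<in> keys m" "u = c k \<or> u = k \<and> (2 \<le> lookup m k \<or> keys m \<inter> below k \<noteq> {})"
        and nf: "\<not> face (raise w m)" for u
    proof (rule nonface_monomial[OF graph])
      define m' where "m' = m - single u (Suc 0)"
      have km: "keys m' \<union> {u} = keys m"
        using arg_cong[OF diff_raise[OF u(1)], of Poly_Mapping.keys] unfolding keys_raise m'_def by auto
      obtain x where x: "x \<in> keys m" "{w, x} \<in> edges G"
        using face_insert[OF m wV] nf unfolding keys_raise by blast
      have nfI: "\<not> face (raise w m')" if "x' \<in> keys m'" "{w, x'} \<in> edges G" for x'
        using that face_no_edge[of _ w x'] by (auto simp: keys_raise)
      show "\<not> face (raise w m')"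
      proof (cases "x \<in> keys m'")
        case True
        then show ?thesis using nfI x(2) by blast
      next
        case False
        then have xu: "x = u" using x(1) km by blast
        show ?thesis using u(2)
        proof
          assume "u = c k"
          then have e: "{w, c k} \<in> edges G" using x(2) xu by simp
          show ?thesis
          proof (cases "w = i")
            case True
            then show ?thesis using e i by (auto simp: below_def)
          next
            case False
            then show ?thesis using e w partners_independent[OF i(1) k] by auto
          qed
        next
          assume uk: "u = k \<and> (2 \<le> lookup m k \<or> keys m \<inter> below k \<noteq> {})"
          have "\<not> 2 \<le> lookup m k"
          proof
            assume "2 \<le> lookup m k"
            then have "k \<in> keys m'" using uk by (simp add: m'_def in_keys_iff lookup_minus)
            then show False using False xu uk by blast
          qed
          then obtain t where t: "t \<in> keys m" "t \<in> L" "t \<noteq> k" "{t, c k} \<in> edges G"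
            using uk by (auto simp: below_def)
          have tm: "t \<in> keys m'" using t km uk by blast
          have e: "{w, k} \<in> edges G" using x(2) xu uk by simp
          show ?thesis
          proof (cases "w = i")
            case True
            then show ?thesis using nfI[OF tm] below_adj[OF t(2) k i(1) t(3,4)] e by blast
          next
            case False
            then have "{k, c i} \<in> edges G" using e w by (auto simp: insert_commute)
            then have "{w, t} \<in> edges G" using below_trans[OF t(2) k i(1) t(3,4)] w False by (auto simp: insert_commute)
            then show ?thesis using nfI[OF tm] by blast
          qed
        qed
      qed
    qed
    have ckw: "c k \<in> keys (raise w m) \<longleftrightarrow> c k \<in> keys m"
      "k \<in> keys (raise w m) \<longleftrightarrow> k \<in> keys m"
      using wk wck by (auto simp: keys_raise)
    consider (partner) "c k \<in> keys m"
      | (self) "c k \<notin> keys m" "k \<in> keys m"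
         "2 \<le> lookup m k \<or> keys m \<inter> below k \<noteq> {}"
      | (none) "c k \<notin> keys m"
         "\<not> (2 \<le> lookup m k \<or> (k \<in> keys m \<and> keys m \<inter> below k \<noteq> {}))"
      by (cases "k \<in> keys m") (auto simp: in_keys_iff)
    then show ?thesis
    proof cases
      case partner
      have s: "shift_monomial k m = (single (m - single (c k) (Suc 0)) 1 :: ('v, 'k) mpoly)"
        using m partner by (simp add: shift_monomial_def)
      show ?thesis
      proof (cases "face (raise w m)")
        case True
        then have "shift_monomial k (raise w m) = (single (raise w m - single (c k) (Suc 0)) 1 :: ('v, 'k) mpoly)"
          using partner unfolding shift_monomial_def ckw by simp
        then show ?thesis using z wck by (simp add: s var_times_monomial raise_raise_diff)
      next
        case False
        then have "shift_monomial k (raise w m) = (0 :: ('v, 'k) mpoly)" by (simp add: shift_monomial_def)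
        then show ?thesis using core[OF partner _ False] idl.subspace_neg[OF sr_ideal_subspace]
          by (simp add: s var_times_monomial)
      qed
    next
      case self
      have s: "shift_monomial k m = (single (m - single k (Suc 0)) 1 :: ('v, 'k) mpoly)"
        using m self by (simp add: shift_monomial_def)
      show ?thesis
      proof (cases "face (raise w m)")
        case True
        then have "shift_monomial k (raise w m) = (single (raise w m - single k (Suc 0)) 1 :: ('v, 'k) mpoly)"
          using self unfolding shift_monomial_def ckw keysw lookw by simp
        then show ?thesis using z wk by (simp add: s var_times_monomial raise_raise_diff)
      next
        case False
        then have "shift_monomial k (raise w m) = (0 :: ('v, 'k) mpoly)" by (simp add: shift_monomial_def)
        then show ?thesis using core[OF self(2) _ False] self(3) idl.subspace_neg[OF sr_ideal_subspace]
          by (simp add: s var_times_monomial)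
      qed
    next
      case none
      then have "shift_monomial k m = (0 :: ('v, 'k) mpoly)" by (auto simp: shift_monomial_def)
      moreover have "shift_monomial k (raise w m) = (0 :: ('v, 'k) mpoly)"
        using none unfolding shift_monomial_def ckw keysw lookw by auto
      ultimately show ?thesis using z by simp
    qed
  qed
qed

lemma shift_add: "shift k (p + q) = shift k p + shift k q"
  by (simp add: shift_def linear_extension_add)

lemma shift_cst: "shift k (cst a * p) = cst a * shift k p"
  by (simp add: shift_def linear_extension_cst)

lemma shift_single: "shift k (single m 1) = shift_monomial k m"
  by (simp add: shift_def linear_extension_monomial)

lemma shift_sum: "shift k (sum f A) = (\<Sum>a\<in>A. shift k (f a))"
  by (simp add: shift_def linear_extension_sum)

lemma shift_sr_ideal:
  fixes r :: "('v, 'k::field) mpoly"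
  assumes "r \<in> sr_ideal G" shows "shift k r \<in> sr_ideal G"
proof -
  have "cst (lookup r m) * shift_monomial k m = (0 :: ('v, 'k) mpoly)"
    if "m \<in> keys r" for m
    using sr_ideal_keys[OF graph assms that] by (simp add: shift_monomial_def)
  then have "shift k r = 0" unfolding shift_def linear_extension_def by (rule sum.neutral[OF ballI])
  then show ?thesis using idl.subspace_0[OF sr_ideal_subspace] by simp
qed

lemma shift_param:
  fixes r :: "('v, 'k::field) mpoly"
  assumes k: "k \<in> L"
  shows "shift k (param k * r) - r \<in> sr_ideal G"
proof (rule linear_congruence_monomials[OF sr_ideal_subspace, where f = "\<lambda>r. shift k (param k * r)" and g = "\<lambda>r. r"])
  show "shift k (param k * (p + q)) = shift k (param k * p) + shift k (param k * q)" for p q :: "('v, 'k) mpoly"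
    by (simp add: distrib_left shift_add)
  show "shift k (param k * (cst a * p)) = cst a * shift k (param k * p)" for a and p :: "('v, 'k) mpoly"
    by (simp only: shift_cst[symmetric] mult.left_commute)
  fix m :: "'v \<Rightarrow>\<^sub>0 nat"
  have "param k * single m (1::'k) = single (raise k m) 1 + single (raise (c k) m) 1"
    by (simp add: param_def distrib_right var_times_monomial)
  then have eq: "shift k (param k * single m (1::'k)) = shift_monomial k (raise k m) + shift_monomial k (raise (c k) m)"
    by (simp add: shift_add shift_single)
  show "shift k (param k * single m (1::'k)) - single m 1 \<in> sr_ideal G"
  proof (cases "face m")
    case True
    then show ?thesis unfolding eq shift_monomial_param[OF k True]
      using idl.subspace_0[OF sr_ideal_subspace] by simp
  next
    case False
    have nf: "\<not> face (raise w m)" for w using False independent_subset unfolding keys_raise by blast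
    have "shift k (param k * single m (1::'k)) = 0"
      unfolding eq using nf[of k] nf[of "c k"] by (simp add: shift_monomial_def)
    then show ?thesis using idl.subspace_neg[OF sr_ideal_subspace nonface_monomial[OF graph False]] by simp
  qed
qed simp_all

lemma shift_var_commute:
  fixes r :: "('v, 'k::field) mpoly"
  assumes "k \<in> L" "i \<in> L" "i \<noteq> k" "i \<notin> below k" "w = i \<or> w = c i"
  shows "shift k (mpoly_var w * r) - mpoly_var w * shift k r \<in> sr_ideal G"
proof (rule linear_congruence_monomials[OF sr_ideal_subspace, where f = "\<lambda>r. shift k (mpoly_var w * r)"
      and g = "\<lambda>r. mpoly_var w * shift k r"])
  show "shift k (mpoly_var w * (p + q)) = shift k (mpoly_var w * p) + shift k (mpoly_var w * q)"
    "mpoly_var w * shift k (p + q) = mpoly_var w * shift k p + mpoly_var w * shift k q" for p q :: "('v, 'k) mpoly"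
    by (simp_all add: distrib_left shift_add)
  show "shift k (mpoly_var w * (cst a * p)) = cst a * shift k (mpoly_var w * p)"
    "mpoly_var w * shift k (cst a * p) = cst a * (mpoly_var w * shift k p)" for a and p :: "('v, 'k) mpoly"
    by (simp_all only: shift_cst mult.left_commute[of "mpoly_var w"])
  show "shift k (mpoly_var w * single m (1::'k)) - mpoly_var w * shift k (single m 1) \<in> sr_ideal G" for m
    unfolding var_times_monomial shift_single using assms by (rule shift_monomial_commute)
qed

lemma shift_param_power_commute:
  fixes r :: "('v, 'k::field) mpoly"
  assumes k: "k \<in> L" "i \<in> L" "i \<noteq> k" "i \<notin> below k"
  shows "shift k (param i ^ j * r) - param i ^ j * shift k r \<in> sr_ideal G"
proof (induction j)
  case 0
  then show ?case using idl.subspace_0[OF sr_ideal_subspace] by simp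
next
  case (Suc j)
  let ?x = "param i :: ('v, 'k) mpoly"
  have one: "shift k (?x * t) - ?x * shift k t \<in> sr_ideal G" for t
  proof -
    have "shift k (?x * t) - ?x * shift k t =
        (shift k (mpoly_var i * t) - mpoly_var i * shift k t) + (shift k (mpoly_var (c i) * t) - mpoly_var (c i) * shift k t)"
      by (simp add: param_def distrib_right shift_add)
    also have "\<dots> \<in> sr_ideal G"
      using shift_var_commute[OF k] by (intro idl.subspace_add[OF sr_ideal_subspace]) auto
    finally show ?thesis .
  qed
  have "shift k (?x ^ Suc j * r) - ?x ^ Suc j * shift k r =
      (shift k (?x * (?x ^ j * r)) - ?x * shift k (?x ^ j * r)) + ?x * (shift k (?x ^ j * r) - ?x ^ j * shift k r)"
    by (simp add: right_diff_distrib mult.assoc)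
  also have "\<dots> \<in> sr_ideal G"
    by (intro idl.subspace_add[OF sr_ideal_subspace] one idl_mult(1)[OF sr_ideal_subspace] Suc.IH)
  finally show ?case .
qed

lemma shift_polynomial_commute:
  fixes r :: "('v, 'k::field) mpoly"
  fixes a :: "nat \<Rightarrow> 'k" and e :: nat
  assumes k: "k \<in> L" "i \<in> L" "i \<noteq> k" "i \<notin> below k"
  defines "g \<equiv> param i ^ e + (\<Sum>j<e. cst (a j) * param i ^ j)"
  shows "shift k (g * r) - g * shift k r \<in> sr_ideal G"
proof -
  note pc = shift_param_power_commute[OF k]
  have "shift k (g * r) - g * shift k r = (shift k (param i ^ e * r) - param i ^ e * shift k r) +
      (\<Sum>j<e. cst (a j) * (shift k (param i ^ j * r) - param i ^ j * shift k r))"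
    by (simp add: g_def distrib_right sum_distrib_right shift_add shift_sum mult.assoc shift_cst
        right_diff_distrib sum_subtractf)
  also have "\<dots> \<in> sr_ideal G"
    by (intro idl.subspace_add[OF sr_ideal_subspace] pc idl.subspace_sum[OF sr_ideal_subspace]
        idl_mult(1)[OF sr_ideal_subspace])
  finally show ?thesis .
qed

text \<open>
  The operator lowers the exponent of \<open>k\<close> or of its partner.
\<close>
lemma shift_nilpotent:
  fixes r :: "('v, 'k::field) mpoly"
  assumes k: "k \<in> L"
  shows "\<exists>N. (shift k ^^ N) r = 0"
proof -
  define deg where "deg = (\<lambda>m :: 'v \<Rightarrow>\<^sub>0 nat. lookup m k + lookup m (c k))"
  have z: "(shift k ^^ N) (0 :: ('v, 'k) mpoly) = 0" for N
  proof (induction N)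
    case (Suc N)
    have "shift k (0 :: ('v, 'k) mpoly) = 0" using shift_add[of k 0 0] by simp
    then show ?case using Suc.IH by simp
  qed simp
  have drop: "deg (m - single w (Suc 0)) < deg m"
    if "w = k \<or> w = c k" "w \<in> keys m" for m w
    using that c_notin[OF k k] by (auto simp: deg_def lookup_minus lookup_single in_keys_iff when_def)
  have mon: "(shift k ^^ N) (single m (1::'k)) = 0" if "deg m < N" for m N
    using that
  proof (induction N arbitrary: m)
    case (Suc N)
    have eq: "(shift k ^^ Suc N) (single m (1::'k)) = (shift k ^^ N) (shift_monomial k m)"
      by (simp add: funpow_swap1 shift_single)
    have IH: "(shift k ^^ N) (single (m - single w (Suc 0)) (1::'k)) = 0"
      if "w = k \<or> w = c k" "w \<in> keys m" for w
      using drop[OF that] Suc.prems by (intro Suc.IH) auto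
    have keysk: "k \<in> keys m" if "2 \<le> lookup m k"
      using that by (simp add: in_keys_iff)
    show ?case unfolding eq shift_monomial_def using IH keysk z by auto
  qed simp
  have padd: "(shift k ^^ N) (p + q) = (shift k ^^ N) p + (shift k ^^ N) q" for N and p q :: "('v, 'k) mpoly"
    by (induction N) (simp_all add: shift_add)
  have pcst: "(shift k ^^ N) (cst a * p) = cst a * (shift k ^^ N) p" for N a and p :: "('v, 'k) mpoly"
    by (induction N) (simp_all add: shift_cst)
  have psum: "(shift k ^^ N) (sum f A) = (\<Sum>a\<in>A. (shift k ^^ N) (f a))"
    for N and A :: "('v \<Rightarrow>\<^sub>0 nat) set" and f :: "_ \<Rightarrow> ('v, 'k) mpoly"
    by (induction A rule: infinite_finite_induct) (simp_all add: padd z)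
  define N where "N = Suc (Max (insert 0 (deg ` keys r)))"
  have lt: "deg m < N" if "m \<in> keys r" for m
    using that by (simp add: N_def less_Suc_eq_le)
  have "(shift k ^^ N) (\<Sum>m\<in>keys r. cst (lookup r m) * single m 1) = 0"
    unfolding psum pcst by (rule sum.neutral) (simp add: mon[OF lt])
  then show ?thesis unfolding mpoly_expand_cst[of r, symmetric] by blast
qed

text \<open>
  The list is sorted by decreasing rank, so that no earlier element is below a later one; by
  \<open>shift_polynomial_commute\<close> the operator of \<open>k\<close> then preserves the ideal generated by the earlier polynomials.
\<close>
lemma regular_parameters:
  fixes g :: "'v \<Rightarrow> ('v, 'k::field) mpoly"
  assumes g: "\<And>i. g i = param i ^ e i + (\<Sum>j<e i. cst (a i j) * param i ^ j)"
    and ks: "distinct ks" "set ks \<subseteq> L" "sorted_wrt (\<lambda>i j. rank j \<le> rank i) ks"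
    and proper: "idl.span (sr_ideal G \<union> g ` set ks) \<noteq> UNIV"
  shows "regular_mod (sr_ideal G) (map g ks)"
  unfolding regular_mod_def
proof (intro conjI allI impI)
  show "idl.span (sr_ideal G \<union> set (map g ks)) \<noteq> UNIV" using proper by simp
  fix n r assume n: "n < length (map g ks)"
  define k where "k = ks ! n"
  have kL: "k \<in> L" using ks(2) n by (auto simp: k_def)
  define K where "K = idl.span (sr_ideal G \<union> g ` set (take n ks))"
  have K: "idl.subspace K" "sr_ideal G \<subseteq> K" unfolding K_def by (auto intro: idl.span_base)
  have earlier: "i \<in> L \<and> i \<noteq> k \<and> i \<notin> below k" if i: "i \<in> set (take n ks)" for i
  proof -
    obtain l where l: "l < n" "i = ks ! l" using i n by (auto simp: in_set_conv_nth)
    have "i \<noteq> k" using ks(1) l n by (auto simp: k_def nth_eq_iff_index_eq)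
    moreover have "rank k \<le> rank i" using sorted_wrt_nth_less[OF ks(3) l(1)] n by (simp add: l k_def)
    moreover have "i \<in> L" using ks(2) l n by auto
    ultimately show ?thesis using rank_less[of i k] kL by (auto simp: below_def)
  qed
  have "\<forall>t\<in>K. \<forall>s. shift k (s * t) \<in> K"
  proof -
    have "K \<subseteq> {t. \<forall>s. shift k (s * t) \<in> K}"
      unfolding K_def
    proof (rule idl.span_minimal; fold K_def)
      show "idl.subspace {t. \<forall>s. shift k (s * t) \<in> K}"
      proof (rule idl.subspaceI)
        have "shift k (0 :: ('v, 'k) mpoly) = 0" using shift_add[of k 0 0] by simp
        then show "0 \<in> {t. \<forall>s. shift k (s * t) \<in> K}" using idl.subspace_0[OF K(1)] by simp
        fix x y b :: "('v, 'k) mpoly" assume x: "x \<in> {t. \<forall>s. shift k (s * t) \<in> K}"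
        show "b * x \<in> {t. \<forall>s. shift k (s * t) \<in> K}"
          using x by (auto simp: mult.assoc[symmetric])
        assume "y \<in> {t. \<forall>s. shift k (s * t) \<in> K}"
        then show "x + y \<in> {t. \<forall>s. shift k (s * t) \<in> K}"
          using x by (auto simp: distrib_left shift_add intro: idl.subspace_add[OF K(1)])
      qed
      show "sr_ideal G \<union> g ` set (take n ks) \<subseteq> {t. \<forall>s. shift k (s * t) \<in> K}"
      proof (intro subsetI CollectI allI)
        fix t s assume "t \<in> sr_ideal G \<union> g ` set (take n ks)"
        then show "shift k (s * t) \<in> K"
        proof
          assume "t \<in> sr_ideal G"
          then show ?thesis using K(2) by (intro subsetD[OF K(2)] shift_sr_ideal idl_mult(1)[OF sr_ideal_subspace])
        next
          assume "t \<in> g ` set (take n ks)"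
          then obtain i where i: "i \<in> set (take n ks)" "t = g i" by blast
          have "shift k (t * s) - t * shift k s \<in> sr_ideal G"
            unfolding i(2) g using earlier[OF i(1)] by (intro shift_polynomial_commute kL) auto
          then have "shift k (t * s) - t * shift k s \<in> K" using K(2) by blast
          moreover have "t \<in> K" unfolding K_def i(2) using i(1) by (intro idl.span_base) auto
          then have "t * shift k s \<in> K" by (rule idl_mult(2)[OF K(1)])
          ultimately have "(shift k (t * s) - t * shift k s) + t * shift k s \<in> K"
            by (rule idl.subspace_add[OF K(1)])
          then show ?thesis by (simp add: mult.commute)
        qed
      qed
    qed
    then show ?thesis by blast
  qed
  then have DK: "shift k t \<in> K" if "t \<in> K" for t using that by (metis mult_1)
  assume "r * map g ks ! n \<in> idl.span (sr_ideal G \<union> set (take n (map g ks)))"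
  then have "r * g k \<in> K" using n by (simp add: K_def k_def take_map)
  then have "r * (param k ^ e k + (\<Sum>j<e k. cst (a k j) * param k ^ j)) \<in> K" unfolding g .
  then have "r \<in> K"
  proof (rule shift_nonzerodivisor[OF K(1), where D = "shift k", rotated 5])
    show "shift k (p + q) = shift k p + shift k q" for p q :: "('v, 'k) mpoly" by (rule shift_add)
    show "shift k (cst (a k j) * p) = cst (a k j) * shift k p" for j and p :: "('v, 'k) mpoly" by (rule shift_cst)
    show "shift k t \<in> K" if "t \<in> K" for t by (rule DK[OF that])
    show "shift k (param k * p) - p \<in> K" for p :: "('v, 'k) mpoly"
      using shift_param[OF kL] K(2) by blast
    show "\<exists>N. (shift k ^^ N) p \<in> K" for p :: "('v, 'k) mpoly"
      using shift_nilpotent[OF kL, of p] idl.subspace_0[OF K(1)] by metis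
  qed
  then show "r \<in> idl.span (sr_ideal G \<union> set (take n (map g ks)))" by (simp add: K_def take_map)
qed

text \<open>
  An independent set contains at most one vertex of each matched pair.
\<close>
lemma independent_card: "independent_set G S \<Longrightarrow> card S \<le> card L"
proof -
  assume S: "independent_set G S"
  have finL: "finite L" using graph vertices by (auto simp: finite_simple_graph_def)
  define f where "f = (\<lambda>v. if v \<in> L then v else inv_into L c v)"
  have fc: "f (c i) = i" if "i \<in> L" for i
    using that disj inv_into_f_f[OF inj that] by (auto simp: f_def)
  have fL: "f i = i" if "i \<in> L" for i using that by (simp add: f_def)
  have SV: "v \<in> vertices G" if "v \<in> S" for v using S that by (auto simp: independent_set_def)
  have "f v \<in> L" if "v \<in> S" for v
    using SV[OF that] by (rule vertex_cases) (auto simp: fc fL)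
  moreover have "inj_on f S"
  proof (rule inj_onI)
    fix u v assume uv: "u \<in> S" "v \<in> S" "f u = f v"
    have ne: "{i, c i} \<inter> S \<noteq> {i, c i}" if "i \<in> L" for i
      using face_no_edge[OF S, of i "c i"] matched[OF that] by auto
    show "u = v"
      using SV[OF uv(1)]
    proof (rule vertex_cases)
      assume u: "u \<in> L"
      show ?thesis using SV[OF uv(2)]
      proof (rule vertex_cases)
        assume "v \<in> L" then show ?thesis using u uv(3) fL by metis
      next
        fix i assume "i \<in> L" "v = c i"
        then show ?thesis using u uv fL fc ne[of i] by auto
      qed
    next
      fix i assume u: "i \<in> L" "u = c i"
      show ?thesis using SV[OF uv(2)]
      proof (rule vertex_cases)
        assume "v \<in> L" then show ?thesis using u uv fL fc ne[of i] by auto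
      next
        fix j assume "j \<in> L" "v = c j"
        then show ?thesis using u uv(3) fc by auto
      qed
    qed
  qed
  ultimately show "card S \<le> card L" using finL by (intro card_inj_on_le[of f]) auto
qed

text \<open>
  Zariski's lemma; the leading coefficient is a nonzero constant and can be normalized.
\<close>
lemma monic_polynomial_in_maximal:
  fixes M :: "('v, 'k::field) mpoly set"
  assumes M: "prime_ideal M" "sr_ideal G \<subseteq> M" "\<And>b. b \<notin> M \<Longrightarrow> \<exists>d. 1 - b * d \<in> M"
  shows "\<exists>e a. t ^ e + (\<Sum>j<e. cst (a j) * t ^ j) \<in> M"
proof -
  note s = prime_idealD(1)[OF M(1)]
  obtain vs where vs: "set vs = vertices G"
    using graph finite_list[of "vertices G"] by (auto simp: finite_simple_graph_def)
  have "\<exists>p\<in>polys_over (range cst). p \<notin> polys_over M \<and> poly p t \<in> M"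
  proof (rule maximal_ideal_algebraic[OF M(1,3) range_cst_subring, where us = "map mpoly_var vs"])
    fix B :: "('v, 'k) mpoly set" assume B: "subring_set B" "range cst \<union> set (map mpoly_var vs) \<subseteq> B"
    have "mpolys_in (vertices G) \<subseteq> B" using B vs by (intro mpolys_in_minimal) auto
    then have "restrict_vars (vertices G) q \<in> B" for q :: "('v, 'k) mpoly"
      using restrict_vars_in by (rule subsetD)
    moreover have "q - restrict_vars (vertices G) q \<in> M" for q :: "('v, 'k) mpoly"
      using minus_restrict_vars_in_ideal[OF sr_ideal_subspace sr_ideal_var] by (rule subsetD[OF M(2)])
    ultimately show "\<forall>q. \<exists>b\<in>B. q - b \<in> M" by blast
  qed
  then obtain p where p: "p \<in> polys_over (range cst)" "p \<notin> polys_over M" "poly p t \<in> M" by blast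
  have "\<forall>i. \<exists>b. coeff p i = cst b" using polys_overD[OF p(1)] by blast
  then obtain b where b: "\<And>i. coeff p i = cst (b i)" by metis
  define e where "e = degree p"
  have "p \<noteq> 0" using p(2) polys_over_ideal(5)[OF s] by auto
  then have "cst (b e) \<noteq> (0 :: ('v, 'k) mpoly)" using b[of e] by (metis e_def leading_coeff_0_iff)
  then have be: "b e \<noteq> 0" by (auto simp: cst_hom(1))
  have "cst (inverse (b e)) * poly p t = (\<Sum>j\<le>e. cst (inverse (b e) * b j) * t ^ j)"
    unfolding poly_altdef sum_distrib_left by (simp add: b e_def cst_hom(4) mult.assoc)
  also have "\<dots> = t ^ e + (\<Sum>j<e. cst (inverse (b e) * b j) * t ^ j)"
    unfolding lessThan_Suc_atMost[symmetric] sum.lessThan_Suc using be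
    by (simp add: cst_hom(2) add.commute)
  finally have "t ^ e + (\<Sum>j<e. cst (inverse (b e) * b j) * t ^ j) \<in> M"
    using idl_mult(1)[OF s p(3)] by metis
  then show ?thesis by (intro exI[of _ e] exI[of _ "\<lambda>j. inverse (b e) * b j"])
qed

theorem cohen_macaulay: "cohen_macaulay_graph TYPE('k::field) G"
  unfolding cohen_macaulay_graph_def cohen_macaulay_ring_def
proof (intro conjI allI impI)
  let ?R = "stanley_reisner_ring G :: ('v, 'k) mpoly set ring"
  interpret R: ring_presentation ?R "sr_map G" by (rule sr_presentation(1)[OF graph])
  have ker: "R.ker = sr_ideal G" by (rule sr_presentation(2)[OF graph])
  show "finite_simple_graph G" by (rule graph)
  show "cring ?R" by (rule R.cring_axioms)
  show "noetherian_ring ?R" by (rule R.noetherian_push) (simp add: ker sr_ideal_noeth[OF graph])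
  fix P assume P: "maximalideal P ?R"
  have prime: "primeideal P ?R" by (rule R.maximalideal_prime[OF P])
  define M where "M = sr_map G -` P"
  have M: "prime_ideal M" "sr_ideal G \<subseteq> M"
    using R.pull_prime[OF prime] R.pull_ideal(2)[OF primeideal.axioms(1)[OF prime]] by (auto simp: M_def ker)
  have max: "\<exists>d. 1 - b * d \<in> M" if "b \<notin> M" for b
    using R.pull_maximal[OF P] that by (simp add: M_def)
  have finL: "finite L" using graph vertices by (auto simp: finite_simple_graph_def)
  obtain l where l: "set l = L" "distinct l" using finite_distinct_list[OF finL] by blast
  define ks where "ks = rev (sort_key rank l)"
  have ks: "distinct ks" "set ks = L" "length ks = card L"
    using l distinct_card[OF l(2)] by (simp_all add: ks_def)
  have sorted: "sorted_wrt (\<lambda>i j. rank j \<le> rank i) ks"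
    using sorted_sort_key[of rank l] by (simp add: ks_def sorted_wrt_rev sorted_map)
  have "\<forall>i. \<exists>e a. param i ^ e + (\<Sum>j<e. cst (a j) * param i ^ j) \<in> M"
    using monic_polynomial_in_maximal[OF M max] by blast
  then obtain e a where ea: "\<And>i. param i ^ e i + (\<Sum>j<e i. cst (a i j) * param i ^ j) \<in> M"
    by metis
  define g where "g = (\<lambda>i. param i ^ e i + (\<Sum>j<e i. cst (a i j) * param i ^ j))"
  have gM: "g i \<in> M" for i using ea by (simp add: g_def)
  have "idl.span (sr_ideal G \<union> g ` set ks) \<subseteq> M"
    using M gM by (intro idl.span_minimal prime_idealD(1)) auto
  then have proper: "idl.span (sr_ideal G \<union> g ` set ks) \<noteq> UNIV" using prime_idealD(2)[OF M(1)] by blast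
  have reg: "regular_mod (sr_ideal G) (map g ks)"
    by (rule regular_parameters[of g e a, OF _ ks(1) _ sorted proper]) (simp_all add: g_def ks(2))
  have "enat (length (map g ks)) \<le> ideal_depth ?R P"
    using reg gM by (intro R.depth_ge) (auto simp: ker M_def[symmetric])
  then have ge: "enat (card L) \<le> ideal_depth ?R P" by (simp add: ks(3))
  have height: "ideal_height ?R P \<le> enat (card L)"
  proof (rule R.height_le)
    fix k p assume p: "\<And>i. i \<le> k \<Longrightarrow> prime_ideal (p i) \<and> R.ker \<subseteq> p i" "\<And>i. i < k \<Longrightarrow> p i \<subset> p (Suc i)"
    obtain S where "independent_set G S" "k \<le> card S"
      using sr_height_le[where p = p and k = k, OF graph p[unfolded ker]] by blast
    then show "enat k \<le> enat (card L)" using independent_card[of S] by simp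
  qed
  have "ideal_depth ?R P \<le> ideal_height ?R P"
  proof (rule R.depth_le)
    fix ts assume ts: "regular_mod R.ker ts" "set ts \<subseteq> sr_map G -` P"
    obtain p where p: "\<forall>i\<le>length ts. prime_ideal (p i) \<and> sr_ideal G \<subseteq> p i"
      "\<forall>i<length ts. p i \<subset> p (Suc i)" "p (length ts) = M"
      using regular_sequence_prime_chain[OF sr_ideal_noeth[OF graph] ts(1)[unfolded ker] M]
        ts(2) unfolding M_def by blast
    have "P \<subseteq> carrier ?R"
      using additive_subgroup.a_subset[OF ideal.axioms(1)[OF primeideal.axioms(1)[OF prime]]] .
    then show "enat (length ts) \<le> ideal_height ?R P"
      using p by (intro R.height_ge[where p = p]) (auto simp: ker M_def)
  qed
  then show "ideal_depth ?R P = ideal_height ?R P" using ge height by (meson antisym order_trans)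
qed

end

section \<open>Products of posets without zero-divisors\<close>

lemma bounded_posetD:
  assumes "bounded_poset L"
  shows "\<bottom>\<^bsub>L\<^esub> \<in> carrier L" "\<top>\<^bsub>L\<^esub> \<in> carrier L"
    and "x \<in> carrier L \<Longrightarrow> \<bottom>\<^bsub>L\<^esub> \<sqsubseteq>\<^bsub>L\<^esub> x" "x \<in> carrier L \<Longrightarrow> x \<sqsubseteq>\<^bsub>L\<^esub> \<top>\<^bsub>L\<^esub>" "x \<in> carrier L \<Longrightarrow> x \<sqsubseteq>\<^bsub>L\<^esub> x"
    and "x \<in> carrier L \<Longrightarrow> y \<in> carrier L \<Longrightarrow> x \<sqsubseteq>\<^bsub>L\<^esub> y \<Longrightarrow> y \<sqsubseteq>\<^bsub>L\<^esub> x \<Longrightarrow> x = y"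
    and "x \<in> carrier L \<Longrightarrow> y \<in> carrier L \<Longrightarrow> z \<in> carrier L \<Longrightarrow> x \<sqsubseteq>\<^bsub>L\<^esub> y \<Longrightarrow> y \<sqsubseteq>\<^bsub>L\<^esub> z \<Longrightarrow> x \<sqsubseteq>\<^bsub>L\<^esub> z"
proof -
  interpret partial_order L using assms by (simp add: bounded_poset_def)
  interpret b: weak_partial_order_bottom L using assms by (simp add: bounded_poset_def)
  interpret t: weak_partial_order_top L using assms by (simp add: bounded_poset_def)
  show "\<bottom>\<^bsub>L\<^esub> \<in> carrier L" "\<top>\<^bsub>L\<^esub> \<in> carrier L"
    "x \<in> carrier L \<Longrightarrow> \<bottom>\<^bsub>L\<^esub> \<sqsubseteq>\<^bsub>L\<^esub> x" "x \<in> carrier L \<Longrightarrow> x \<sqsubseteq>\<^bsub>L\<^esub> \<top>\<^bsub>L\<^esub>" "x \<in> carrier L \<Longrightarrow> x \<sqsubseteq>\<^bsub>L\<^esub> x"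
    by simp_all
  show "x \<in> carrier L \<Longrightarrow> y \<in> carrier L \<Longrightarrow> x \<sqsubseteq>\<^bsub>L\<^esub> y \<Longrightarrow> y \<sqsubseteq>\<^bsub>L\<^esub> x \<Longrightarrow> x = y"
    by (rule le_antisym)
  show "x \<in> carrier L \<Longrightarrow> y \<in> carrier L \<Longrightarrow> z \<in> carrier L \<Longrightarrow> x \<sqsubseteq>\<^bsub>L\<^esub> y \<Longrightarrow> y \<sqsubseteq>\<^bsub>L\<^esub> z \<Longrightarrow> x \<sqsubseteq>\<^bsub>L\<^esub> z"
    by (rule le_trans)
qed

lemma bounded_poset_bottom_eq:
  assumes "bounded_poset L" "b \<in> carrier L" "\<And>x. x \<in> carrier L \<Longrightarrow> b \<sqsubseteq>\<^bsub>L\<^esub> x" shows "\<bottom>\<^bsub>L\<^esub> = b"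
  using bounded_posetD(1)[OF assms(1)] assms(2)
  by (rule bounded_posetD(6)[OF assms(1)]) (simp_all add: bounded_posetD[OF assms(1)] assms(2,3))

lemma bounded_poset_top_eq:
  assumes "bounded_poset L" "t \<in> carrier L" "\<And>x. x \<in> carrier L \<Longrightarrow> x \<sqsubseteq>\<^bsub>L\<^esub> t" shows "\<top>\<^bsub>L\<^esub> = t"
  using bounded_posetD(2)[OF assms(1)] assms(2)
  by (rule bounded_posetD(6)[OF assms(1)]) (simp_all add: bounded_posetD[OF assms(1)] assms(2,3))

lemma Lower_pair_bottom_iff:
  assumes L: "bounded_poset L" and ab: "a \<in> carrier L" "b \<in> carrier L"
  shows "Lower L {a, b} = {\<bottom>\<^bsub>L\<^esub>} \<longleftrightarrow> (\<forall>x\<in>carrier L. x \<sqsubseteq>\<^bsub>L\<^esub> a \<and> x \<sqsubseteq>\<^bsub>L\<^esub> b \<longrightarrow> x = \<bottom>\<^bsub>L\<^esub>)"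
proof -
  have "Lower L {a, b} = {x \<in> carrier L. x \<sqsubseteq>\<^bsub>L\<^esub> a \<and> x \<sqsubseteq>\<^bsub>L\<^esub> b}"
    using ab by (auto simp: Lower_def)
  then show ?thesis
    using bounded_posetD(1)[OF L] bounded_posetD(3)[OF L ab(1)] bounded_posetD(3)[OF L ab(2)] by auto
qed

text \<open>
  In a lattice the cones in the distributivity law for posets are principal, generated by the two
  sides of the distributivity law for lattices.
\<close>
lemma boolean_lattice_imp_boolean_poset:
  assumes L: "boolean_lattice L" shows "boolean_poset L"
proof -
  interpret bounded_lattice L using L by (simp add: boolean_lattice_def)
  have bp: "bounded_poset L" unfolding bounded_poset_def
    by (intro conjI partial_order_axioms weak_partial_order_bottom_axioms weak_partial_order_top_axioms)
  have lower: "Lower L (Upper L (Lower L {a} \<union> Lower L {b})) = Lower L {a \<squnion>\<^bsub>L\<^esub> b}"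
    if ab: "a \<in> carrier L" "b \<in> carrier L" for a b
  proof -
    have "u \<in> Upper L (Lower L {a} \<union> Lower L {b}) \<longleftrightarrow> u \<in> carrier L \<and> a \<squnion>\<^bsub>L\<^esub> b \<sqsubseteq>\<^bsub>L\<^esub> u" for u
    proof
      assume u: "u \<in> Upper L (Lower L {a} \<union> Lower L {b})"
      then have uc: "u \<in> carrier L" by (simp add: Upper_def)
      have "a \<in> Lower L {a}" "b \<in> Lower L {b}" using ab by (auto simp: Lower_def)
      then have "a \<sqsubseteq>\<^bsub>L\<^esub> u" "b \<sqsubseteq>\<^bsub>L\<^esub> u" using u ab by (auto simp: Upper_def)
      then show "u \<in> carrier L \<and> a \<squnion>\<^bsub>L\<^esub> b \<sqsubseteq>\<^bsub>L\<^esub> u" using uc ab by (auto intro: join_le)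
    next
      assume u: "u \<in> carrier L \<and> a \<squnion>\<^bsub>L\<^esub> b \<sqsubseteq>\<^bsub>L\<^esub> u"
      have "a \<sqsubseteq>\<^bsub>L\<^esub> u" "b \<sqsubseteq>\<^bsub>L\<^esub> u"
        using u ab join_left[OF ab] join_right[OF ab] by (auto intro: le_trans)
      then show "u \<in> Upper L (Lower L {a} \<union> Lower L {b})"
        using u ab by (auto simp: Upper_def Lower_def intro: le_trans)
    qed
    then have U: "Upper L (Lower L {a} \<union> Lower L {b}) = {u \<in> carrier L. a \<squnion>\<^bsub>L\<^esub> b \<sqsubseteq>\<^bsub>L\<^esub> u}" by blast
    have J: "a \<squnion>\<^bsub>L\<^esub> b \<in> carrier L" using ab by simp
    show ?thesis unfolding U using J le_refl[OF J] by (auto simp: Lower_def intro: le_trans)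
  qed
  have pair: "Lower L {a, b} = Lower L {a \<sqinter>\<^bsub>L\<^esub> b}" if ab: "a \<in> carrier L" "b \<in> carrier L" for a b
    using ab meet_left[OF ab] meet_right[OF ab]
    by (auto simp: Lower_def intro: meet_le le_trans[of _ "a \<sqinter>\<^bsub>L\<^esub> b"])
  have "distributive_poset L" unfolding distributive_poset_def
  proof (intro conjI ballI partial_order_axioms)
    fix a b c assume abc: "a \<in> carrier L" "b \<in> carrier L" "c \<in> carrier L"
    then have bc: "b \<squnion>\<^bsub>L\<^esub> c \<in> carrier L" by simp
    have up: "Upper L {b, c} = {u \<in> carrier L. b \<squnion>\<^bsub>L\<^esub> c \<sqsubseteq>\<^bsub>L\<^esub> u}"
      using abc join_left[OF abc(2,3)] join_right[OF abc(2,3)]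
      by (auto simp: Upper_def intro: join_le le_trans[of _ "b \<squnion>\<^bsub>L\<^esub> c"])
    have "Lower L ({a} \<union> Upper L {b, c}) = Lower L {a, b \<squnion>\<^bsub>L\<^esub> c}"
      unfolding up using abc(1) bc le_refl[OF bc] by (auto simp: Lower_def intro: le_trans)
    also have "\<dots> = Lower L {a \<sqinter>\<^bsub>L\<^esub> (b \<squnion>\<^bsub>L\<^esub> c)}" by (rule pair[OF abc(1) bc])
    also have "a \<sqinter>\<^bsub>L\<^esub> (b \<squnion>\<^bsub>L\<^esub> c) = (a \<sqinter>\<^bsub>L\<^esub> b) \<squnion>\<^bsub>L\<^esub> (a \<sqinter>\<^bsub>L\<^esub> c)"
      using L abc by (simp add: boolean_lattice_def)
    also have "Lower L {(a \<sqinter>\<^bsub>L\<^esub> b) \<squnion>\<^bsub>L\<^esub> (a \<sqinter>\<^bsub>L\<^esub> c)} =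
        Lower L (Upper L (Lower L {a \<sqinter>\<^bsub>L\<^esub> b} \<union> Lower L {a \<sqinter>\<^bsub>L\<^esub> c}))"
      using abc by (intro lower[symmetric]) auto
    finally show "Lower L ({a} \<union> Upper L {b, c}) = Lower L (Upper L (Lower L {a, b} \<union> Lower L {a, c}))"
      using pair abc by simp
  qed
  then show ?thesis using L bp by (simp add: boolean_poset_def boolean_lattice_def)
qed

locale zero_divisor_free_family =
  fixes I :: "'i set" and P :: "'i \<Rightarrow> 'a gorder"
  assumes finite_index: "finite I"
    and bounded: "i \<in> I \<Longrightarrow> bounded_poset (P i)"
    and finite_factor: "i \<in> I \<Longrightarrow> finite (carrier (P i))"
    and zero_divisors: "i \<in> I \<Longrightarrow> poset_zero_divisors (P i) = {\<bottom>\<^bsub>P i\<^esub>}"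
begin

abbreviation PP :: "('i \<Rightarrow> 'a) gorder" where "PP \<equiv> product_poset I P"

definition bot :: "'i \<Rightarrow> 'a" where "bot = (\<lambda>i\<in>I. \<bottom>\<^bsub>P i\<^esub>)"

definition one :: "'i \<Rightarrow> 'a" where "one = (\<lambda>i\<in>I. \<top>\<^bsub>P i\<^esub>)"

definition supp :: "('i \<Rightarrow> 'a) \<Rightarrow> 'i set" where "supp a = {i \<in> I. a i \<noteq> \<bottom>\<^bsub>P i\<^esub>}"

lemma carrier_PP: "carrier PP = (\<Pi>\<^sub>E i\<in>I. carrier (P i))"
  and le_PP: "a \<sqsubseteq>\<^bsub>PP\<^esub> b \<longleftrightarrow> (\<forall>i\<in>I. a i \<sqsubseteq>\<^bsub>P i\<^esub> b i)"
  and eq_PP: "a .=\<^bsub>PP\<^esub> b \<longleftrightarrow> a = b"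
  by (simp_all add: product_poset_def)

lemma comp: "a \<in> carrier PP \<Longrightarrow> i \<in> I \<Longrightarrow> a i \<in> carrier (P i)"
  by (auto simp: carrier_PP)

lemma PP_eqI: "a \<in> carrier PP \<Longrightarrow> b \<in> carrier PP \<Longrightarrow> (\<And>i. i \<in> I \<Longrightarrow> a i = b i) \<Longrightarrow> a = b"
  unfolding carrier_PP by (rule PiE_ext)

lemmas factorD = bounded_posetD[OF bounded]

lemma bot_one_carrier: "bot \<in> carrier PP" "one \<in> carrier PP"
  by (auto simp: bot_def one_def carrier_PP factorD)

lemma update_carrier: "a \<in> carrier PP \<Longrightarrow> i \<in> I \<Longrightarrow> x \<in> carrier (P i) \<Longrightarrow> a(i := x) \<in> carrier PP"
  by (auto simp: carrier_PP PiE_iff extensional_def)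

lemma bounded_PP: "bounded_poset PP"
proof -
  have po: "partial_order PP"
  proof (intro partial_order.intro partial_order_axioms.intro weak_partial_order.intro
      weak_partial_order_axioms.intro equivalence.intro)
    show "(.=\<^bsub>PP\<^esub>) = (=)" by (simp add: product_poset_def)
    show "x .=\<^bsub>PP\<^esub> x" "x .=\<^bsub>PP\<^esub> y \<Longrightarrow> y .=\<^bsub>PP\<^esub> x" "x .=\<^bsub>PP\<^esub> y \<Longrightarrow> y .=\<^bsub>PP\<^esub> z \<Longrightarrow> x .=\<^bsub>PP\<^esub> z"
      "x .=\<^bsub>PP\<^esub> y \<Longrightarrow> z .=\<^bsub>PP\<^esub> w \<Longrightarrow> x \<sqsubseteq>\<^bsub>PP\<^esub> z \<longleftrightarrow> y \<sqsubseteq>\<^bsub>PP\<^esub> w" for x y z w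
      by (simp_all add: eq_PP)
    show "x \<sqsubseteq>\<^bsub>PP\<^esub> x" if "x \<in> carrier PP" for x
      using that by (simp add: le_PP factorD(5) comp)
    show "x \<sqsubseteq>\<^bsub>PP\<^esub> z" if "x \<sqsubseteq>\<^bsub>PP\<^esub> y" "y \<sqsubseteq>\<^bsub>PP\<^esub> z" "x \<in> carrier PP" "y \<in> carrier PP" "z \<in> carrier PP" for x y z
      unfolding le_PP
    proof
      fix i assume i: "i \<in> I"
      show "x i \<sqsubseteq>\<^bsub>P i\<^esub> z i"
        using factorD(7)[OF i comp[OF that(3) i] comp[OF that(4) i] comp[OF that(5) i]] that(1,2) i
        unfolding le_PP by blast
    qed
    show "x .=\<^bsub>PP\<^esub> y" if "x \<sqsubseteq>\<^bsub>PP\<^esub> y" "y \<sqsubseteq>\<^bsub>PP\<^esub> x" "x \<in> carrier PP" "y \<in> carrier PP" for x y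
      unfolding eq_PP
    proof (rule PP_eqI[OF that(3,4)])
      fix i assume i: "i \<in> I"
      show "x i = y i"
        using factorD(6)[OF i comp[OF that(3) i] comp[OF that(4) i]] that(1,2) i unfolding le_PP by blast
    qed
  qed
  interpret partial_order PP by (rule po)
  have "least PP bot (carrier PP)"
    using bot_one_carrier(1) by (auto simp: least_def le_PP bot_def factorD comp)
  then have "weak_partial_order_bottom PP" by unfold_locales blast
  moreover have "greatest PP one (carrier PP)"
    using bot_one_carrier(2) by (auto simp: greatest_def le_PP one_def factorD comp)
  then have "weak_partial_order_top PP" by unfold_locales blast
  ultimately show ?thesis using po by (simp add: bounded_poset_def)
qed

lemma bottom_PP: "\<bottom>\<^bsub>PP\<^esub> = bot"
  by (rule bounded_poset_bottom_eq[OF bounded_PP bot_one_carrier(1)])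
    (auto simp: le_PP bot_def factorD comp)

lemma top_PP: "\<top>\<^bsub>PP\<^esub> = one"
  by (rule bounded_poset_top_eq[OF bounded_PP bot_one_carrier(2)])
    (auto simp: le_PP one_def factorD comp)

lemma supp_empty_iff: "a \<in> carrier PP \<Longrightarrow> supp a = {} \<longleftrightarrow> a = bot"
proof
  assume a: "a \<in> carrier PP" and "supp a = {}"
  then show "a = bot" by (intro PP_eqI[OF a bot_one_carrier(1)]) (auto simp: supp_def bot_def)
qed (auto simp: supp_def bot_def)

text \<open>
  If both supports contain \<open>i\<close>, then the components at \<open>i\<close> have a common lower bound other than the bottom,
  since neither is a zero-divisor; placed at \<open>i\<close> and extended by the bottom it is a common lower bound
  in the product.
\<close>
lemma disjoint_iff_supp:
  assumes ab: "a \<in> carrier PP" "b \<in> carrier PP"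
  shows "Lower PP {a, b} = {\<bottom>\<^bsub>PP\<^esub>} \<longleftrightarrow> supp a \<inter> supp b = {}"
  unfolding Lower_pair_bottom_iff[OF bounded_PP ab] unfolding bottom_PP
proof
  assume d: "supp a \<inter> supp b = {}"
  show "\<forall>x\<in>carrier PP. x \<sqsubseteq>\<^bsub>PP\<^esub> a \<and> x \<sqsubseteq>\<^bsub>PP\<^esub> b \<longrightarrow> x = bot"
  proof (intro ballI impI)
    fix x assume x: "x \<in> carrier PP" "x \<sqsubseteq>\<^bsub>PP\<^esub> a \<and> x \<sqsubseteq>\<^bsub>PP\<^esub> b"
    show "x = bot"
    proof (rule PP_eqI[OF x(1) bot_one_carrier(1)])
      fix i assume i: "i \<in> I"
      have "a i = \<bottom>\<^bsub>P i\<^esub> \<or> b i = \<bottom>\<^bsub>P i\<^esub>" using d i by (auto simp: supp_def)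
      then have "x i \<sqsubseteq>\<^bsub>P i\<^esub> \<bottom>\<^bsub>P i\<^esub>" using x(2) i by (auto simp: le_PP)
      then have "x i = \<bottom>\<^bsub>P i\<^esub>" 
        using factorD(6)[OF i comp[OF x(1) i] factorD(1)[OF i]] factorD(3)[OF i comp[OF x(1) i]] by blast
      then show "x i = bot i" using i by (simp add: bot_def)
    qed
  qed
next
  assume low: "\<forall>x\<in>carrier PP. x \<sqsubseteq>\<^bsub>PP\<^esub> a \<and> x \<sqsubseteq>\<^bsub>PP\<^esub> b \<longrightarrow> x = bot"
  show "supp a \<inter> supp b = {}"
  proof (rule ccontr)
    assume "supp a \<inter> supp b \<noteq> {}"
    then obtain i where i: "i \<in> I" "a i \<noteq> \<bottom>\<^bsub>P i\<^esub>" "b i \<noteq> \<bottom>\<^bsub>P i\<^esub>" by (auto simp: supp_def)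
    note abi = comp[OF ab(1) i(1)] comp[OF ab(2) i(1)]
    have "a i \<notin> poset_zero_divisors (P i)" using zero_divisors[OF i(1)] i(2) by simp
    then have "Lower (P i) {a i, b i} \<noteq> {\<bottom>\<^bsub>P i\<^esub>}" using abi i(3) by (auto simp: poset_zero_divisors_def)
    then obtain x where x: "x \<in> carrier (P i)" "x \<sqsubseteq>\<^bsub>P i\<^esub> a i" "x \<sqsubseteq>\<^bsub>P i\<^esub> b i" "x \<noteq> \<bottom>\<^bsub>P i\<^esub>"
      unfolding Lower_pair_bottom_iff[OF bounded[OF i(1)] abi] by blast
    have c: "bot(i := x) \<in> carrier PP" by (rule update_carrier[OF bot_one_carrier(1) i(1) x(1)])
    moreover have "bot(i := x) \<sqsubseteq>\<^bsub>PP\<^esub> a \<and> bot(i := x) \<sqsubseteq>\<^bsub>PP\<^esub> b"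
      using x ab by (auto simp: le_PP bot_def factorD comp)
    ultimately have "bot(i := x) = bot" using low by blast
    then have "(bot(i := x)) i = bot i" by (rule fun_cong)
    then have "x = \<bottom>\<^bsub>P i\<^esub>" using i(1) by (simp add: bot_def)
    then show False using x(4) by simp
  qed
qed

lemma nonbottom_exists: "i \<in> I \<Longrightarrow> \<exists>x\<in>carrier (P i). x \<noteq> \<bottom>\<^bsub>P i\<^esub>"
  using zero_divisors[of i] by (auto simp: poset_zero_divisors_def)

lemma card_ge_2: assumes i: "i \<in> I" shows "2 \<le> card (carrier (P i))"
proof -
  obtain x where x: "x \<in> carrier (P i)" "x \<noteq> \<bottom>\<^bsub>P i\<^esub>" using nonbottom_exists[OF i] by blast
  have "card {x, \<bottom>\<^bsub>P i\<^esub>} \<le> card (carrier (P i))"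
    using x(1) factorD(1)[OF i] by (intro card_mono finite_factor i) auto
  then show ?thesis using x(2) by simp
qed

lemma supp_exists: assumes "A \<subseteq> I" shows "\<exists>a\<in>carrier PP. supp a = A"
proof -
  have "\<forall>i. \<exists>x. i \<in> I \<longrightarrow> x \<in> carrier (P i) \<and> x \<noteq> \<bottom>\<^bsub>P i\<^esub>" using nonbottom_exists by blast
  then obtain x where x: "\<And>i. i \<in> I \<Longrightarrow> x i \<in> carrier (P i) \<and> x i \<noteq> \<bottom>\<^bsub>P i\<^esub>" by metis
  define a where "a = (\<lambda>i\<in>I. if i \<in> A then x i else \<bottom>\<^bsub>P i\<^esub>)"
  have "a \<in> carrier PP" using x by (auto simp: a_def carrier_PP factorD)
  moreover have "supp a = A" using x assms by (auto simp: supp_def a_def)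
  ultimately show ?thesis by blast
qed

definition V :: "('i \<Rightarrow> 'a) set" where
  "V = {a \<in> carrier PP. supp a \<noteq> {} \<and> supp a \<noteq> I}"

lemma vertices_zero_divisor_graph: "vertices (zero_divisor_graph PP) = V"
proof -
  have zd: "a \<in> poset_zero_divisors PP \<longleftrightarrow> a \<in> carrier PP \<and> supp a \<noteq> I" if "I \<noteq> {}" for a
  proof
    assume "a \<in> poset_zero_divisors PP"
    then obtain b where b: "a \<in> carrier PP" "b \<in> carrier PP" "b \<noteq> bot" "Lower PP {a, b} = {\<bottom>\<^bsub>PP\<^esub>}"
      by (auto simp: poset_zero_divisors_def bottom_PP)
    then have "supp a \<inter> supp b = {}" "supp b \<noteq> {}" using disjoint_iff_supp supp_empty_iff by auto
    then show "a \<in> carrier PP \<and> supp a \<noteq> I" using b(1) by (auto simp: supp_def)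
  next
    assume a: "a \<in> carrier PP \<and> supp a \<noteq> I"
    have "supp a \<subseteq> I" by (auto simp: supp_def)
    obtain b where b: "b \<in> carrier PP" "supp b = I - supp a" using supp_exists[of "I - supp a"] by blast
    then have "b \<noteq> bot" using a \<open>supp a \<subseteq> I\<close> supp_empty_iff[OF b(1)] by auto
    moreover have "Lower PP {a, b} = {\<bottom>\<^bsub>PP\<^esub>}" using a b by (subst disjoint_iff_supp) auto
    ultimately show "a \<in> poset_zero_divisors PP" using a b by (auto simp: poset_zero_divisors_def bottom_PP)
  qed
  moreover have "poset_zero_divisors PP - {bot} = {}" if empty: "I = {}"
  proof -
    have "a = bot" if "a \<in> carrier PP" for a
      by (rule PP_eqI[OF that bot_one_carrier(1)]) (simp add: empty)
    then show ?thesis unfolding poset_zero_divisors_def by blast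
  qed
  moreover have "V = {}" if "I = {}" using that unfolding V_def supp_def by blast
  moreover have "poset_zero_divisors PP - {bot} = V" if "I \<noteq> {}"
    using zd[OF that] supp_empty_iff unfolding V_def by blast
  moreover have "vertices (zero_divisor_graph PP) = poset_zero_divisors PP - {bot}"
    by (simp add: zero_divisor_graph_def Let_def bottom_PP)
  ultimately show ?thesis by metis
qed

lemma edge_iff:
  "{a, b} \<in> edges (zero_divisor_graph PP) \<longleftrightarrow> a \<in> V \<and> b \<in> V \<and> supp a \<inter> supp b = {}"
proof -
  have V: "poset_zero_divisors PP - {\<bottom>\<^bsub>PP\<^esub>} = V"
    using vertices_zero_divisor_graph by (simp add: zero_divisor_graph_def Let_def)
  have E: "edges (zero_divisor_graph PP) =
      {{a, b} | a b. a \<in> V \<and> b \<in> V \<and> a \<noteq> b \<and> Lower PP {a, b} = {\<bottom>\<^bsub>PP\<^esub>}}"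
    by (simp add: zero_divisor_graph_def Let_def V)
  have iff: "a \<noteq> b \<and> Lower PP {a, b} = {\<bottom>\<^bsub>PP\<^esub>} \<longleftrightarrow> supp a \<inter> supp b = {}" if "a \<in> V" "b \<in> V" for a b
    using that disjoint_iff_supp[of a b] by (auto simp: V_def)
  show ?thesis
  proof
    assume "{a, b} \<in> edges (zero_divisor_graph PP)"
    then obtain x y where xy: "{a, b} = {x, y}" "x \<in> V" "y \<in> V"
      "x \<noteq> y" "Lower PP {x, y} = {\<bottom>\<^bsub>PP\<^esub>}"
      unfolding E mem_Collect_eq by (elim exE conjE)
    then have "supp x \<inter> supp y = {}" using iff[OF xy(2,3)] by simp
    with xy show "a \<in> V \<and> b \<in> V \<and> supp a \<inter> supp b = {}" by (auto simp: doubleton_eq_iff)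
  next
    assume ab: "a \<in> V \<and> b \<in> V \<and> supp a \<inter> supp b = {}"
    then have "a \<noteq> b \<and> Lower PP {a, b} = {\<bottom>\<^bsub>PP\<^esub>}" using iff[of a b] by simp
    with ab show "{a, b} \<in> edges (zero_divisor_graph PP)" unfolding E by blast
  qed
qed

lemma edge_is_pair:
  assumes "e \<in> edges (zero_divisor_graph PP)"
  obtains a b where "e = {a, b}" "a \<in> V" "b \<in> V" "supp a \<inter> supp b = {}"
proof -
  obtain a b where e: "e = {a, b}" using assms by (auto simp: zero_divisor_graph_def Let_def)
  then have "{a, b} \<in> edges (zero_divisor_graph PP)" using assms by simp
  then show ?thesis by (intro that[OF e]) (simp_all add: edge_iff)
qed

lemma finite_carrier_PP: "finite (carrier PP)"
  unfolding carrier_PP using finite_index finite_factor by (rule finite_PiE)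

lemma graph_zero_divisor: "finite_simple_graph (zero_divisor_graph PP)"
proof -
  have "finite V" using finite_carrier_PP by (rule finite_subset[rotated]) (auto simp: V_def)
  moreover have "e \<subseteq> V \<and> card e = 2" if "e \<in> edges (zero_divisor_graph PP)" for e
    using that
  proof (rule edge_is_pair)
    fix a b assume ab: "e = {a, b}" "a \<in> V" "b \<in> V" "supp a \<inter> supp b = {}"
    then have "a \<noteq> b" by (auto simp: V_def)
    then show ?thesis using ab by simp
  qed
  ultimately show ?thesis by (simp add: finite_simple_graph_def vertices_zero_divisor_graph)
qed

lemma card_supp_fiber:
  assumes "A \<subseteq> I"
  shows "card {a \<in> carrier PP. supp a = A} = (\<Prod>i\<in>A. card (carrier (P i)) - 1)"
proof -
  define B where "B = (\<lambda>i. if i \<in> A then carrier (P i) - {\<bottom>\<^bsub>P i\<^esub>} else {\<bottom>\<^bsub>P i\<^esub>})"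
  have "{a \<in> carrier PP. supp a = A} = (\<Pi>\<^sub>E i\<in>I. B i)"
  proof (intro Set.set_eqI iffI)
    fix a assume "a \<in> {a \<in> carrier PP. supp a = A}"
    then show "a \<in> (\<Pi>\<^sub>E i\<in>I. B i)" by (auto simp: carrier_PP supp_def B_def PiE_iff)
  next
    fix a assume a: "a \<in> (\<Pi>\<^sub>E i\<in>I. B i)"
    then have ai: "a i \<in> B i" if "i \<in> I" for i using that by (rule PiE_mem)
    have "a \<in> carrier PP" unfolding carrier_PP
      using a ai by (auto simp: B_def PiE_iff factorD split: if_splits)
    moreover have "a i \<noteq> \<bottom>\<^bsub>P i\<^esub> \<longleftrightarrow> i \<in> A" if "i \<in> I" for i
      using ai[OF that] by (auto simp: B_def split: if_splits)
    then have "supp a = A" using assms by (auto simp: supp_def)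
    ultimately show "a \<in> {a \<in> carrier PP. supp a = A}" by simp
  qed
  then have "card {a \<in> carrier PP. supp a = A} = (\<Prod>i\<in>I. card (B i))"
    using finite_index by (simp add: card_PiE)
  also have "\<dots> = (\<Prod>i\<in>I. if i \<in> A then card (carrier (P i)) - 1 else 1)"
    by (rule prod.cong) (auto simp: B_def factorD card_Diff_singleton)
  also have "\<dots> = (\<Prod>i\<in>A. card (carrier (P i)) - 1)"
    using assms finite_index by (simp add: prod.If_cases Int_absorb1)
  finally show ?thesis .
qed

text \<open>
  The set \<open>S\<close> of all vertices whose support contains \<open>i\<close> is compared with the set obtained by replacing
  the fibre \<open>A\<close> over \<open>{i}\<close> by the fibre \<open>B\<close> over its complement.
\<close>
lemma well_covered_imp_product:
  assumes wc: "well_covered (zero_divisor_graph PP)" and i: "i \<in> I" and I1: "I \<noteq> {i}"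
  shows "card (carrier (P i)) - 1 = (\<Prod>j\<in>I - {i}. card (carrier (P j)) - 1)"
proof -
  let ?G = "zero_divisor_graph PP"
  define S where "S = {v \<in> V. i \<in> supp v}"
  define U where "U = {v \<in> V. i \<in> supp v \<and> supp v \<noteq> {i}}"
  define A where "A = {a \<in> carrier PP. supp a = {i}}"
  define B where "B = {a \<in> carrier PP. supp a = I - {i}}"
  have AV: "A \<subseteq> V" and BV: "B \<subseteq> V" using i I1 by (auto simp: A_def B_def V_def)
  have suppI: "supp v \<subseteq> I" for v by (auto simp: supp_def)
  have exV: "\<exists>w\<in>V. supp w = C" if "C \<subseteq> I" "C \<noteq> {}" "C \<noteq> I" for C
    using supp_exists[OF that(1)] that(2,3) by (auto simp: V_def)
  have indep: "independent_set ?G T" if "T \<subseteq> V" "\<And>a b. a \<in> T \<Longrightarrow> b \<in> T \<Longrightarrow> supp a \<inter> supp b \<noteq> {}" for T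
    unfolding independent_set_def vertices_zero_divisor_graph
  proof (intro conjI ballI notI that(1))
    fix e assume "e \<in> edges ?G" "e \<subseteq> T"
    then show False using that(2) by (elim edge_is_pair) blast
  qed
  have maxI: "maximal_independent_set ?G T" if ind: "independent_set ?G T"
    and dom: "\<And>v. v \<in> V \<Longrightarrow> v \<notin> T \<Longrightarrow> \<exists>w\<in>T. supp v \<inter> supp w = {}" for T
    unfolding maximal_independent_set_def
  proof (intro conjI allI impI ind)
    fix T' assume T': "independent_set ?G T' \<and> T \<subseteq> T'"
    have "v \<in> T" if v: "v \<in> T'" for v
    proof (rule ccontr)
      assume "v \<notin> T"
      have "v \<in> V" using T' v by (auto simp: independent_set_def vertices_zero_divisor_graph)
      then obtain w where w: "w \<in> T" "supp v \<inter> supp w = {}" using dom \<open>v \<notin> T\<close> by blast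
      have "w \<in> V" using T' w(1) by (auto simp: independent_set_def vertices_zero_divisor_graph)
      then have "{v, w} \<in> edges ?G" using \<open>v \<in> V\<close> w(2) by (simp add: edge_iff)
      then show False using T' v w(1) by (auto simp: independent_set_def)
    qed
    then show "T' = T" using T' by blast
  qed
  have "maximal_independent_set ?G S"
  proof (rule maxI)
    show "independent_set ?G S" by (rule indep) (auto simp: S_def)
    fix v assume v: "v \<in> V" "v \<notin> S"
    obtain w where w: "w \<in> V" "supp w = {i}" using exV[of "{i}"] i I1 by auto
    then show "\<exists>w\<in>S. supp v \<inter> supp w = {}" using v by (intro bexI[of _ w]) (auto simp: S_def)
  qed
  moreover have "maximal_independent_set ?G (U \<union> B)"
  proof (rule maxI)
    have cross: "supp a \<inter> (I - {i}) \<noteq> {}" if "a \<in> U" for a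
      using that suppI[of a] by (auto simp: U_def)
    have Bne: "I - {i} \<noteq> {}" using i I1 by auto
    show "independent_set ?G (U \<union> B)"
    proof (rule indep)
      show "U \<union> B \<subseteq> V" using BV by (auto simp: U_def)
      fix a b assume "a \<in> U \<union> B" "b \<in> U \<union> B"
      then show "supp a \<inter> supp b \<noteq> {}"
        using cross[of a] cross[of b] Bne by (auto simp: U_def B_def)
    qed
    fix v assume v: "v \<in> V" "v \<notin> U \<union> B"
    show "\<exists>w\<in>U \<union> B. supp v \<inter> supp w = {}"
    proof (cases "i \<in> supp v")
      case True
      then have "supp v = {i}" using v by (auto simp: U_def)
      moreover obtain w where "w \<in> carrier PP" "supp w = I - {i}" using supp_exists[of "I - {i}"] by auto
      ultimately show ?thesis by (intro bexI[of _ w]) (auto simp: B_def)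
    next
      case False
      have "supp v \<noteq> I - {i}" using v by (auto simp: B_def V_def)
      moreover obtain w where w: "w \<in> V" "supp w = I - supp v"
        using exV[of "I - supp v"] v(1) suppI[of v] by (auto simp: V_def)
      moreover have "I - supp v \<noteq> {i}" using calculation(1) suppI[of v] i False by auto
      ultimately show ?thesis using i False by (intro bexI[of _ w]) (auto simp: U_def)
    qed
  qed
  ultimately have "card S = card (U \<union> B)" using wc unfolding well_covered_def by blast
  moreover have "S = U \<union> A" using AV by (auto simp: S_def U_def A_def V_def)
  moreover have "card (U \<union> A) = card U + card A" "card (U \<union> B) = card U + card B"
    using finite_carrier_PP by (intro card_Un_disjoint; force simp: U_def A_def B_def V_def)+
  ultimately have "card A = card B" by simp
  then show ?thesis using i card_supp_fiber[of "{i}"] card_supp_fiber[of "I - {i}"] by (simp add: A_def B_def)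
qed

text \<open>
  For distinct \<open>i\<close>, \<open>j\<close>, \<open>k\<close> the product formula gives \<open>m i * m k \<le> m j\<close> and \<open>m j * m k \<le> m i\<close>, hence
  \<open>m k * m k \<le> 1\<close>.
\<close>
lemma well_covered_imp_card_2:
  assumes wc: "well_covered (zero_divisor_graph PP)" and card: "3 \<le> card I" and k: "k \<in> I"
  shows "card (carrier (P k)) = 2"
proof -
  define m where "m = (\<lambda>i. card (carrier (P i)) - 1)"
  have m1: "1 \<le> m i" if "i \<in> I" for i using card_ge_2[OF that] by (simp add: m_def)
  have "1 < card (I - {k})" using card k finite_index by (simp add: card_Diff_singleton)
  then have "I - {k} \<noteq> {}" by (metis card.empty not_less_zero)
  then obtain i where i: "i \<in> I" "i \<noteq> k" by blast
  have "0 < card (I - {k} - {i})" using card k i finite_index by (simp add: card_Diff_singleton)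
  then have "I - {k} - {i} \<noteq> {}" by (metis card.empty not_less_zero)
  then obtain j where j: "j \<in> I" "j \<noteq> k" "j \<noteq> i" by blast
  have ge: "m a * m b \<le> m c" if "a \<in> I" "b \<in> I" "c \<in> I" "a \<noteq> b" "a \<noteq> c" "b \<noteq> c" for a b c
  proof -
    have "m c = (\<Prod>j\<in>I - {c}. m j)"
      unfolding m_def using that by (intro well_covered_imp_product[OF wc]) auto
    also have "\<dots> = m a * (m b * (\<Prod>j\<in>I - {c} - {a} - {b}. m j))"
      using that finite_index by (subst prod.remove[of _ a], simp, simp, subst prod.remove[of _ b]) auto
    finally have eq: "m c = m a * m b * (\<Prod>j\<in>I - {c} - {a} - {b}. m j)" by simp
    have "1 \<le> (\<Prod>j\<in>I - {c} - {a} - {b}. m j)" using m1 by (intro prod_ge_1) auto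
    then show ?thesis unfolding eq by simp
  qed
  have "m i * m k * m k \<le> m j * m k" using ge[of i k j] i j k by (intro mult_le_mono1) auto
  also have "\<dots> \<le> m i" using ge[of j k i] i j k by auto
  finally have "m i * (m k * m k) \<le> m i * 1" by (simp add: mult.assoc)
  then have le: "m k * m k \<le> 1" using m1[OF i(1)] by (subst (asm) mult_le_cancel1) simp
  have "m k = 1"
  proof (rule ccontr)
    assume "m k \<noteq> 1"
    then have "2 \<le> m k" using m1[OF k] by simp
    then have "2 * 2 \<le> m k * m k" by (intro mult_le_mono)
    then show False using le by simp
  qed
  then show ?thesis using card_ge_2[OF k] by (simp add: m_def)
qed

definition compl :: "('i \<Rightarrow> 'a) \<Rightarrow> 'i \<Rightarrow> 'a" where
  "compl a = (\<lambda>i\<in>I. if a i = \<bottom>\<^bsub>P i\<^esub> then \<top>\<^bsub>P i\<^esub> else \<bottom>\<^bsub>P i\<^esub>)"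

lemma compl_carrier: "compl a \<in> carrier PP"
  by (auto simp: compl_def carrier_PP factorD)

context
  assumes two: "i \<in> I \<Longrightarrow> card (carrier (P i)) = 2"
begin

lemma bottom_neq_top: assumes i: "i \<in> I" shows "\<bottom>\<^bsub>P i\<^esub> \<noteq> \<top>\<^bsub>P i\<^esub>"
proof
  assume eq: "\<bottom>\<^bsub>P i\<^esub> = \<top>\<^bsub>P i\<^esub>"
  obtain x where x: "x \<in> carrier (P i)" "x \<noteq> \<bottom>\<^bsub>P i\<^esub>" using nonbottom_exists[OF i] by blast
  have "x \<sqsubseteq>\<^bsub>P i\<^esub> \<bottom>\<^bsub>P i\<^esub>" unfolding eq by (rule factorD(4)[OF i x(1)])
  then have "x = \<bottom>\<^bsub>P i\<^esub>"
    by (intro factorD(6)[OF i x(1) factorD(1)[OF i]] factorD(3)[OF i x(1)])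
  then show False using x(2) by simp
qed

lemma two_cases: assumes i: "i \<in> I" shows "carrier (P i) = {\<bottom>\<^bsub>P i\<^esub>, \<top>\<^bsub>P i\<^esub>}"
proof -
  have "{\<bottom>\<^bsub>P i\<^esub>, \<top>\<^bsub>P i\<^esub>} \<subseteq> carrier (P i)" using factorD(1,2)[OF i] by simp
  moreover have "card {\<bottom>\<^bsub>P i\<^esub>, \<top>\<^bsub>P i\<^esub>} = card (carrier (P i))" using bottom_neq_top[OF i] two[OF i] by simp
  ultimately show ?thesis using card_subset_eq[OF finite_factor[OF i]] by metis
qed

lemma two_values: "a \<in> carrier PP \<Longrightarrow> i \<in> I \<Longrightarrow> a i = \<bottom>\<^bsub>P i\<^esub> \<or> a i = \<top>\<^bsub>P i\<^esub>"
  using comp[of a i] two_cases[of i] by simp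

lemma le_iff_supp:
  assumes ab: "a \<in> carrier PP" "b \<in> carrier PP" shows "a \<sqsubseteq>\<^bsub>PP\<^esub> b \<longleftrightarrow> supp a \<subseteq> supp b"
proof -
  have "a i \<sqsubseteq>\<^bsub>P i\<^esub> b i \<longleftrightarrow> (i \<in> supp a \<longrightarrow> i \<in> supp b)" if i: "i \<in> I" for i
  proof -
    have "\<not> \<top>\<^bsub>P i\<^esub> \<sqsubseteq>\<^bsub>P i\<^esub> \<bottom>\<^bsub>P i\<^esub>"
      using factorD(6)[OF i factorD(2)[OF i] factorD(1)[OF i]] factorD(3)[OF i factorD(2)[OF i]] bottom_neq_top[OF i]
      by auto
    then show ?thesis
      using two_values[OF ab(1) i] two_values[OF ab(2) i] bottom_neq_top[OF i] i
        factorD(3)[OF i comp[OF ab(2) i]] factorD(4)[OF i comp[OF ab(1) i]]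
      by (auto simp: supp_def)
  qed
  then show ?thesis unfolding le_PP by (auto simp: supp_def)
qed

lemma supp_inj: assumes "a \<in> carrier PP" "b \<in> carrier PP" "supp a = supp b" shows "a = b"
  using assms le_iff_supp[of a b] le_iff_supp[of b a] bounded_posetD(6)[OF bounded_PP] by simp

lemma supp_compl: "supp (compl a) = I - supp a"
  by (auto simp: supp_def compl_def bottom_neq_top bottom_neq_top[symmetric])

definition of_supp :: "'i set \<Rightarrow> 'i \<Rightarrow> 'a" where
  "of_supp A = (\<lambda>i\<in>I. if i \<in> A then \<top>\<^bsub>P i\<^esub> else \<bottom>\<^bsub>P i\<^esub>)"

lemma of_supp_carrier: "of_supp A \<in> carrier PP"
  by (auto simp: of_supp_def carrier_PP factorD)

lemma supp_of_supp: "supp (of_supp A) = A \<inter> I"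
  by (auto simp: supp_def of_supp_def bottom_neq_top bottom_neq_top[symmetric])

lemma supp_subset: "supp a \<subseteq> I"
  by (auto simp: supp_def)

lemma least_join:
  assumes ab: "a \<in> carrier PP" "b \<in> carrier PP"
  shows "least PP (of_supp (supp a \<union> supp b)) (Upper PP {a, b})"
proof (rule least_UpperI)
  show "x \<sqsubseteq>\<^bsub>PP\<^esub> of_supp (supp a \<union> supp b)" if "x \<in> {a, b}" for x
    using that ab supp_subset by (auto simp: le_iff_supp of_supp_carrier supp_of_supp)
  show "of_supp (supp a \<union> supp b) \<sqsubseteq>\<^bsub>PP\<^esub> y" if "y \<in> Upper PP {a, b}" for y
  proof -
    have "y \<in> carrier PP" "a \<sqsubseteq>\<^bsub>PP\<^esub> y" "b \<sqsubseteq>\<^bsub>PP\<^esub> y" using that ab by (auto simp: Upper_def)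
    then show ?thesis using ab by (auto simp: le_iff_supp of_supp_carrier supp_of_supp)
  qed
qed (use ab of_supp_carrier in auto)

lemma greatest_meet:
  assumes ab: "a \<in> carrier PP" "b \<in> carrier PP"
  shows "greatest PP (of_supp (supp a \<inter> supp b)) (Lower PP {a, b})"
proof (rule greatest_LowerI)
  show "of_supp (supp a \<inter> supp b) \<sqsubseteq>\<^bsub>PP\<^esub> x" if "x \<in> {a, b}" for x
    using that ab by (auto simp: le_iff_supp of_supp_carrier supp_of_supp)
  show "y \<sqsubseteq>\<^bsub>PP\<^esub> of_supp (supp a \<inter> supp b)" if "y \<in> Lower PP {a, b}" for y
  proof -
    have "y \<in> carrier PP" "y \<sqsubseteq>\<^bsub>PP\<^esub> a" "y \<sqsubseteq>\<^bsub>PP\<^esub> b" using that ab by (auto simp: Lower_def)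
    then show ?thesis using ab supp_subset[of y] by (auto simp: le_iff_supp of_supp_carrier supp_of_supp)
  qed
qed (use ab of_supp_carrier in auto)

lemma boolean_lattice_PP: "boolean_lattice PP"
proof -
  have bp: "partial_order PP" "weak_partial_order_bottom PP" "weak_partial_order_top PP"
    using bounded_PP by (auto simp: bounded_poset_def)
  have us: "upper_semilattice PP"
    using bp(1) least_join by (intro upper_semilattice.intro upper_semilattice_axioms.intro) blast+
  have ls: "lower_semilattice PP"
    using bp(1) greatest_meet by (intro lower_semilattice.intro lower_semilattice_axioms.intro) blast+
  have bl: "bounded_lattice PP"
    using us ls bp by (intro bounded_lattice.intro lattice.intro)
  interpret partial_order PP by (rule bp(1))
  interpret us: upper_semilattice PP by (rule us)
  interpret ls: lower_semilattice PP by (rule ls)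
  have join: "a \<squnion>\<^bsub>PP\<^esub> b = of_supp (supp a \<union> supp b)" if "a \<in> carrier PP" "b \<in> carrier PP" for a b
    by (rule us.joinI[OF _ that]) (rule least_unique[OF _ least_join[OF that]])
  have meet: "a \<sqinter>\<^bsub>PP\<^esub> b = of_supp (supp a \<inter> supp b)" if "a \<in> carrier PP" "b \<in> carrier PP" for a b
    by (rule ls.meetI[OF _ that]) (rule greatest_unique[OF _ greatest_meet[OF that]])
  have dist: "a \<sqinter>\<^bsub>PP\<^esub> (b \<squnion>\<^bsub>PP\<^esub> c) = (a \<sqinter>\<^bsub>PP\<^esub> b) \<squnion>\<^bsub>PP\<^esub> (a \<sqinter>\<^bsub>PP\<^esub> c)"
    if "a \<in> carrier PP" "b \<in> carrier PP" "c \<in> carrier PP" for a b c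
  proof -
    have "supp a \<inter> (supp b \<union> supp c) \<inter> I = (supp a \<inter> supp b \<inter> I) \<union> (supp a \<inter> supp c \<inter> I)" by blast
    moreover have "(supp b \<union> supp c) \<inter> I = supp b \<union> supp c" using supp_subset by blast
    moreover have "of_supp (supp a \<inter> (supp b \<union> supp c)) = of_supp (supp a \<inter> (supp b \<union> supp c) \<inter> I)"
      by (auto simp: of_supp_def)
    ultimately show ?thesis using that by (simp add: join meet of_supp_carrier supp_of_supp)
  qed
  have "is_complement PP a (compl a)" if a: "a \<in> carrier PP" for a
    unfolding is_complement_def
  proof
    show "Lower PP {a, compl a} = {\<bottom>\<^bsub>PP\<^esub>}"
      using a by (simp add: disjoint_iff_supp compl_carrier supp_compl)
    show "Upper PP {a, compl a} = {\<top>\<^bsub>PP\<^esub>}"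
    proof
      show "{\<top>\<^bsub>PP\<^esub>} \<subseteq> Upper PP {a, compl a}"
        using bounded_posetD(2,4)[OF bounded_PP] by (auto simp: Upper_def)
      show "Upper PP {a, compl a} \<subseteq> {\<top>\<^bsub>PP\<^esub>}"
      proof
        fix u assume "u \<in> Upper PP {a, compl a}"
        then have u: "u \<in> carrier PP" "a \<sqsubseteq>\<^bsub>PP\<^esub> u" "compl a \<sqsubseteq>\<^bsub>PP\<^esub> u"
          using a compl_carrier by (auto simp: Upper_def)
        then have "supp u = I"
          using a compl_carrier supp_subset[of u] by (auto simp: le_iff_supp supp_compl)
        moreover have "supp one = I" by (auto simp: supp_def one_def bottom_neq_top bottom_neq_top[symmetric])
        ultimately have "u = one" using supp_inj[OF u(1) bot_one_carrier(2)] by simp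
        then show "u \<in> {\<top>\<^bsub>PP\<^esub>}" by (simp add: top_PP)
      qed
    qed
  qed
  then have "complemented_poset PP"
    using bounded_PP compl_carrier unfolding complemented_poset_def by blast
  then show ?thesis using bl dist by (simp add: boolean_lattice_def)
qed

text \<open>
  The product is the lattice of subsets of \<open>I\<close>. The matching pairs a set avoiding \<open>q\<close> with its complement;
  the partners all contain \<open>q\<close> and so are independent.
\<close>
lemma cohen_macaulay_zero_divisor_graph:
  assumes q: "q \<in> I"
  shows "cohen_macaulay_graph TYPE('k::field) (zero_divisor_graph PP)"
proof -
  let ?G = "zero_divisor_graph PP"
  define L where "L = {v \<in> V. q \<notin> supp v}"
  have Vc: "v \<in> carrier PP" if "v \<in> V" for v using that by (simp add: V_def)
  have complV: "compl v \<in> V" if "v \<in> V" for v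
    using that supp_subset[of v] by (auto simp: V_def compl_carrier supp_compl)
  have compl_compl: "compl (compl v) = v" if "v \<in> V" for v
    using supp_subset[of v] by (intro supp_inj compl_carrier Vc that) (auto simp: supp_compl)
  have below: "{t, compl k} \<in> edges ?G \<longleftrightarrow> supp t \<subseteq> supp k" if "t \<in> V" "k \<in> V" for t k
    using that complV supp_subset[of t] by (auto simp: edge_iff supp_compl)
  interpret ordered_matching ?G L compl "\<lambda>v. card (supp v)"
  proof
    show "finite_simple_graph ?G" by (rule graph_zero_divisor)
    show "vertices ?G = L \<union> compl ` L"
      unfolding vertices_zero_divisor_graph
    proof
      show "V \<subseteq> L \<union> compl ` L"
      proof
        fix v assume v: "v \<in> V"
        show "v \<in> L \<union> compl ` L"
        proof (cases "q \<in> supp v")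
          case True
          then have "compl v \<in> L" using v complV q by (auto simp: L_def supp_compl)
          then show ?thesis using compl_compl[OF v] by (metis UnI2 imageI)
        qed (use v in \<open>simp add: L_def\<close>)
      qed
      show "L \<union> compl ` L \<subseteq> V" using complV by (auto simp: L_def)
    qed
    show "inj_on compl L" by (rule inj_on_inverseI[of _ compl]) (auto simp: L_def compl_compl)
    show "L \<inter> compl ` L = {}" using q by (auto simp: L_def supp_compl)
    show "{compl i, compl j} \<notin> edges ?G" if "i \<in> L" "j \<in> L" for i j
      using that q by (auto simp: L_def edge_iff supp_compl)
    show "{k, compl k} \<in> edges ?G" if "k \<in> L" for k
      using that by (auto simp: L_def below)
    show "{t, compl j} \<in> edges ?G"
      if "t \<in> L" "k \<in> L" "j \<in> L" "t \<noteq> k" "{t, compl k} \<in> edges ?G" "{k, compl j} \<in> edges ?G" for t k j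
      using that by (auto simp: L_def below)
    show "{j, t} \<in> edges ?G"
      if "t \<in> L" "k \<in> L" "j \<in> L" "t \<noteq> k" "{t, compl k} \<in> edges ?G" "{j, k} \<in> edges ?G" for t k j
    proof -
      have "supp t \<subseteq> supp k" using that by (simp add: L_def below)
      then show ?thesis using that by (auto simp: L_def edge_iff)
    qed
    show "card (supp t) < card (supp k)" if "t \<in> L" "k \<in> L" "t \<noteq> k" "{t, compl k} \<in> edges ?G" for t k
    proof (rule psubset_card_mono)
      show "finite (supp k)" using supp_subset finite_index by (rule finite_subset)
      have tk: "t \<in> V" "k \<in> V" using that by (auto simp: L_def)
      then have "supp t \<subseteq> supp k" using that(4) below by simp
      then show "supp t \<subset> supp k" using supp_inj[OF Vc[OF tk(1)] Vc[OF tk(2)]] that(3) by blast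
    qed
  qed
  show ?thesis by (rule cohen_macaulay)
qed

end

text \<open>
  Let \<open>a\<close> have the component \<open>x\<close>, different from the bottom, at \<open>i\<close> and the bottom elsewhere. A complement
  of \<open>a\<close> has the bottom at \<open>i\<close>, so the top with its component at \<open>i\<close> replaced by \<open>x\<close> is above both, and
  \<open>x\<close> must be the top.
\<close>
lemma complemented_imp_card_2:
  assumes C: "complemented_poset PP" and i: "i \<in> I"
  shows "card (carrier (P i)) = 2"
proof -
  have "x = \<bottom>\<^bsub>P i\<^esub> \<or> x = \<top>\<^bsub>P i\<^esub>" if x: "x \<in> carrier (P i)" for x
  proof (rule disjCI)
    assume nt: "x \<noteq> \<top>\<^bsub>P i\<^esub>"
    define a where "a = bot(i := x)"
    have a: "a \<in> carrier PP" unfolding a_def by (rule update_carrier[OF bot_one_carrier(1) i x])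
    obtain a' where a': "a' \<in> carrier PP" "is_complement PP a a'"
      using C a unfolding complemented_poset_def by blast
    have "supp a \<inter> supp a' = {}" using a' a disjoint_iff_supp by (simp add: is_complement_def)
    show "x = \<bottom>\<^bsub>P i\<^esub>"
    proof (rule ccontr)
      assume "x \<noteq> \<bottom>\<^bsub>P i\<^esub>"
      then have "i \<in> supp a" using i by (simp add: supp_def a_def)
      then have a'i: "a' i = \<bottom>\<^bsub>P i\<^esub>" using \<open>supp a \<inter> supp a' = {}\<close> i by (auto simp: supp_def)
      define u where "u = one(i := x)"
      have u: "u \<in> carrier PP" unfolding u_def by (rule update_carrier[OF bot_one_carrier(2) i x])
      have "a \<sqsubseteq>\<^bsub>PP\<^esub> u" using x i by (auto simp: le_PP a_def u_def bot_def one_def factorD)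
      moreover have "a' \<sqsubseteq>\<^bsub>PP\<^esub> u"
        using x i a'i a'(1) by (auto simp: le_PP u_def one_def factorD comp)
      ultimately have "u \<in> Upper PP {a, a'}" using u by (auto simp: Upper_def)
      then have "u = one" using a'(2) by (simp add: is_complement_def top_PP)
      then have "u i = one i" by (rule fun_cong)
      then show False using nt i by (simp add: u_def one_def)
    qed
  qed
  then have "carrier (P i) \<subseteq> {\<bottom>\<^bsub>P i\<^esub>, \<top>\<^bsub>P i\<^esub>}" by blast
  then have "card (carrier (P i)) \<le> card {\<bottom>\<^bsub>P i\<^esub>, \<top>\<^bsub>P i\<^esub>}" by (rule card_mono[rotated]) simp
  also have "\<dots> \<le> 2" by (simp add: card_insert_if)
  finally show ?thesis using card_ge_2[OF i] by simp
qed

end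

theorem theorem1p3:
  fixes n :: nat and P :: "nat \<Rightarrow> 'a gorder"
  defines "PP \<equiv> product_poset {1..n} P"
  assumes "n \<ge> 3"
    and "\<And>i. i \<in> {1..n} \<Longrightarrow> bounded_poset (P i)"
    and "\<And>i. i \<in> {1..n} \<Longrightarrow> finite (carrier (P i))"
    and "\<And>i. i \<in> {1..n} \<Longrightarrow> poset_zero_divisors (P i) = {\<bottom>\<^bsub>P i\<^esub>}"
    and "2 \<le> card (carrier (P 1))"
    and "\<And>i. 1 \<le> i \<Longrightarrow> i < n \<Longrightarrow> card (carrier (P i)) \<le> card (carrier (P (Suc i)))"
  shows
    "(cohen_macaulay_graph TYPE('k::field) (zero_divisor_graph PP) \<longleftrightarrow>
        well_covered (zero_divisor_graph PP)) \<and>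
     (well_covered (zero_divisor_graph PP) \<longleftrightarrow> (\<forall>i\<in>{1..n}. card (carrier (P i)) = 2)) \<and>
     ((\<forall>i\<in>{1..n}. card (carrier (P i)) = 2) \<longleftrightarrow> boolean_lattice PP) \<and>
     (boolean_lattice PP \<longleftrightarrow> boolean_poset PP)"
proof -
  interpret F: zero_divisor_free_family "{1..n}" P
    using assms(3-5) by unfold_locales auto
  have two_CM: "cohen_macaulay_graph TYPE('k) (zero_divisor_graph PP)"
    if "\<forall>i\<in>{1..n}. card (carrier (P i)) = 2"
    unfolding PP_def using that assms(2) by (intro F.cohen_macaulay_zero_divisor_graph[of 1]) auto
  have CM_wc: "well_covered (zero_divisor_graph PP)"
    if "cohen_macaulay_graph TYPE('k) (zero_divisor_graph PP)"
    using that by (rule cohen_macaulay_imp_well_covered)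
  have wc_two: "\<forall>i\<in>{1..n}. card (carrier (P i)) = 2" if "well_covered (zero_divisor_graph PP)"
    using that assms(2) unfolding PP_def by (intro ballI F.well_covered_imp_card_2) auto
  have two_lattice: "boolean_lattice PP" if "\<forall>i\<in>{1..n}. card (carrier (P i)) = 2"
    unfolding PP_def using that by (intro F.boolean_lattice_PP) auto
  have lattice_poset: "boolean_poset PP" if "boolean_lattice PP"
    using that by (rule boolean_lattice_imp_boolean_poset)
  have poset_two: "\<forall>i\<in>{1..n}. card (carrier (P i)) = 2" if "boolean_poset PP"
    using that unfolding PP_def boolean_poset_def by (intro ballI F.complemented_imp_card_2) auto
  show ?thesis using two_CM CM_wc wc_two two_lattice lattice_poset poset_two by blast
qed

end
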